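(* Let $T>0$ and let $\mathbf Z:[-T,T]\to\mathbb R^{2N}$ be a solution of $\dot{\mathbf Z}\in\operatorname{co}F(\mathbf Z)$, $\mathbf Z(0)=\mathbf Z_0$, where $\mathbf Z_0\in\mathcal D(F)$. Assume that there exist $t_1\in(-T,T)$ and $\mathbf Z_1\in\mathcal I_\ell$, for some $\ell\in\{1,\dots,N\}$, such that $\mathbf Z(t_1)=\mathbf Z_1$ and $$\widehat{\mathbf f}^-(\mathbf Z_1)\cdot\mathbf n(\mathbf Z_1)>0\qquad\text{and}\qquad\widehat{\mathbf f}^+(\mathbf Z_1)\cdot\mathbf n(\mathbf Z_1)<0,$$ where $\widehat{\mathbf f}^\pm$ and $\mathbf n$ are associated with the base point $\hat{\mathbf Z}=\mathbf Z_1$ (see context). Then right uniqueness holds for $\dot{\mathbf Z}\in\operatorname{co}F(\mathbf Z)$ at the point $(t_1,\mathbf Z_1)$, and there exists $\delta>0$ such that $\mathbf Z(t)$ belongs to $\mathcal A_\ell$ and solves, for all $t\in[t_1,t_1+\delta]$, the ordinary differential equation $$\dot{\mathbf Z}=\mathbf f^0(\mathbf Z)\in\operatorname{co}F(\mathbf Z),\qquad \mathbf f^0(\mathbf Z):=\alpha(\mathbf Z)\widehat{\mathbf f}^+(\mathbf Z)+(1-\alpha(\mathbf Z))\widehat{\mathbf f}^-(\mathbf Z),$$ where $\alpha(\mathbf Z)\in(0,1)$ is defined by $$\alpha(\mathbf Z):=\frac{\widehat{\mathbf f}^-(\mathbf Z)\cdot\mathbf n(\mathbf Z)}{\widehat{\mathbf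 f}^-(\mathbf Z)\cdot\mathbf n(\mathbf Z)-\widehat{\mathbf f}^+(\mathbf Z)\cdot\mathbf n(\mathbf Z)}.$$
   Context: Setting. $\Omega\subset\mathbb R^2$ is a bounded simply connected open set with $C^{2,\gamma}$ boundary for some $\gamma\in(0,1)$, with outer unit normal $\mathbf n_\Omega$; $N\ge1$ is an integer, and $b_1,\dots,b_N\in\mathbb R$ are the Burgers moduli. Let $\mu>0$, $\lambda\neq0$ and $$\mathbf L=\begin{pmatrix}\mu&0\\0&\mu\lambda^2\end{pmatrix},\quad \mathbf J=\begin{pmatrix}0&1\\-1&0\end{pmatrix},\quad \boldsymbol\Lambda=\begin{pmatrix}\lambda&0\\0&1\end{pmatrix},\quad \mathbf k_i(\mathbf x;\mathbf y)=\frac{b_i}{2\pi}\frac{\lambda\mathbf J^T(\mathbf x-\mathbf y)}{|\boldsymbol\Lambda(\mathbf x-\mathbf y)|^2}\ (\mathbf x\ne\mathbf y).$$ Set $\mathcal D(F)=\{\mathbf Z=(\mathbf z_1,\dots,\mathbf z_N)\in\Omega^N:\ \mathbf z_j\neq\mathbf z_k\text{ for all }j\ne k\}\subset\mathbb R^{2N}$. For $\mathbf Z\in\mathcal D(F)$ let $u_0(\cdot;\mathbf z_1,\dots,\mathbf z_N)$ be the solution (unique up to an additive constant) of the Neumann problem $\operatorname{div}(\mathbf L\nabla_{\mathbf x}u_0)=0$ in $\Omega$, $\mathbf L(\nabla_{\mathbf x}u_0+\sum_{i=1}^N\mathbf k_i(\mathbf x;\mathbf z_i))\cdot\mathbf n_\Omega(\mathbf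 x)=0$ on $\partial\Omega$. The Peach-Köhler force on the $\ell$-th dislocation is $$\mathbf j_\ell(\mathbf Z)=b_\ell\,\mathbf J\mathbf L\Big[\sum_{i\ne\ell}\mathbf k_i(\mathbf z_\ell;\mathbf z_i)+\nabla_{\mathbf x}u_0(\mathbf z_\ell;\mathbf z_1,\dots,\mathbf z_N)\Big].$$ The set of glide directions $\mathcal G\subset S^1$ is a finite set of unit vectors of $\mathbb R^2$ with $-\mathbf g\in\mathcal G$ whenever $\mathbf g\in\mathcal G$ and $\operatorname{span}\mathcal G=\mathbb R^2$. Set $\mathcal G_\ell(\mathbf Z)=\arg\max_{\mathbf g\in\mathcal G}\{\mathbf j_\ell(\mathbf Z)\cdot\mathbf g\}$, $F_\ell(\mathbf Z)=\{(\mathbf j_\ell(\mathbf Z)\cdot\mathbf g)\mathbf g:\mathbf g\in\mathcal G_\ell(\mathbf Z)\}$, $F(\mathbf Z)=F_1(\mathbf Z)\times\cdots\times F_N(\mathbf Z)\subset\mathbb R^{2N}$. $\operatorname{co}$ denotes the convex hull. A solution of $\dot{\mathbf Z}\in\operatorname{co}F(\mathbf Z)$ on an interval $I$ is an absolutely continuous function $\mathbf Z$ on $I$ with $\mathbf Z(t)\in\mathcal D(F)$ for $t\in I$ and $\dot{\mathbf Z}(t)\in\operatorname{co}F(\mathbf Z(t))$ for a.e. $t\in I$. Ambiguity sets. $\mathcal A_\ell=\{\mathbf Z\in\mathcal D(F):\operatorname{card}\mathcal G_\ell(\mathbf Z)=2\}$; for $\mathbf Z\in\mathcal A_\ell$ write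 $\mathcal G_\ell(\mathbf Z)=\{\mathbf g_\ell^+(\mathbf Z),\mathbf g_\ell^-(\mathbf Z)\}$. If $\mathcal G_k(\mathbf Z)$ is a singleton, its element is denoted $\mathbf g_k(\mathbf Z)$. The singular set $\mathcal S_\ell$ is the set of $\mathbf Z^*\in\mathcal A_\ell$ such that, with the constant vector $\mathbf g_0=\mathbf g_\ell^+(\mathbf Z^* )-\mathbf g_\ell^-(\mathbf Z^* )$, the function $\mathbf Z\mapsto\mathbf j_\ell(\mathbf Z)\cdot\mathbf g_0$ and its full gradient in $\mathbb R^{2N}$ both vanish at $\mathbf Z^*$. Further, $\mathcal E_{\rm int}=\{\mathbf Z:\mathbf Z\in\mathcal A_\ell\cap\mathcal A_j\text{ for some }\ell\ne j\}$, $\mathcal E_{\rm zero}=\{\mathbf Z\in\mathcal D(F):\mathbf j_k(\mathbf Z)=\mathbf 0\text{ for some }k\}$, and $\mathcal I_\ell=\mathcal A_\ell\setminus(\mathcal S_\ell\cup\mathcal E_{\rm int}\cup\mathcal E_{\rm zero})$. Local fields. Let $\hat{\mathbf Z}\in\mathcal I_\ell$. For $r>0$ small, $\mathcal A_\ell\cap B_r(\hat{\mathbf Z})$ is a smooth $(2N-1)$-dimensional manifold dividing $B_r(\hat{\mathbf Z})\subset\mathcal D(F)$ into two disjoint open sets $V^\pm$ such that $\mathcal G_\ell(\mathbf Z)=\{\mathbf g_\ell^\pm(\hat{\mathbf Z})\}$ for $\mathbf Z\in V^\pm$ (respectively), and $\mathcal G_k(\mathbf Z)=\{\mathbf g_k(\hat{\mathbf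 Z})\}$ on $B_r(\hat{\mathbf Z})$ for $k\neq\ell$. On $B_r(\hat{\mathbf Z})$ define $\widehat{\mathbf f}^\pm=(\widehat{\mathbf f}^\pm_1,\dots,\widehat{\mathbf f}^\pm_N)$ by $\widehat{\mathbf f}^\pm_k(\mathbf Z)=(\mathbf j_k(\mathbf Z)\cdot\mathbf g_k(\hat{\mathbf Z}))\mathbf g_k(\hat{\mathbf Z})$ for $k\ne\ell$ and $\widehat{\mathbf f}^\pm_\ell(\mathbf Z)=(\mathbf j_\ell(\mathbf Z)\cdot\mathbf g^\pm_\ell(\hat{\mathbf Z}))\mathbf g^\pm_\ell(\hat{\mathbf Z})$. $\mathbf n(\mathbf Z)$ is the unit normal to $\mathcal A_\ell$ at $\mathbf Z\in\mathcal A_\ell\cap B_r(\hat{\mathbf Z})$ directed from $V^-$ to $V^+$. Right uniqueness for $\dot{\mathbf Z}\in\operatorname{co}F(\mathbf Z)$ at $(t_1,\mathbf Z_1)$ means: there exists $t_2>t_1$ such that any two solutions of the inclusion taking the value $\mathbf Z_1$ at time $t_1$ coincide on the subset of $[t_1,t_2]$ on which they are both defined. *)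

theory Defs
  imports "HOL-Analysis.Analysis"
begin

section \<open>Differential operators and absolute continuity\<close>

definition grad :: "('a::real_inner \<Rightarrow> real) \<Rightarrow> 'a \<Rightarrow> 'a" where
  "grad f x = (THE D. GDERIV f x :> D)"

definition divergence :: "(real^2 \<Rightarrow> real^2) \<Rightarrow> real^2 \<Rightarrow> real" where
  "divergence X x = (\<Sum>i\<in>UNIV. frechet_derivative X (at x) (axis i 1) $ i)"

definition C1_on :: "'a::euclidean_space set \<Rightarrow> ('a \<Rightarrow> 'b::real_normed_vector) \<Rightarrow> bool" where
  "C1_on S f \<longleftrightarrow> (\<forall>x\<in>S. f differentiable (at x)) \<and>
     (\<forall>v. continuous_on S (\<lambda>x. frechet_derivative f (at x) v))"

definition C2_on :: "'a::euclidean_space set \<Rightarrow> ('a \<Rightarrow> real) \<Rightarrow> bool" where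
  "C2_on S u \<longleftrightarrow> C1_on S u \<and> C1_on S (grad u)"

definition absolutely_continuous_fun_on :: "real set \<Rightarrow> (real \<Rightarrow> 'a::real_normed_vector) \<Rightarrow> bool" where
  "absolutely_continuous_fun_on I f \<longleftrightarrow>
     (\<forall>\<epsilon>>0. \<exists>\<delta>>0. \<forall>P :: (real \<times> real) set.
        finite P \<longrightarrow> (\<forall>(a, b)\<in>P. a \<le> b \<and> {a..b} \<subseteq> I) \<longrightarrow>
        disjoint_family_on (\<lambda>(a, b). {a<..<b}) P \<longrightarrow>
        (\<Sum>(a, b)\<in>P. b - a) < \<delta> \<longrightarrow>
        (\<Sum>(a, b)\<in>P. norm (f b - f a)) < \<epsilon>)"


section \<open>Planar domains\<close>

definition J_mat :: "real^2^2" where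
  "J_mat = vector [vector [0, 1], vector [-1, 0]]"

definition C2_holder :: "real \<Rightarrow> (real \<Rightarrow> real) \<Rightarrow> bool" where
  "C2_holder \<gamma> \<phi> \<longleftrightarrow> (\<exists>\<phi>' \<phi>'' C.
     (\<forall>s. (\<phi> has_real_derivative \<phi>' s) (at s)) \<and>
     (\<forall>s. (\<phi>' has_real_derivative \<phi>'' s) (at s)) \<and>
     (\<forall>s t. \<bar>\<phi>'' s - \<phi>'' t\<bar> \<le> C * \<bar>s - t\<bar> powr \<gamma>))"

text \<open>Near each boundary point, the domain is the side of a \<open>C\<^sup>2\<^sup>,\<^sup>\<gamma>\<close> graph in the
  orthonormal coordinates \<open>(J e, e)\<close>.\<close>

definition C2_holder_boundary :: "real \<Rightarrow> (real^2) set \<Rightarrow> bool" where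
  "C2_holder_boundary \<gamma> \<Omega> \<longleftrightarrow>
     (\<forall>p\<in>frontier \<Omega>. \<exists>e r \<phi>. norm e = 1 \<and> r > 0 \<and> C2_holder \<gamma> \<phi> \<and>
        (\<forall>x\<in>ball p r. x \<in> \<Omega> \<longleftrightarrow> \<phi> (x \<bullet> (J_mat *v e)) < x \<bullet> e))"

text \<open>For a \<open>C\<^sup>1\<close> domain this relation holds for exactly one vector at each boundary point:
  directions making an obtuse angle with it enter the domain, those making an acute angle
  leave it.\<close>

definition outer_unit_normal :: "(real^2) set \<Rightarrow> real^2 \<Rightarrow> real^2 \<Rightarrow> bool" where
  "outer_unit_normal \<Omega> x \<nu> \<longleftrightarrow> norm \<nu> = 1 \<and>
     (\<forall>v. (v \<bullet> \<nu> < 0 \<longrightarrow> (\<forall>\<^sub>F t in at_right 0. x + t *\<^sub>R v \<in> \<Omega>)) \<and>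
          (v \<bullet> \<nu> > 0 \<longrightarrow> (\<forall>\<^sub>F t in at_right 0. x + t *\<^sub>R v \<notin> closure \<Omega>)))"


section \<open>The Peach--Koehler force\<close>

text \<open>A configuration of dislocations is a point of \<open>(\<real>\<^sup>2)\<^sup>N\<close>, represented by the type
  \<open>(real^2)^'n\<close> with \<open>N = CARD('n)\<close>; its Euclidean structure is that of \<open>\<real>\<^sup>2\<^sup>N\<close>.\<close>

definition L_mat :: "real \<Rightarrow> real \<Rightarrow> real^2^2" where
  "L_mat \<mu> lam = vector [vector [\<mu>, 0], vector [0, \<mu> * lam\<^sup>2]]"

definition Lambda_mat :: "real \<Rightarrow> real^2^2" where
  "Lambda_mat lam = vector [vector [lam, 0], vector [0, 1]]"

definition kfield :: "real \<Rightarrow> real \<Rightarrow> real^2 \<Rightarrow> real^2 \<Rightarrow> real^2" where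
  "kfield lam \<beta> x y =
     (\<beta> / (2 * pi)) *\<^sub>R (lam / (norm (Lambda_mat lam *v (x - y)))\<^sup>2) *\<^sub>R (transpose J_mat *v (x - y))"

definition configs :: "(real^2) set \<Rightarrow> ((real^2)^'n) set" where
  "configs \<Omega> = {Z. (\<forall>i. Z $ i \<in> \<Omega>) \<and> (\<forall>j k. j \<noteq> k \<longrightarrow> Z $ j \<noteq> Z $ k)}"

text \<open>Classical solutions, of class \<open>C\<^sup>2(\<Omega>) \<inter> C\<^sup>1(closure \<Omega>)\<close>; \<open>D\<close> is the continuous
  extension of the gradient to the closure.\<close>

definition neumann_solution ::
  "(real^2) set \<Rightarrow> real \<Rightarrow> real \<Rightarrow> ('n::finite \<Rightarrow> real) \<Rightarrow> (real^2)^'n \<Rightarrow> (real^2 \<Rightarrow> real) \<Rightarrow> bool" where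
  "neumann_solution \<Omega> \<mu> lam b Z u \<longleftrightarrow>
     C2_on \<Omega> u \<and>
     (\<forall>x\<in>\<Omega>. divergence (\<lambda>y. L_mat \<mu> lam *v grad u y) x = 0) \<and>
     (\<exists>D. continuous_on (closure \<Omega>) D \<and> (\<forall>x\<in>\<Omega>. D x = grad u x) \<and>
        (\<forall>x\<in>frontier \<Omega>. \<forall>\<nu>. outer_unit_normal \<Omega> x \<nu> \<longrightarrow>
           (L_mat \<mu> lam *v (D x + (\<Sum>i\<in>UNIV. kfield lam (b i) x (Z $ i)))) \<bullet> \<nu> = 0))"

definition peach_koehler ::
  "real \<Rightarrow> real \<Rightarrow> ('n::finite \<Rightarrow> real) \<Rightarrow> ((real^2)^'n \<Rightarrow> real^2 \<Rightarrow> real) \<Rightarrow> 'n \<Rightarrow> (real^2)^'n \<Rightarrow> real^2" where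
  "peach_koehler \<mu> lam b u0 l Z =
     b l *\<^sub>R (J_mat *v (L_mat \<mu> lam *v
       ((\<Sum>i\<in>UNIV - {l}. kfield lam (b i) (Z $ l) (Z $ i)) + grad (u0 Z) (Z $ l))))"


section \<open>The differential inclusion\<close>

text \<open>From here on \<open>j :: 'n \<Rightarrow> (real^2)^'n \<Rightarrow> real^2\<close> stands for the family of forces.\<close>

definition glide_directions :: "(real^2) set \<Rightarrow> bool" where
  "glide_directions G \<longleftrightarrow> finite G \<and> (\<forall>g\<in>G. norm g = 1) \<and> (\<forall>g\<in>G. - g \<in> G) \<and> span G = UNIV"

definition max_glide ::
  "(real^2) set \<Rightarrow> ('n \<Rightarrow> (real^2)^'n \<Rightarrow> real^2) \<Rightarrow> 'n \<Rightarrow> (real^2)^'n \<Rightarrow> (real^2) set" where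
  "max_glide G j l Z = {g. is_arg_max (\<lambda>h. j l Z \<bullet> h) (\<lambda>h. h \<in> G) g}"

definition Fset ::
  "(real^2) set \<Rightarrow> ('n \<Rightarrow> (real^2)^'n \<Rightarrow> real^2) \<Rightarrow> (real^2)^'n \<Rightarrow> ((real^2)^'n) set" where
  "Fset G j Z = {W. \<forall>l. W $ l \<in> {(j l Z \<bullet> g) *\<^sub>R g | g. g \<in> max_glide G j l Z}}"

definition inclusion_solution ::
  "(real^2) set \<Rightarrow> (real^2) set \<Rightarrow> ('n::finite \<Rightarrow> (real^2)^'n \<Rightarrow> real^2) \<Rightarrow> real set \<Rightarrow>
   (real \<Rightarrow> (real^2)^'n) \<Rightarrow> bool" where
  "inclusion_solution \<Omega> G j I Z \<longleftrightarrow>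
     is_interval I \<and> absolutely_continuous_fun_on I Z \<and> (\<forall>t\<in>I. Z t \<in> configs \<Omega>) \<and>
     (AE t in lborel. t \<in> I \<longrightarrow>
        (\<exists>V \<in> convex hull (Fset G j (Z t)). (Z has_vector_derivative V) (at t within I)))"

definition right_unique ::
  "(real^2) set \<Rightarrow> (real^2) set \<Rightarrow> ('n::finite \<Rightarrow> (real^2)^'n \<Rightarrow> real^2) \<Rightarrow> real \<Rightarrow>
   (real^2)^'n \<Rightarrow> bool" where
  "right_unique \<Omega> G j t1 Z1 \<longleftrightarrow>
     (\<exists>t2>t1. \<forall>I1 I2 X Y.
        inclusion_solution \<Omega> G j I1 X \<longrightarrow> inclusion_solution \<Omega> G j I2 Y \<longrightarrow>
        t1 \<in> I1 \<longrightarrow> t1 \<in> I2 \<longrightarrow> X t1 = Z1 \<longrightarrow> Y t1 = Z1 \<longrightarrow>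
        (\<forall>t \<in> {t1..t2} \<inter> I1 \<inter> I2. X t = Y t))"


section \<open>Ambiguity sets\<close>

definition ambiguity ::
  "(real^2) set \<Rightarrow> (real^2) set \<Rightarrow> ('n \<Rightarrow> (real^2)^'n \<Rightarrow> real^2) \<Rightarrow> 'n \<Rightarrow> ((real^2)^'n) set" where
  "ambiguity \<Omega> G j l = {Z \<in> configs \<Omega>. card (max_glide G j l Z) = 2}"

definition singular ::
  "(real^2) set \<Rightarrow> (real^2) set \<Rightarrow> ('n::finite \<Rightarrow> (real^2)^'n \<Rightarrow> real^2) \<Rightarrow> 'n \<Rightarrow> ((real^2)^'n) set" where
  "singular \<Omega> G j l =
     {Z \<in> ambiguity \<Omega> G j l. \<exists>gp gm. max_glide G j l Z = {gp, gm} \<and>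
        j l Z \<bullet> (gp - gm) = 0 \<and> GDERIV (\<lambda>Y. j l Y \<bullet> (gp - gm)) Z :> 0}"

definition E_int ::
  "(real^2) set \<Rightarrow> (real^2) set \<Rightarrow> ('n \<Rightarrow> (real^2)^'n \<Rightarrow> real^2) \<Rightarrow> ((real^2)^'n) set" where
  "E_int \<Omega> G j = {Z. \<exists>l k. l \<noteq> k \<and> Z \<in> ambiguity \<Omega> G j l \<inter> ambiguity \<Omega> G j k}"

definition E_zero ::
  "(real^2) set \<Rightarrow> ('n \<Rightarrow> (real^2)^'n \<Rightarrow> real^2) \<Rightarrow> ((real^2)^'n) set" where
  "E_zero \<Omega> j = {Z \<in> configs \<Omega>. \<exists>k. j k Z = 0}"

definition I_set ::
  "(real^2) set \<Rightarrow> (real^2) set \<Rightarrow> ('n::finite \<Rightarrow> (real^2)^'n \<Rightarrow> real^2) \<Rightarrow> 'n \<Rightarrow> ((real^2)^'n) set" where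
  "I_set \<Omega> G j l = ambiguity \<Omega> G j l - (singular \<Omega> G j l \<union> E_int \<Omega> G j \<union> E_zero \<Omega> j)"


section \<open>Local fields\<close>

text \<open>The argument \<open>g\<close> is one of the two elements of \<open>max_glide G j l Zhat\<close>. For
  \<open>k \<noteq> l\<close> and \<open>Zhat \<in> I_set \<Omega> G j l\<close> the set \<open>max_glide G j k Zhat\<close> is a singleton.\<close>

definition local_field ::
  "(real^2) set \<Rightarrow> ('n \<Rightarrow> (real^2)^'n \<Rightarrow> real^2) \<Rightarrow> 'n \<Rightarrow> (real^2)^'n \<Rightarrow> real^2 \<Rightarrow>
   (real^2)^'n \<Rightarrow> (real^2)^'n" where
  "local_field G j l Zhat g Z =
     (\<chi> k. let h = (if k = l then g else the_elem (max_glide G j k Zhat)) in (j k Z \<bullet> h) *\<^sub>R h)"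

text \<open>The side of the ambiguity hypersurface on which \<open>g\<close> is the only maximizing direction. Within a
  small ball \<open>B\<close> around a point of \<open>I_set \<Omega> G j l\<close> with maximizing directions \<open>gp\<close>, \<open>gm\<close>, the
  open sets \<open>V\<^sup>+\<close>, \<open>V\<^sup>-\<close> into which the hypersurface divides \<open>B\<close> are the intersections of \<open>B\<close> with
  \<open>side \<Omega> G j l gp\<close> and \<open>side \<Omega> G j l gm\<close>. Normals only depend on these sets near
  the point, so no radius has to be chosen.\<close>

definition side ::
  "(real^2) set \<Rightarrow> (real^2) set \<Rightarrow> ('n \<Rightarrow> (real^2)^'n \<Rightarrow> real^2) \<Rightarrow> 'n \<Rightarrow> real^2 \<Rightarrow>
   ((real^2)^'n) set" where
  "side \<Omega> G j l g = {Z \<in> configs \<Omega>. max_glide G j l Z = {g}}"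

definition tangent_vector :: "'a::real_normed_vector set \<Rightarrow> 'a \<Rightarrow> 'a \<Rightarrow> bool" where
  "tangent_vector A z w \<longleftrightarrow>
     (\<exists>c. c 0 = z \<and> (\<forall>\<^sub>F t in at 0. c t \<in> A) \<and> (c has_vector_derivative w) (at (0::real)))"

definition unit_normal_from_to :: "'a::real_inner set \<Rightarrow> 'a set \<Rightarrow> 'a set \<Rightarrow> 'a \<Rightarrow> 'a" where
  "unit_normal_from_to A Vm Vp z =
     (THE n. norm n = 1 \<and> (\<forall>w. tangent_vector A z w \<longrightarrow> n \<bullet> w = 0) \<and>
        (\<forall>\<^sub>F t in at_right 0. z + t *\<^sub>R n \<in> Vp \<and> z - t *\<^sub>R n \<in> Vm))"

end

theory Submission
  imports Defs "HOL-Complex_Analysis.Riemann_Mapping"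
begin

text \<open>Write \<open>\<sigma> = j l \<bullet> (gp - gm)\<close>. Near \<open>Z1\<close> every dislocation other than \<open>l\<close> keeps its glide direction, while
dislocation \<open>l\<close> follows \<open>gp\<close> where \<open>\<sigma> > 0\<close> and \<open>gm\<close> where \<open>\<sigma> < 0\<close>. The inclusion is thus a differential
equation with right-hand side \<open>fp\<close> or \<open>fm\<close> off the hypersurface \<open>\<sigma> = 0\<close>, and with the segment between
the two on it. By transversality \<open>\<sigma>\<close> decreases along \<open>fp\<close> and increases along \<open>fm\<close>, so \<open>\<sigma>\<^sup>2\<close> cannot
increase along a solution: one that starts on the hypersurface stays there (\<open>on_surface\<close>). Its velocity
is then a tangential element of the segment, and \<open>f0\<close> is the only one (\<open>tangential_eq_slide\<close>). Since
\<open>f0\<close> is continuous, the equation, at first valid almost everywhere, holds at all times (\<open>solves_ode\<close>).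

For uniqueness, observe that on the hypersurface \<open>fp - fm\<close> is a multiple of one constant vector \<open>e\<close>, namely
\<open>gp - gm\<close> placed in component \<open>l\<close>. The projection along \<open>e\<close> removes the weight \<open>\<alpha>\<close> from \<open>f0\<close> and
leaves the Lipschitz field \<open>fm\<close>; and because \<open>e\<close> is transversal to the hypersurface, the distance of two of
its points is controlled by the distance of their projections. Gronwall's inequality finishes the argument
(\<open>unique\<close>). Here \<open>\<sigma>\<close> is only required to be continuously differentiable, whereas Lipschitz continuity of \<open>f0\<close>
itself would involve second derivatives.

What remains is that the forces are continuously differentiable functions of the configuration, although
\<open>u0\<close> consists of one arbitrarily chosen Neumann solution for each configuration. This follows from an explicit
formula. In the coordinates stretched by \<open>Lambda_mat\<close> the gradient of a solution becomes a holomorphic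
function \<open>P\<close>, and the Neumann condition says that the stream function
\<open>Im \<Psi> - (\<Sum>i. \<beta> i * ln (norm (z - w i)))\<close> of the total field, where \<open>\<Psi>\<close> is a primitive of \<open>P\<close>, has no
tangential derivative at the boundary. Hence it has a single limit at all boundary points
(\<open>boundary_limit\<close>, \<open>frontier_limit_global\<close>), the boundary of a bounded simply connected domain being
connected. For a Riemann map \<open>f\<close> of the domain the Green functions
\<open>ln (norm ((f z - f (w i)) / (1 - cnj (f (w i)) * f z)))\<close> have the same singularities and vanish at the
boundary, so the maximum principle identifies \<open>P\<close> (\<open>stream_function_determined\<close>). At the position of a
dislocation the resulting expression involves only \<open>f\<close>, its first two derivatives and conjugates, evaluated at
the positions of the dislocations (\<open>peach_koehler_C1\<close>).\<close>

section \<open>Absolutely continuous functions of a real variable\<close>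

definition nonoverlapping_intervals :: "real set \<Rightarrow> (real \<times> real) set \<Rightarrow> bool" where
  "nonoverlapping_intervals I P \<longleftrightarrow> finite P \<and> (\<forall>(a, b)\<in>P. a \<le> b \<and> {a..b} \<subseteq> I) \<and>
     disjoint_family_on (\<lambda>(a, b). {a<..<b}) P"

lemma absolutely_continuous_fun_on_iff:
  "absolutely_continuous_fun_on I f \<longleftrightarrow>
     (\<forall>\<epsilon>>0. \<exists>\<delta>>0. \<forall>P. nonoverlapping_intervals I P \<longrightarrow>
        (\<Sum>(a, b)\<in>P. b - a) < \<delta> \<longrightarrow> (\<Sum>(a, b)\<in>P. norm (f b - f a)) < \<epsilon>)"
  by (simp only: absolutely_continuous_fun_on_def nonoverlapping_intervals_def imp_conjL)

text \<open>This covers inner products with a fixed vector, compositions with Lipschitz functions, and sums with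
Lipschitz functions of \<open>t\<close>.\<close>

lemma absolutely_continuous_fun_on_dominated:
  fixes f :: "real \<Rightarrow> 'a::real_normed_vector" and g :: "real \<Rightarrow> 'b::real_normed_vector"
  assumes f: "absolutely_continuous_fun_on I f"
    and dom: "\<And>s t. s \<in> I \<Longrightarrow> t \<in> I \<Longrightarrow> s \<le> t \<Longrightarrow> norm (g t - g s) \<le> C * norm (f t - f s) + D * (t - s)"
  shows "absolutely_continuous_fun_on I g"
  unfolding absolutely_continuous_fun_on_iff
proof (intro allI impI)
  fix e :: real assume "e > 0"
  define K where "K = 1 + \<bar>C\<bar> + \<bar>D\<bar>"
  have K: "K > 0" "C \<le> K" "D \<le> K" by (auto simp: K_def)
  have "e / (2*K) > 0" using \<open>e > 0\<close> K by simp
  then obtain d where d: "d > 0" and *: "\<And>P. nonoverlapping_intervals I P \<Longrightarrow>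
      (\<Sum>(a, b)\<in>P. b - a) < d \<Longrightarrow> (\<Sum>(a, b)\<in>P. norm (f b - f a)) < e / (2*K)"
    using f unfolding absolutely_continuous_fun_on_iff by meson
  show "\<exists>\<delta>>0. \<forall>P. nonoverlapping_intervals I P \<longrightarrow>
      (\<Sum>(a, b)\<in>P. b - a) < \<delta> \<longrightarrow> (\<Sum>(a, b)\<in>P. norm (g b - g a)) < e"
  proof (intro exI[of _ "min d (e / (2*K))"] conjI allI impI)
    show "0 < min d (e / (2*K))" using d \<open>e / (2*K) > 0\<close> by simp
    fix P assume P: "nonoverlapping_intervals I P" "(\<Sum>(a, b)\<in>P. b - a) < min d (e / (2*K))"
    have 1: "(\<Sum>(a, b)\<in>P. norm (f b - f a)) < e / (2*K)" using *[OF P(1)] P(2) by simp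
    have "(\<Sum>(a, b)\<in>P. norm (g b - g a)) \<le> (\<Sum>(a, b)\<in>P. K * norm (f b - f a) + K * (b - a))"
    proof (rule sum_mono, clarify)
      fix a b assume "(a, b) \<in> P"
      then have ab: "a \<le> b" "a \<in> I" "b \<in> I" using P(1) by (force simp: nonoverlapping_intervals_def)+
      have "norm (g b - g a) \<le> C * norm (f b - f a) + D * (b - a)" using dom ab by auto
      also have "\<dots> \<le> K * norm (f b - f a) + K * (b - a)"
        using K ab by (intro add_mono mult_right_mono) auto
      finally show "norm (g b - g a) \<le> K * norm (f b - f a) + K * (b - a)" .
    qed
    also have "\<dots> = K * (\<Sum>(a, b)\<in>P. norm (f b - f a)) + K * (\<Sum>(a, b)\<in>P. b - a)"
      by (simp add: sum.distrib sum_distrib_left case_prod_unfold)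
    also have "\<dots> < K * (e / (2*K)) + K * (e / (2*K))"
      using 1 P(2) K by (intro add_strict_mono mult_strict_left_mono) auto
    also have "\<dots> = e" using K by (simp add: field_simps)
    finally show "(\<Sum>(a, b)\<in>P. norm (g b - g a)) < e" .
  qed
qed

lemma absolutely_continuous_fun_on_subset:
  assumes f: "absolutely_continuous_fun_on I f" and "J \<subseteq> I"
  shows "absolutely_continuous_fun_on J f"
proof -
  have "nonoverlapping_intervals I P" if "nonoverlapping_intervals J P" for P
    using that \<open>J \<subseteq> I\<close> unfolding nonoverlapping_intervals_def by blast
  then show ?thesis using f unfolding absolutely_continuous_fun_on_iff by meson
qed

lemma absolutely_continuous_fun_on_imp_continuous_on:
  assumes "absolutely_continuous_fun_on {a..b::real} f"
  shows "continuous_on {a..b} f"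
  unfolding continuous_on_iff
proof (intro ballI allI impI)
  fix x e :: real assume x: "x \<in> {a..b}" and "e > 0"
  obtain d where d: "d > 0" and *: "\<And>P. nonoverlapping_intervals {a..b} P \<Longrightarrow>
      (\<Sum>(a, b)\<in>P. b - a) < d \<Longrightarrow> (\<Sum>(a, b)\<in>P. norm (f b - f a)) < e"
    using assms \<open>e > 0\<close> unfolding absolutely_continuous_fun_on_iff by meson
  have one: "norm (f v - f u) < e" if "u \<le> v" "u \<in> {a..b}" "v \<in> {a..b}" "v - u < d" for u v
    using *[of "{(u, v)}"] that by (simp add: nonoverlapping_intervals_def disjoint_family_on_def)
  show "\<exists>d>0. \<forall>y\<in>{a..b}. dist y x < d \<longrightarrow> dist (f y) (f x) < e"
  proof (intro exI[of _ d] conjI ballI impI d)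
    fix y assume "y \<in> {a..b}" "dist y x < d"
    then show "dist (f y) (f x) < e"
      using one[of x y] one[of y x] x by (cases "x \<le> y") (auto simp: dist_norm dist_real_def norm_minus_commute)
  qed
qed

text \<open>Cousin's lemma gives an elementary proof. Off an exceptional null set the derivative provides a gauge such that
\<open>f\<close> grows by at most \<open>e\<close> times the length of each tagged interval. The intervals with a tag in the null set lie in an
open set of small measure, where absolute continuity bounds the sum of the increments by \<open>e\<close>.\<close>

lemma absolutely_continuous_nonincreasing:
  fixes f :: "real \<Rightarrow> real"
  assumes ac: "absolutely_continuous_fun_on {a..b} f" and "a \<le> b"
    and deriv: "AE t in lborel. t \<in> {a..b} \<longrightarrow> (\<exists>d\<le>0. (f has_vector_derivative d) (at t within {a..b}))"
  shows "f b \<le> f a"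
proof -
  have bound: "f b - f a \<le> e * (b - a) + e" if "e > 0" for e :: real
  proof -
    obtain \<delta> where \<delta>: "\<delta> > 0" and small: "\<And>P. nonoverlapping_intervals {a..b} P \<Longrightarrow>
        (\<Sum>(u, v)\<in>P. v - u) < \<delta> \<Longrightarrow> (\<Sum>(u, v)\<in>P. norm (f v - f u)) < e"
      using ac \<open>e > 0\<close> unfolding absolutely_continuous_fun_on_iff by meson
    from deriv obtain N where N: "N \<in> null_sets lborel"
      "\<And>t. t \<notin> N \<Longrightarrow> t \<in> {a..b} \<Longrightarrow> \<exists>d\<le>0. (f has_vector_derivative d) (at t within {a..b})"
      by (force elim!: AE_E simp: null_sets_def)
    have "N \<in> sets borel" using N(1) by (auto simp: null_sets_def)
    then obtain U where U: "open U" "N \<subseteq> U" "emeasure lborel (U - N) < ennreal \<delta>"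
      using outer_regular_lborel[of N \<delta>] \<delta> by (metis ennreal_less_zero_iff)
    have mU: "emeasure lborel U < ennreal \<delta>"
    proof -
      have "emeasure lborel U = emeasure lborel (U - N)"
        using U(1) by (intro emeasure_Diff_null_set[OF N(1), symmetric]) auto
      then show ?thesis using U(3) by simp
    qed
    have "\<exists>d>0. \<forall>y\<in>{a..b}. \<bar>y - t\<bar> < d \<longrightarrow> (y - t) * sgn (y - t) * e \<ge> (f y - f t) * sgn (y - t)"
      if t: "t \<in> {a..b}" "t \<notin> N" for t
    proof -
      obtain D where D: "D \<le> 0" "(f has_vector_derivative D) (at t within {a..b})" using N(2) t by blast
      from D(2) have "(f has_derivative (\<lambda>h. h * D)) (at t within {a..b})"
        by (simp add: has_vector_derivative_def)
      then obtain d where d: "d > 0" "\<And>y. y \<in> {a..b} \<Longrightarrow> norm (y - t) < d \<Longrightarrow>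
          norm (f y - f t - (y - t) * D) \<le> e * norm (y - t)"
        using \<open>e > 0\<close> unfolding has_derivative_within_alt by meson
      show ?thesis
      proof (intro exI[of _ d] conjI ballI impI d(1))
        fix y assume y: "y \<in> {a..b}" "\<bar>y - t\<bar> < d"
        have 1: "\<bar>f y - f t - (y - t) * D\<bar> \<le> e * \<bar>y - t\<bar>" using d(2)[of y] y by simp
        consider "y > t" | "y = t" | "y < t" by linarith
        then show "(y - t) * sgn (y - t) * e \<ge> (f y - f t) * sgn (y - t)"
        proof cases
          case 1
          then have "(y - t) * D \<le> 0" using D(1) by (simp add: mult_nonneg_nonpos)
          with 1 d(2)[of y] y show ?thesis by (simp add: abs_if mult.commute split: if_splits)
        next
          case 3
          then have "(y - t) * D \<ge> 0" using D(1) by (simp add: mult_nonpos_nonpos)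
          with 3 \<open>\<bar>f y - f t - (y - t) * D\<bar> \<le> e * \<bar>y - t\<bar>\<close> show ?thesis by (simp add: abs_if algebra_simps split: if_splits)
        qed simp
      qed
    qed
    then obtain d where d: "\<And>t. t \<in> {a..b} \<Longrightarrow> t \<notin> N \<Longrightarrow> d t > 0"
      "\<And>t y. t \<in> {a..b} \<Longrightarrow> t \<notin> N \<Longrightarrow> y\<in>{a..b} \<Longrightarrow> \<bar>y - t\<bar> < d t \<Longrightarrow> (y - t) * sgn (y - t) * e \<ge> (f y - f t) * sgn (y - t)"
      by metis
    \<comment> \<open>The gauge confines the intervals with a tag in \<open>N\<close> to \<open>U\<close>.\<close>
    define g where "g t = (if t \<in> N then U else if t \<in> {a..b} then ball t (d t) else ball t 1)" for t
    have "gauge g" unfolding gauge_def g_def using U d(1) by auto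
    then obtain p where p: "p tagged_division_of {a..b}" "g fine p"
      using fine_division_exists_real by blast
    have finp: "finite p" using p(1) by blast
    have K: "\<exists>u v. K = {u..v} \<and> u \<le> v \<and> a \<le> u \<and> v \<le> b \<and> x \<in> K \<and> K \<subseteq> g x" if xKp: "(x, K) \<in> p" for x K
    proof -
      obtain u v where uv: "K = {u..v}" using tagged_division_ofD(4)[OF p(1) xKp] by auto
      moreover have x: "x \<in> K" and "K \<subseteq> {a..b}"
        using tagged_division_ofD(2,3)[OF p(1) xKp] by auto
      ultimately have "u \<le> v" "a \<le> u" "v \<le> b" by auto
      moreover have "K \<subseteq> g x" using p(2) xKp by (auto simp: fine_def)
      ultimately show ?thesis using uv x by blast
    qed
    have tele: "(\<Sum>(x,K)\<in>p. f (Sup K) - f (Inf K)) = f b - f a"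
      using additive_tagged_division_1[OF \<open>a \<le> b\<close> p(1)] .
    have cont: "(\<Sum>(x,K)\<in>p. Sup K - Inf K) = b - a"
      using additive_tagged_division_1[OF \<open>a \<le> b\<close> p(1), of "\<lambda>x. x"] by simp
    \<comment> \<open>Degenerate intervals contribute nothing; the others are determined by their end points.\<close>
    define q where "q = {(x,K)\<in>p. x \<in> N \<and> interior K \<noteq> {}}"
    define p1 where "p1 = {(x,K)\<in>p. x \<notin> N}"
    define p2 where "p2 = {(x,K)\<in>p. x \<in> N}"
    have pp: "p = p1 \<union> p2" "p1 \<inter> p2 = {}" "q \<subseteq> p2" "finite p1" "finite p2" "finite q"
      using finp by (auto simp: p1_def p2_def q_def intro: finite_subset[OF _ finp])
    have s1: "(\<Sum>(x,K)\<in>p1. f (Sup K) - f (Inf K)) \<le> (\<Sum>(x,K)\<in>p1. e * (Sup K - Inf K))"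
    proof (rule sum_mono, clarify)
      fix x K assume "(x, K) \<in> p1"
      then have xK: "(x, K) \<in> p" "x \<notin> N" by (auto simp: p1_def)
      obtain u v where uv: "K = {u..v}" "u \<le> v" "a \<le> u" "v \<le> b" "x \<in> K" "K \<subseteq> g x" using K[OF xK(1)] by blast
      have x: "x \<in> {a..b}" "u \<le> x" "x \<le> v" using uv by auto
      have "{u..v} \<subseteq> ball x (d x)" using uv xK(2) x by (simp add: g_def)
      then have "u \<in> ball x (d x)" "v \<in> ball x (d x)" using uv(2) by auto
      then have uvd: "\<bar>u - x\<bar> < d x" "\<bar>v - x\<bar> < d x" by (auto simp: dist_real_def)
      have "f v - f x \<le> e * (v - x)"
        using d(2)[OF x(1) xK(2), of v] uvd uv x by (cases "v = x") (auto simp: mult.commute)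
      moreover have "f x - f u \<le> e * (x - u)"
        using d(2)[OF x(1) xK(2), of u] uvd uv x by (cases "u = x") (auto simp: algebra_simps)
      ultimately show "f (Sup K) - f (Inf K) \<le> e * (Sup K - Inf K)" using uv by (simp add: algebra_simps)
    qed
    have "(\<Sum>(x,K)\<in>p1. e * (Sup K - Inf K)) = e * (\<Sum>(x,K)\<in>p1. (Sup K - Inf K))"
      by (simp add: sum_distrib_left case_prod_unfold)
    also have "\<dots> \<le> e * (\<Sum>(x,K)\<in>p. (Sup K - Inf K))"
    proof (rule mult_left_mono)
      show "(\<Sum>(x,K)\<in>p1. (Sup K - Inf K)) \<le> (\<Sum>(x,K)\<in>p. (Sup K - Inf K))"
        using pp finp K by (intro sum_mono2) fastforce+
    qed (use \<open>e > 0\<close> in simp)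
    finally have s1': "(\<Sum>(x,K)\<in>p1. f (Sup K) - f (Inf K)) \<le> e * (b - a)" using s1 cont by simp
    have s2: "(\<Sum>(x,K)\<in>p2. f (Sup K) - f (Inf K)) = (\<Sum>(x,K)\<in>q. f (Sup K) - f (Inf K))"
    proof (rule sum.mono_neutral_right[OF pp(5,3)], clarify)
      fix x K assume xK: "(x, K) \<in> p2" "(x, K) \<notin> q"
      then have "interior K = {}" "(x,K) \<in> p" by (auto simp: q_def p2_def)
      moreover obtain u v where "K = {u..v}" "u \<le> v" using K[OF calculation(2)] by blast
      ultimately show "f (Sup K) - f (Inf K) = 0" by (simp add: interior_atLeastAtMost_real)
    qed
    define P where "P = (\<lambda>(x,K). (Inf K, Sup K)) ` q"
    have disj: "interior K \<inter> interior K' = {}" if "(x,K) \<in> q" "(x',K') \<in> q" "(x,K) \<noteq> (x',K')" for x K x' K'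
      using that(1,2) tagged_division_ofD(5)[OF p(1) _ _ that(3)] unfolding q_def by blast
    have intK: "interior K = {Inf K<..<Sup K}" "Inf K < Sup K" "K = {Inf K..Sup K}" "K \<subseteq> U" if "(x,K) \<in> q" for x K
    proof -
      have "(x,K) \<in> p" "x \<in> N" "interior K \<noteq> {}" using that by (auto simp: q_def)
      moreover obtain u v where "K = {u..v}" "u \<le> v" "K \<subseteq> g x" using K[OF calculation(1)] by blast
      ultimately show "interior K = {Inf K<..<Sup K}" "Inf K < Sup K" "K = {Inf K..Sup K}" "K \<subseteq> U"
        by (auto simp: interior_atLeastAtMost_real g_def)
    qed
    have inj: "inj_on (\<lambda>(x,K). (Inf K, Sup K)) q"
    proof (rule inj_onI, clarify)
      fix x K x' K' assume a: "(x, K) \<in> q" "(x', K') \<in> q" "Inf K = Inf K'" "Sup K = Sup (K' :: real set)"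
      show "x = x' \<and> K = K'"
      proof (rule ccontr)
        assume "\<not> (x = x' \<and> K = K')"
        then have "interior K \<inter> interior K' = {}" using disj[OF a(1,2)] by auto
        moreover have "interior K = interior K'" using intK(1)[OF a(1)] intK(1)[OF a(2)] a(3,4) by simp
        moreover have "interior K \<noteq> {}" using a(1) by (auto simp: q_def)
        ultimately show False by auto
      qed
    qed
    have "(\<Sum>(a, b)\<in>P. norm (f b - f a)) < e"
    proof (rule small)
      have "finite P" using pp by (simp add: P_def)
      moreover have "\<forall>(u, v)\<in>P. u \<le> v \<and> {u..v} \<subseteq> {a..b}"
      proof -
        have "Inf K \<le> Sup K \<and> {Inf K..Sup K} \<subseteq> {a..b}" if "(x,K) \<in> q" for x K
        proof -
          have "(x,K) \<in> p" using that by (auto simp: q_def)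
          from K[OF this] obtain u v where "K = {u..v}" "u \<le> v" "a \<le> u" "v \<le> b" by blast
          then show ?thesis by auto
        qed
        then show ?thesis unfolding P_def by (auto simp del: atLeastatMost_subset_iff)
      qed
      moreover have "disjoint_family_on (\<lambda>(a, b). {a<..<b}) P"
        unfolding disjoint_family_on_def
      proof (intro ballI impI)
        fix A B assume AB: "A \<in> P" "B \<in> P" "A \<noteq> B"
        then obtain x K x' K' where a: "(x, K) \<in> q" "(x', K') \<in> q" "A = (Inf K, Sup K)" "B = (Inf K', Sup K')"
          unfolding P_def by auto
        have "interior K \<inter> interior K' = {}" using disj[OF a(1,2)] a(3,4) AB(3) by auto
        then show "(case A of (a, b) \<Rightarrow> {a<..<b}) \<inter> (case B of (a, b) \<Rightarrow> {a<..<b}) = {}"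
          using intK(1)[OF a(1)] intK(1)[OF a(2)] a(3,4) by simp
      qed
      ultimately show "nonoverlapping_intervals {a..b} P" by (simp add: nonoverlapping_intervals_def)
      have "ennreal (\<Sum>(u, v)\<in>P. v - u) = (\<Sum>(x,K)\<in>q. ennreal (Sup K - Inf K))"
        unfolding P_def sum.reindex[OF inj] using intK(2)
        by (subst sum_ennreal[symmetric]) (auto simp: case_prod_unfold comp_def intro!: less_imp_le)
      also have "\<dots> = (\<Sum>(x,K)\<in>q. emeasure lborel (interior K))"
      proof (rule sum.cong[OF refl], clarify)
        fix x K assume "(x,K) \<in> q"
        then show "ennreal (Sup K - Inf K) = emeasure lborel (interior K)"
          using intK(1,2)[of x K] by simp
      qed
      also have "\<dots> = emeasure lborel (\<Union>(x,K)\<in>q. interior K)"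
      proof -
        have "disjoint_family_on (\<lambda>(x,K). interior K) q"
          unfolding disjoint_family_on_def using disj by fastforce
        moreover have "(\<lambda>(x,K). interior K) ` q \<subseteq> sets lborel" by auto
        ultimately show ?thesis
          using sum_emeasure[of "\<lambda>(x,K). interior K" q lborel] pp(6)
          by (simp add: case_prod_unfold)
      qed
      also have "\<dots> \<le> emeasure lborel U"
      proof (rule emeasure_mono)
        show "(\<Union>(x,K)\<in>q. interior K) \<subseteq> U" using intK(4) interior_subset by fastforce
      qed (use U in auto)
      also have "\<dots> < ennreal \<delta>" by (rule mU)
      finally show "(\<Sum>(u, v)\<in>P. v - u) < \<delta>"
        using \<delta> ennreal_less_iff ennreal_neg not_le by (metis ennreal_lessI linorder_not_less order_less_irrefl order.strict_trans1 ennreal_leI)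
    qed
    moreover have "(\<Sum>(x,K)\<in>q. f (Sup K) - f (Inf K)) \<le> (\<Sum>(a, b)\<in>P. norm (f b - f a))"
      unfolding P_def sum.reindex[OF inj] by (rule sum_mono) (auto simp: case_prod_unfold)
    moreover have "f b - f a = (\<Sum>(x,K)\<in>p1. f (Sup K) - f (Inf K)) + (\<Sum>(x,K)\<in>p2. f (Sup K) - f (Inf K))"
      using tele pp by (simp add: sum.union_disjoint)
    ultimately show ?thesis using s1' s2 by linarith
  qed
  show ?thesis
  proof (rule ccontr)
    assume "\<not> f b \<le> f a"
    define e where "e = (f b - f a) / (2 * (b - a + 1))"
    have "e > 0" using \<open>\<not> f b \<le> f a\<close> \<open>a \<le> b\<close> by (simp add: e_def)
    have "e * (b - a + 1) = (f b - f a) / 2" using \<open>a \<le> b\<close> unfolding e_def by (auto simp: divide_simps)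
    then have "e * (b - a) + e = (f b - f a) / 2" by (simp add: distrib_left)
    then show False using bound[OF \<open>e > 0\<close>] \<open>\<not> f b \<le> f a\<close> by (simp add: field_simps)
  qed
qed

lemma has_vector_derivative_compose_has_derivative:
  assumes "(X has_vector_derivative V) (at t within S)" "(f has_derivative D) (at (X t))"
  shows "((\<lambda>t. f (X t)) has_vector_derivative D V) (at t within S)"
  using vector_derivative_diff_chain_within[OF assms(1) has_derivative_at_withinI[OF assms(2)]]
  by (simp add: o_def)

text \<open>The component of \<open>X\<close> in the direction of the total displacement grows at most at the rate \<open>M\<close>.\<close>

lemma absolutely_continuous_norm_bound:
  fixes X :: "real \<Rightarrow> 'a::real_inner"
  assumes ac: "absolutely_continuous_fun_on {a..b} X" and "a \<le> b" and "M \<ge> 0"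
    and deriv: "AE t in lborel. t \<in> {a..b} \<longrightarrow>
      (\<exists>V. norm V \<le> M \<and> (X has_vector_derivative V) (at t within {a..b}))"
  shows "norm (X b - X a) \<le> M * (b - a)"
proof -
  define u where "u = X b - X a"
  define f where "f = (\<lambda>t. u \<bullet> X t - norm u * M * t)"
  have "f b \<le> f a"
  proof (rule absolutely_continuous_nonincreasing[OF _ \<open>a \<le> b\<close>])
    show "absolutely_continuous_fun_on {a..b} f"
    proof (rule absolutely_continuous_fun_on_dominated[OF ac])
      fix s t assume "s \<in> {a..b}" "t \<in> {a..b}" "s \<le> t"
      have "f t - f s = u \<bullet> (X t - X s) - norm u * M * (t - s)"
        by (simp add: f_def algebra_simps)
      moreover have "\<bar>u \<bullet> (X t - X s)\<bar> \<le> norm u * norm (X t - X s)" by (rule Cauchy_Schwarz_ineq2)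
      moreover have "\<bar>norm u * M * (t - s)\<bar> = norm u * \<bar>M\<bar> * (t - s)" using \<open>s \<le> t\<close> by (simp add: abs_mult)
      ultimately show "norm (f t - f s) \<le> norm u * norm (X t - X s) + norm u * \<bar>M\<bar> * (t - s)"
        by simp
    qed
    show "AE t in lborel. t \<in> {a..b} \<longrightarrow> (\<exists>d\<le>0. (f has_vector_derivative d) (at t within {a..b}))"
      using deriv
    proof (rule AE_mp, intro AE_I2 impI)
      fix t assume "t \<in> {a..b} \<longrightarrow> (\<exists>V. norm V \<le> M \<and> (X has_vector_derivative V) (at t within {a..b}))" "t \<in> {a..b}"
      then obtain V where V: "norm V \<le> M" "(X has_vector_derivative V) (at t within {a..b})" by blast
      have "(f has_vector_derivative (u \<bullet> V - norm u * M)) (at t within {a..b})"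
        unfolding f_def
        by (intro has_vector_derivative_diff bounded_linear.has_vector_derivative[OF bounded_linear_inner_right V(2)])
           (auto intro!: derivative_eq_intros simp flip: has_real_derivative_iff_has_vector_derivative)
      moreover have "u \<bullet> V \<le> norm u * M"
        by (meson V(1) mult_left_mono norm_cauchy_schwarz norm_ge_zero order_trans)
      ultimately show "\<exists>d\<le>0. (f has_vector_derivative d) (at t within {a..b})"
        by (intro exI[of _ "u \<bullet> V - norm u * M"]) simp
    qed
  qed
  then have "u \<bullet> (X b - X a) \<le> norm u * (M * (b - a))"
    unfolding f_def by (simp add: algebra_simps)
  then have "norm u * norm u \<le> norm u * (M * (b - a))"
    unfolding u_def[symmetric] by (simp add: power2_norm_eq_inner flip: power2_eq_square)
  then show ?thesis
    unfolding u_def[symmetric] using \<open>a \<le> b\<close> \<open>M \<ge> 0\<close>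
    by (cases "u = 0") (simp_all add: mult_le_cancel_left)
qed

text \<open>Subtracting the integral of \<open>g\<close> leaves an absolutely continuous function whose derivative vanishes almost
everywhere, hence a constant. So \<open>X\<close> is a primitive of the continuous function \<open>g\<close>.\<close>

lemma ae_derivative_continuous_imp_derivative:
  fixes X :: "real \<Rightarrow> 'a::euclidean_space"
  assumes ac: "absolutely_continuous_fun_on {a..b} X"
    and g: "continuous_on {a..b} g"
    and deriv: "AE t in lborel. t \<in> {a..b} \<longrightarrow> (X has_vector_derivative g t) (at t within {a..b})"
    and t: "t \<in> {a..b}"
  shows "(X has_vector_derivative g t) (at t within {a..b})"
proof -
  define h where "h = (\<lambda>t. X t - integral {a..t} g)"
  have I: "((\<lambda>t. integral {a..t} g) has_vector_derivative g t) (at t within {a..b})" if "t \<in> {a..b}" for t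
    using integral_has_vector_derivative[OF g that] .
  obtain B where B: "\<And>x. x \<in> {a..b} \<Longrightarrow> norm (g x) \<le> B"
    using compact_imp_bounded[OF compact_continuous_image[OF g compact_Icc]]
    unfolding bounded_iff by (metis imageI)
  have lip: "norm (integral {a..t} g - integral {a..s} g) \<le> B * (t - s)"
    if "s \<in> {a..b}" "t \<in> {a..b}" "s \<le> t" for s t
  proof -
    have int: "g integrable_on {a..t}" "g integrable_on {s..t}"
      using that by (auto intro!: integrable_continuous_interval continuous_on_subset[OF g])
    have "integral {a..s} g + integral {s..t} g = integral {a..t} g"
      using that int by (intro Henstock_Kurzweil_Integration.integral_combine) auto
    then have "integral {a..t} g - integral {a..s} g = integral {s..t} g" by (simp add: algebra_simps)
    moreover have "norm (integral {s..t} g) \<le> B * (t - s)"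
      using that B by (intro integral_bound continuous_on_subset[OF g]) auto
    ultimately show ?thesis by simp
  qed
  have ach: "absolutely_continuous_fun_on {a..b} h"
  proof (rule absolutely_continuous_fun_on_dominated[OF ac])
    fix s t assume st: "s \<in> {a..b}" "t \<in> {a..b}" "s \<le> t"
    have "norm (h t - h s) \<le> norm (X t - X s) + norm (integral {a..t} g - integral {a..s} g)"
      unfolding h_def using norm_triangle_ineq4[of "X t - X s" "integral {a..t} g - integral {a..s} g"]
      by (simp add: algebra_simps)
    then show "norm (h t - h s) \<le> 1 * norm (X t - X s) + B * (t - s)" using lip[OF st] by simp
  qed
  have hd: "AE t in lborel. t \<in> {a..b} \<longrightarrow> (h has_vector_derivative 0) (at t within {a..b})"
    using deriv
  proof (rule AE_mp, intro AE_I2 impI)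
    fix t assume "t \<in> {a..b} \<longrightarrow> (X has_vector_derivative g t) (at t within {a..b})" "t \<in> {a..b}"
    then show "(h has_vector_derivative 0) (at t within {a..b})"
      unfolding h_def using has_vector_derivative_diff[OF _ I, of X "g t" t] by simp
  qed
  have const: "h t = h a" if "t \<in> {a..b}" for t
  proof -
    have "norm (h t - h a) \<le> 0 * (t - a)"
    proof (rule absolutely_continuous_norm_bound)
      show "absolutely_continuous_fun_on {a..t} h"
        by (rule absolutely_continuous_fun_on_subset[OF ach]) (use that in auto)
      show "AE t' in lborel. t' \<in> {a..t} \<longrightarrow>
         (\<exists>V. norm V \<le> 0 \<and> (h has_vector_derivative V) (at t' within {a..t}))"
        using hd
      proof (rule AE_mp, intro AE_I2 impI)
        fix x assume x: "x \<in> {a..b} \<longrightarrow> (h has_vector_derivative 0) (at x within {a..b})" "x \<in> {a..t}"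
        then have "(h has_vector_derivative 0) (at x within {a..t})"
          using that by (auto intro: has_vector_derivative_within_subset)
        then show "\<exists>V. norm V \<le> 0 \<and> (h has_vector_derivative V) (at x within {a..t})" by force
      qed
    qed (use that in auto)
    then show ?thesis by simp
  qed
  have "((\<lambda>t. h a + integral {a..t} g) has_vector_derivative g t) (at t within {a..b})"
    using I[OF t] by (auto intro!: derivative_eq_intros)
  then show ?thesis
  proof (rule has_vector_derivative_transform[OF t, rotated])
    show "\<And>x. x \<in> {a..b} \<Longrightarrow> X x = h a + integral {a..x} g"
      using const by (metis h_def diff_add_cancel)
  qed
qed

section \<open>Continuously differentiable functions\<close>

lemma C1_on_has_derivative: "C1_on U f \<Longrightarrow> x \<in> U \<Longrightarrow> (f has_derivative frechet_derivative f (at x)) (at x)"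
  by (simp add: C1_on_def frechet_derivative_works[symmetric])

lemma C1_on_continuous_on: "C1_on U f \<Longrightarrow> continuous_on U f"
  by (metis C1_on_has_derivative continuous_at_imp_continuous_on has_derivative_continuous)

lemma C1_on_subset: "C1_on U f \<Longrightarrow> V \<subseteq> U \<Longrightarrow> C1_on V f"
  unfolding C1_on_def by (meson continuous_on_subset subsetD)

lemma frechet_derivative_expand:
  fixes f :: "'a::euclidean_space \<Rightarrow> 'b::real_normed_vector"
  assumes "f differentiable (at x)"
  shows "frechet_derivative f (at x) v = (\<Sum>i\<in>Basis. (v \<bullet> i) *\<^sub>R frechet_derivative f (at x) i)"
proof -
  have lin: "linear (frechet_derivative f (at x))" using assms by (rule linear_frechet_derivative)
  have "frechet_derivative f (at x) v = frechet_derivative f (at x) (\<Sum>i\<in>Basis. (v \<bullet> i) *\<^sub>R i)"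
    by (simp add: euclidean_representation)
  then show ?thesis by (simp add: linear_sum[OF lin] linear_cmul[OF lin])
qed

text \<open>Continuity of the derivative in every fixed direction becomes joint continuity in point and direction
because a direction is a combination of finitely many basis vectors.\<close>

lemma C1_on_continuous_derivative:
  fixes f :: "'a::euclidean_space \<Rightarrow> 'b::real_normed_vector"
  assumes f: "C1_on U f" and x: "continuous_on A x" "\<And>t. t \<in> A \<Longrightarrow> x t \<in> U" and w: "continuous_on A w"
  shows "continuous_on A (\<lambda>t. frechet_derivative f (at (x t)) (w t))"
proof -
  have "continuous_on A (\<lambda>t. \<Sum>i\<in>Basis. (w t \<bullet> i) *\<^sub>R frechet_derivative f (at (x t)) i)"
  proof (intro continuous_intros w)
    fix i show "continuous_on A (\<lambda>t. frechet_derivative f (at (x t)) i)"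
      by (rule continuous_on_compose2[OF _ x(1)]) (use f x(2) in \<open>auto simp: C1_on_def\<close>)
  qed
  then show ?thesis
    by (rule continuous_on_eq) (use f x(2) frechet_derivative_expand in \<open>metis C1_on_def\<close>)
qed

lemma C1_on_derivative_bound:
  fixes f :: "'a::euclidean_space \<Rightarrow> 'b::real_normed_vector"
  assumes f: "C1_on U f" and K: "compact K" "K \<subseteq> U"
  obtains L where "L \<ge> 0" "\<And>x v. x \<in> K \<Longrightarrow> norm (frechet_derivative f (at x) v) \<le> L * norm v"
proof -
  have "\<exists>B. \<forall>x\<in>K. norm (frechet_derivative f (at x) i) \<le> B" for i
  proof -
    have "continuous_on K (\<lambda>x. frechet_derivative f (at x) i)"
      using f K unfolding C1_on_def by (meson continuous_on_subset)
    then have "bounded ((\<lambda>x. frechet_derivative f (at x) i) ` K)"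
      by (intro compact_imp_bounded compact_continuous_image K(1))
    then show ?thesis by (simp add: bounded_iff)
  qed
  then obtain B where B: "\<And>i x. x \<in> K \<Longrightarrow> norm (frechet_derivative f (at x) i) \<le> B i" by metis
  show ?thesis
  proof
    show "(\<Sum>i\<in>Basis. \<bar>B i\<bar>) \<ge> 0" by (simp add: sum_nonneg)
    fix x and v :: 'a assume x: "x \<in> K"
    have "norm (frechet_derivative f (at x) v) = norm (\<Sum>i\<in>Basis. (v \<bullet> i) *\<^sub>R frechet_derivative f (at x) i)"
      using frechet_derivative_expand[of f x v] f K x unfolding C1_on_def by auto
    also have "\<dots> \<le> (\<Sum>i\<in>Basis. norm v * \<bar>B i\<bar>)"
    proof (rule sum_norm_le)
      fix i :: 'a assume "i \<in> Basis"
      have "norm (frechet_derivative f (at x) i) \<le> \<bar>B i\<bar>" using B[OF x, of i] by linarith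
      then show "norm ((v \<bullet> i) *\<^sub>R frechet_derivative f (at x) i) \<le> norm v * \<bar>B i\<bar>"
        using Basis_le_norm[OF \<open>i \<in> Basis\<close>, of v] by (auto intro: mult_mono)
    qed
    finally show "norm (frechet_derivative f (at x) v) \<le> (\<Sum>i\<in>Basis. \<bar>B i\<bar>) * norm v"
      by (simp add: sum_distrib_left mult.commute)
  qed
qed

lemma C1_on_lipschitz:
  fixes f :: "'a::euclidean_space \<Rightarrow> 'b::real_normed_vector"
  assumes f: "C1_on U f" and K: "compact K" "convex K" "K \<subseteq> U"
  obtains L where "L \<ge> 0" "\<And>x y. x \<in> K \<Longrightarrow> y \<in> K \<Longrightarrow> norm (f x - f y) \<le> L * norm (x - y)"
proof -
  obtain L where L: "L \<ge> 0" "\<And>x v. x \<in> K \<Longrightarrow> norm (frechet_derivative f (at x) v) \<le> L * norm v"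
    using C1_on_derivative_bound[OF f K(1,3)] by metis
  show ?thesis
  proof
    fix x y assume xy: "x \<in> K" "y \<in> K"
    show "norm (f x - f y) \<le> L * norm (x - y)"
    proof (rule differentiable_bound[OF K(2) _ _ xy])
      show "(f has_derivative frechet_derivative f (at w)) (at w within K)" if "w \<in> K" for w
        using that K f by (blast intro: has_derivative_at_withinI C1_on_has_derivative)
      show "onorm (frechet_derivative f (at w)) \<le> L" if "w \<in> K" for w
        using L that by (intro onorm_bound) auto
    qed
  qed (rule L)
qed

lemma C1_onI:
  fixes f :: "'a::euclidean_space \<Rightarrow> 'b::real_normed_vector"
  assumes "\<And>x. x \<in> U \<Longrightarrow> (f has_derivative f' x) (at x)" "\<And>v. continuous_on U (\<lambda>x. f' x v)"
  shows "C1_on U f"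
proof -
  have eq: "frechet_derivative f (at x) = f' x" if "x \<in> U" for x
    using frechet_derivative_at[OF assms(1)[OF that]] by simp
  show ?thesis unfolding C1_on_def
  proof (intro conjI ballI allI)
    show "f differentiable (at x)" if "x \<in> U" for x using assms(1)[OF that] by (auto simp: differentiable_def)
    show "continuous_on U (\<lambda>x. frechet_derivative f (at x) v)" for v
      using assms(2)[of v] by (rule continuous_on_eq) (simp add: eq)
  qed
qed

lemma C1_on_const: "C1_on U (\<lambda>x. c)"
  by (rule C1_onI[where f'="\<lambda>x v. 0"]) (auto intro!: derivative_eq_intros)

lemma C1_on_bounded_linear_compose:
  assumes "C1_on U f" "bounded_linear L"
  shows "C1_on U (\<lambda>x. L (f x))"
proof (rule C1_onI)
  show "((\<lambda>x. L (f x)) has_derivative (\<lambda>v. L (frechet_derivative f (at x) v))) (at x)" if "x \<in> U" for x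
    by (rule bounded_linear.has_derivative[OF assms(2) C1_on_has_derivative[OF assms(1) that]])
  show "continuous_on U (\<lambda>x. L (frechet_derivative f (at x) v))" for v
    by (rule bounded_linear.continuous_on[OF assms(2)]) (use assms(1) in \<open>auto simp: C1_on_def\<close>)
qed

lemma C1_on_bilinear:
  assumes B: "bounded_bilinear B" and f: "C1_on U f" and g: "C1_on U g"
  shows "C1_on U (\<lambda>x. B (f x) (g x))"
proof (rule C1_onI)
  show "((\<lambda>x. B (f x) (g x)) has_derivative
     (\<lambda>v. B (f x) (frechet_derivative g (at x) v) + B (frechet_derivative f (at x) v) (g x))) (at x)" if "x \<in> U" for x
    by (rule bounded_bilinear.FDERIV[OF B C1_on_has_derivative[OF f that] C1_on_has_derivative[OF g that]])
  show "continuous_on U (\<lambda>x. B (f x) (frechet_derivative g (at x) v) + B (frechet_derivative f (at x) v) (g x))" for v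
    using f g by (intro continuous_on_add bounded_bilinear.continuous_on[OF B] C1_on_continuous_on[OF f] C1_on_continuous_on[OF g])
      (auto simp: C1_on_def)
qed

lemma C1_on_add:
  assumes f: "C1_on U f" and g: "C1_on U g"
  shows "C1_on U (\<lambda>x. f x + g x)"
proof (rule C1_onI)
  show "((\<lambda>x. f x + g x) has_derivative
     (\<lambda>v. frechet_derivative f (at x) v + frechet_derivative g (at x) v)) (at x)" if "x \<in> U" for x
    by (rule has_derivative_add[OF C1_on_has_derivative[OF f that] C1_on_has_derivative[OF g that]])
  show "continuous_on U (\<lambda>x. frechet_derivative f (at x) v + frechet_derivative g (at x) v)" for v
    using f g by (intro continuous_on_add) (auto simp: C1_on_def)
qed

lemma C1_on_sum: "(\<And>i. i \<in> I \<Longrightarrow> C1_on U (f i)) \<Longrightarrow> C1_on U (\<lambda>x. \<Sum>i\<in>I. f i x)"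
  by (induction I rule: infinite_finite_induct) (auto intro: C1_on_const C1_on_add)

lemma C1_on_vec:
  fixes f :: "'a::euclidean_space \<Rightarrow> 'b::euclidean_space^'n"
  assumes "\<And>k. C1_on U (\<lambda>x. f x $ k)"
  shows "C1_on U f"
proof -
  have "linear (axis k :: 'b \<Rightarrow> 'b^'n)" for k
    by (rule linearI) (auto simp: vec_eq_iff axis_def)
  then have "bounded_linear (axis k :: 'b \<Rightarrow> 'b^'n)" for k by (simp add: linear_conv_bounded_linear)
  then have "C1_on U (\<lambda>x. \<Sum>k\<in>UNIV. axis k (f x $ k))"
    by (intro C1_on_sum C1_on_bounded_linear_compose[OF assms])
  moreover have "(\<Sum>k\<in>UNIV. axis k (y $ k)) = y" for y :: "'b^'n"
    by (simp add: vec_eq_iff axis_def if_distrib[of "\<lambda>u. u $ _"] cong: if_cong)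
  ultimately show ?thesis by simp
qed

lemma C1_on_linear: "bounded_linear L \<Longrightarrow> C1_on U L"
  by (rule C1_onI[where f'="\<lambda>x. L"]) (auto intro: bounded_linear_imp_has_derivative)

lemma C1_on_holomorphic_compose:
  fixes f :: "'a::euclidean_space \<Rightarrow> complex"
  assumes h: "h holomorphic_on S" "open S" and f: "C1_on U f" "f ` U \<subseteq> S"
  shows "C1_on U (\<lambda>x. h (f x))"
proof (rule C1_onI)
  show "((\<lambda>x. h (f x)) has_derivative (\<lambda>v. deriv h (f x) * frechet_derivative f (at x) v)) (at x)" if "x \<in> U" for x
  proof -
    have "f x \<in> S" using f(2) that by auto
    then have "(h has_field_derivative deriv h (f x)) (at (f x))"
      using h holomorphic_derivI by blast
    then have "(h has_derivative (*) (deriv h (f x))) (at (f x))" by (simp add: has_field_derivative_def)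
    from has_derivative_compose[OF C1_on_has_derivative[OF f(1) that] this] show ?thesis by simp
  qed
  have "continuous_on U (\<lambda>x. deriv h (f x))"
    by (rule continuous_on_compose2[OF holomorphic_on_imp_continuous_on[OF holomorphic_deriv[OF h]] C1_on_continuous_on[OF f(1)] f(2)])
  then show "continuous_on U (\<lambda>x. deriv h (f x) * frechet_derivative f (at x) v)" for v
    using f(1) by (intro continuous_on_mult) (auto simp: C1_on_def)
qed

lemma C1_on_cong:
  assumes "C1_on U f" "open U" "\<And>x. x \<in> U \<Longrightarrow> f x = g x"
  shows "C1_on U g"
proof (rule C1_onI)
  show "(g has_derivative frechet_derivative f (at x)) (at x)" if "x \<in> U" for x
    by (rule has_derivative_transform_within_open[OF C1_on_has_derivative[OF assms(1) that] assms(2) that assms(3)])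
  show "continuous_on U (\<lambda>x. frechet_derivative f (at x) v)" for v
    using assms(1) by (simp add: C1_on_def)
qed

lemma C1_on_mult:
  fixes f g :: "'a::euclidean_space \<Rightarrow> complex"
  shows "C1_on U f \<Longrightarrow> C1_on U g \<Longrightarrow> C1_on U (\<lambda>x. f x * g x)"
  by (rule C1_on_bilinear[OF bounded_bilinear_mult])

lemma C1_on_inverse:
  fixes f :: "'a::euclidean_space \<Rightarrow> complex"
  assumes "C1_on U f" "\<And>x. x \<in> U \<Longrightarrow> f x \<noteq> 0"
  shows "C1_on U (\<lambda>x. inverse (f x))"
  by (rule C1_on_holomorphic_compose[of inverse "- {0}"])
     (use assms in \<open>auto intro!: holomorphic_intros\<close>)

section \<open>Sliding along a hypersurface\<close>

text \<open>Two solutions are only ever compared on a common compact interval, so the derivative is taken within that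
interval, whatever larger interval a solution lives on.\<close>

definition inclusion_curve :: "('a::euclidean_space \<Rightarrow> 'a set) \<Rightarrow> real \<Rightarrow> real \<Rightarrow> (real \<Rightarrow> 'a) \<Rightarrow> bool" where
  "inclusion_curve F a s X \<longleftrightarrow> absolutely_continuous_fun_on {a..s} X \<and>
     (AE t in lborel. t \<in> {a..s} \<longrightarrow>
        (\<exists>V \<in> convex hull (F (X t)). (X has_vector_derivative V) (at t within {a..s})))"

lemma inclusion_curve_restrict:
  assumes "inclusion_curve F a s X" "a \<le> s'" "s' \<le> s"
  shows "inclusion_curve F a s' X"
  unfolding inclusion_curve_def
proof
  have sub: "{a..s'} \<subseteq> {a..s}" using assms by auto
  show "absolutely_continuous_fun_on {a..s'} X"
    using assms sub by (auto simp: inclusion_curve_def intro: absolutely_continuous_fun_on_subset)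
  have "AE t in lborel. t \<in> {a..s} \<longrightarrow>
        (\<exists>V \<in> convex hull (F (X t)). (X has_vector_derivative V) (at t within {a..s}))"
    using assms by (simp add: inclusion_curve_def)
  then show "AE t in lborel. t \<in> {a..s'} \<longrightarrow>
        (\<exists>V \<in> convex hull (F (X t)). (X has_vector_derivative V) (at t within {a..s'}))"
    by eventually_elim (use sub has_vector_derivative_within_subset[OF _ sub] in blast)
qed

text \<open>Up to its first exit from the ball the curve has speed at most \<open>M\<close>, so it has not travelled as far as \<open>r\<close>.\<close>

lemma inclusion_curve_stays_in_ball:
  assumes X: "inclusion_curve F a s X" "X a = z" and "M \<ge> 0"
    and F: "\<And>x V. x \<in> ball z r \<Longrightarrow> V \<in> F x \<Longrightarrow> norm V \<le> M"
    and s: "M * (s - a) < r" and t: "t \<in> {a..s}"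
  shows "X t \<in> ball z r"
proof (rule ccontr)
  assume "X t \<notin> ball z r"
  have hull: "norm V \<le> M" if "x \<in> ball z r" "V \<in> convex hull F x" for x V
  proof -
    have "F x \<subseteq> cball 0 M" using F that(1) by auto
    then have "convex hull F x \<subseteq> cball 0 M" by (simp add: subset_hull)
    then show ?thesis using that(2) by auto
  qed
  have cont: "continuous_on {a..s} X"
    using X(1) absolutely_continuous_fun_on_imp_continuous_on by (auto simp: inclusion_curve_def)
  define S where "S = {a..s} \<inter> X -` (- ball z r)"
  have "closed S" unfolding S_def
    by (rule continuous_closed_preimage[OF cont]) auto
  then have "compact S" by (metis S_def compact_Icc compact_Int_closed inf.left_idem)
  moreover have "S \<noteq> {}" using t \<open>X t \<notin> ball z r\<close> by (auto simp: S_def)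
  ultimately obtain \<tau> where \<tau>: "\<tau> \<in> S" "\<And>x. x \<in> S \<Longrightarrow> \<tau> \<le> x"
    using compact_attains_inf[of S] by blast
  have \<tau>': "a \<le> \<tau>" "\<tau> \<le> s" using \<tau>(1) by (auto simp: S_def)
  have inb: "X u \<in> ball z r" if "a \<le> u" "u < \<tau>" for u
    using that \<tau>' \<tau>(2)[of u] by (force simp: S_def)
  have X\<tau>: "inclusion_curve F a \<tau> X" by (rule inclusion_curve_restrict[OF X(1) \<tau>'])
  have "norm (X \<tau> - X a) \<le> M * (\<tau> - a)"
  proof (rule absolutely_continuous_norm_bound)
    show "AE t in lborel. t \<in> {a..\<tau>} \<longrightarrow> (\<exists>V. norm V \<le> M \<and> (X has_vector_derivative V) (at t within {a..\<tau>}))"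
    proof -
      have "AE t in lborel. t \<in> {a..\<tau>} \<longrightarrow> (\<exists>V \<in> convex hull (F (X t)). (X has_vector_derivative V) (at t within {a..\<tau>}))"
        using X\<tau> by (simp add: inclusion_curve_def)
      moreover have "AE t in lborel. t \<noteq> \<tau>" by (rule AE_lborel_singleton)
      ultimately show ?thesis
      proof eventually_elim
        case (elim t)
        show ?case
        proof
          assume "t \<in> {a..\<tau>}"
          then have "X t \<in> ball z r" using inb elim(2) by auto
          then show "\<exists>V. norm V \<le> M \<and> (X has_vector_derivative V) (at t within {a..\<tau>})"
            using elim(1) \<open>t \<in> {a..\<tau>}\<close> hull by blast
        qed
      qed
    qed
  qed (use X\<tau> \<tau>' \<open>M \<ge> 0\<close> in \<open>auto simp: inclusion_curve_def\<close>)
  also have "\<dots> \<le> M * (s - a)" using \<tau>' \<open>M \<ge> 0\<close> by (intro mult_left_mono) auto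
  also have "\<dots> < r" by (rule s)
  finally have "X \<tau> \<in> ball z r" using X(2) by (simp add: dist_norm norm_minus_commute)
  then show False using \<tau>(1) by (simp add: S_def)
qed

text \<open>A ball around a point of the hypersurface \<open>\<sigma> = 0\<close> in which the fields on both sides point towards the
hypersurface, with constants that are uniform on the ball. The assumption \<open>jump\<close> is what makes uniqueness work: on the
hypersurface the two fields differ by a multiple of a fixed vector, which by \<open>jump_transversal\<close> is not tangential.\<close>

locale sliding_region =
  fixes z :: "'a::euclidean_space" and r K M \<kappa> :: real
    and \<sigma> :: "'a \<Rightarrow> real" and D\<sigma> :: "'a \<Rightarrow> 'a \<Rightarrow> real"
    and fp fm :: "'a \<Rightarrow> 'a" and F :: "'a \<Rightarrow> 'a set" and e :: 'a and c :: "'a \<Rightarrow> real"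
  assumes r: "r > 0" and z: "\<sigma> z = 0"
    and K: "K \<ge> 0" and M: "M \<ge> 0" and \<kappa>: "\<kappa> > 0"
    and \<sigma>: "\<And>x. x \<in> ball z r \<Longrightarrow> (\<sigma> has_derivative D\<sigma> x) (at x)"
    and D\<sigma>_bound: "\<And>x v. x \<in> ball z r \<Longrightarrow> \<bar>D\<sigma> x v\<bar> \<le> K * norm v"
    and D\<sigma>_cont: "\<And>v. continuous_on (ball z r) v \<Longrightarrow> continuous_on (ball z r) (\<lambda>x. D\<sigma> x (v x))"
    and field_cont: "continuous_on (ball z r) fp" "continuous_on (ball z r) fm"
    and field_bound: "\<And>x. x \<in> ball z r \<Longrightarrow> norm (fp x) \<le> M" "\<And>x. x \<in> ball z r \<Longrightarrow> norm (fm x) \<le> M"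
    and field_lip: "\<And>x y. x \<in> ball z r \<Longrightarrow> y \<in> ball z r \<Longrightarrow> norm (fm x - fm y) \<le> K * norm (x - y)"
    and transversal: "\<And>x. x \<in> ball z r \<Longrightarrow> D\<sigma> x (fp x) < 0" "\<And>x. x \<in> ball z r \<Longrightarrow> D\<sigma> x (fm x) > 0"
    and jump: "\<And>x. x \<in> ball z r \<Longrightarrow> \<sigma> x = 0 \<Longrightarrow> fp x - fm x = c x *\<^sub>R e"
    and jump_transversal: "\<And>x. x \<in> ball z r \<Longrightarrow> \<bar>D\<sigma> x e\<bar> \<ge> \<kappa>"
    and F: "\<And>x. x \<in> ball z r \<Longrightarrow> F x = (if \<sigma> x > 0 then {fp x} else if \<sigma> x < 0 then {fm x} else {fp x, fm x})"
begin

text \<open>The coefficient \<open>\<alpha>\<close>, written with the derivative of \<open>\<sigma>\<close> instead of the unit normal: the norm of the gradient cancels.\<close>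

definition weight :: "'a \<Rightarrow> real" where
  "weight x = D\<sigma> x (fm x) / (D\<sigma> x (fm x) - D\<sigma> x (fp x))"

definition slide :: "'a \<Rightarrow> 'a" where
  "slide x = weight x *\<^sub>R fp x + (1 - weight x) *\<^sub>R fm x"

lemma linear_D\<sigma>: "x \<in> ball z r \<Longrightarrow> linear (D\<sigma> x)"
  using \<sigma> has_derivative_linear by blast

lemma weight_bounds: "x \<in> ball z r \<Longrightarrow> 0 < weight x" "x \<in> ball z r \<Longrightarrow> weight x < 1"
  using transversal[of x] by (auto simp: weight_def field_simps)

lemma slide_in_hull: "x \<in> ball z r \<Longrightarrow> \<sigma> x = 0 \<Longrightarrow> slide x \<in> convex hull F x"
proof -
  assume x: "x \<in> ball z r" "\<sigma> x = 0"
  have "F x = {fp x, fm x}" using F[OF x(1)] x(2) by simp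
  moreover have "slide x \<in> convex hull {fp x, fm x}"
    unfolding convex_hull_2 slide_def mem_Collect_eq
    by (intro exI[of _ "weight x"] exI[of _ "1 - weight x"]) (use weight_bounds[OF x(1)] in auto)
  ultimately show ?thesis by simp
qed

lemma slide_cont: "continuous_on (ball z r) slide"
proof -
  have "D\<sigma> x (fm x) - D\<sigma> x (fp x) \<noteq> 0" if "x \<in> ball z r" for x using transversal[OF that] by simp
  then show ?thesis
    unfolding slide_def weight_def by (intro continuous_intros D\<sigma>_cont field_cont) auto
qed

text \<open>Along the segment from \<open>fm x\<close> to \<open>fp x\<close> the affine function \<open>D\<sigma> x\<close> changes sign, so it vanishes exactly once.\<close>

lemma tangential_eq_slide:
  assumes x: "x \<in> ball z r" "\<sigma> x = 0" and V: "V \<in> convex hull F x" "D\<sigma> x V = 0"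
  shows "V = slide x"
proof -
  obtain u where u: "V = u *\<^sub>R fp x + (1 - u) *\<^sub>R fm x"
    using V(1) F[OF x(1)] x(2) by (auto simp: convex_hull_2) (metis add_diff_cancel_left')
  have "D\<sigma> x V = u * D\<sigma> x (fp x) + (1 - u) * D\<sigma> x (fm x)"
    unfolding u using linear_D\<sigma>[OF x(1)] by (simp add: linear_add linear_cmul)
  then have "u * (D\<sigma> x (fm x) - D\<sigma> x (fp x)) = D\<sigma> x (fm x)" using V(2) by (simp add: algebra_simps)
  then have "u = weight x" using transversal[OF x(1)] by (simp add: weight_def field_simps)
  then show ?thesis by (simp add: u slide_def)
qed

lemma in_ball:
  assumes "inclusion_curve F a s X" "X a = z" "M * (s - a) < r" "t \<in> {a..s}"
  shows "X t \<in> ball z r"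
proof (rule inclusion_curve_stays_in_ball[OF assms(1,2) M _ assms(3,4)])
  show "norm V \<le> M" if "x \<in> ball z r" "V \<in> F x" for x V
    using that field_bound[OF that(1)] F[OF that(1)] by (auto split: if_splits)
qed

lemma \<sigma>_lip:
  assumes "x \<in> ball z r" "y \<in> ball z r"
  shows "\<bar>\<sigma> x - \<sigma> y\<bar> \<le> K * norm (x - y)"
proof -
  have "norm (\<sigma> x - \<sigma> y) \<le> K * norm (x - y)"
  proof (rule differentiable_bound[OF convex_ball _ _ assms])
    show "(\<sigma> has_derivative D\<sigma> w) (at w within ball z r)" if "w \<in> ball z r" for w
      using \<sigma>[OF that] by (rule has_derivative_at_withinI)
    show "onorm (D\<sigma> w) \<le> K" if "w \<in> ball z r" for w
      using D\<sigma>_bound[OF that] K by (intro onorm_bound) auto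
  qed
  then show ?thesis by simp
qed

text \<open>Since both fields point towards the hypersurface, the derivative of \<open>\<sigma>\<^sup>2\<close> along the curve is nonpositive almost everywhere, and
\<open>\<sigma>\<^sup>2\<close> starts from zero.\<close>

lemma on_surface:
  assumes X: "inclusion_curve F a s X" "X a = z" "M * (s - a) < r" and t: "t \<in> {a..s}"
  shows "\<sigma> (X t) = 0"
proof -
  have ball: "X u \<in> ball z r" if "u \<in> {a..t}" for u
    using in_ball[OF X] that t by auto
  have Xt: "inclusion_curve F a t X" using X(1) t by (auto intro: inclusion_curve_restrict)
  define f where "f = (\<lambda>u. \<sigma> (X u) * \<sigma> (X u))"
  have "f t \<le> f a"
  proof (rule absolutely_continuous_nonincreasing[where f=f and a=a and b=t])
    have ac: "absolutely_continuous_fun_on {a..t} X" using Xt by (simp add: inclusion_curve_def)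
    show "absolutely_continuous_fun_on {a..t} f"
    proof (rule absolutely_continuous_fun_on_dominated[OF ac])
      fix u v assume uv: "u \<in> {a..t}" "v \<in> {a..t}"
      have b: "\<bar>\<sigma> (X w)\<bar> \<le> K * r" if "w \<in> {a..t}" for w
      proof -
        have "\<bar>\<sigma> (X w)\<bar> \<le> K * norm (X w - z)" using \<sigma>_lip[OF ball[OF that], of z] r z by simp
        also have "\<dots> \<le> K * r" using ball[OF that] K by (intro mult_left_mono) (auto simp: dist_norm norm_minus_commute)
        finally show ?thesis .
      qed
      have "f v - f u = (\<sigma> (X v) - \<sigma> (X u)) * (\<sigma> (X v) + \<sigma> (X u))" by (simp add: f_def algebra_simps)
      then have "norm (f v - f u) = \<bar>\<sigma> (X v) - \<sigma> (X u)\<bar> * \<bar>\<sigma> (X v) + \<sigma> (X u)\<bar>" by (simp add: abs_mult)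
      also have "\<dots> \<le> (K * norm (X v - X u)) * (2 * (K * r))"
        using b[OF uv(1)] b[OF uv(2)] \<sigma>_lip[OF ball[OF uv(2)] ball[OF uv(1)]] K
        by (intro mult_mono) auto
      finally show "norm (f v - f u) \<le> (2 * K * K * r) * norm (X v - X u) + 0 * (v - u)" by (simp add: algebra_simps)
    qed
    have "AE u in lborel. u \<in> {a..t} \<longrightarrow> (\<exists>V \<in> convex hull (F (X u)). (X has_vector_derivative V) (at u within {a..t}))"
      using Xt by (simp add: inclusion_curve_def)
    then show "AE u in lborel. u \<in> {a..t} \<longrightarrow> (\<exists>d\<le>0. (f has_vector_derivative d) (at u within {a..t}))"
    proof eventually_elim
      case (elim u)
      show ?case
      proof
        assume u: "u \<in> {a..t}"
        then obtain V where V: "V \<in> convex hull (F (X u))" "(X has_vector_derivative V) (at u within {a..t})" using elim by blast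
        note xb = ball[OF u]
        have "((\<lambda>u. \<sigma> (X u)) has_real_derivative D\<sigma> (X u) V) (at u within {a..t})"
          using has_vector_derivative_compose_has_derivative[OF V(2) \<sigma>[OF xb]]
          by (simp add: has_real_derivative_iff_has_vector_derivative)
        then have "(f has_vector_derivative (2 * (\<sigma> (X u) * D\<sigma> (X u) V))) (at u within {a..t})"
          unfolding f_def by (auto intro!: derivative_eq_intros simp flip: has_real_derivative_iff_has_vector_derivative)
        moreover have "\<sigma> (X u) * D\<sigma> (X u) V \<le> 0"
        proof -
          consider "\<sigma> (X u) > 0" | "\<sigma> (X u) < 0" | "\<sigma> (X u) = 0" by linarith
          then show ?thesis
          proof cases
            case 1
            then have "V = fp (X u)" using V(1) F[OF xb] by simp
            then show ?thesis using 1 transversal(1)[OF xb] by (simp add: mult_nonneg_nonpos)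
          next
            case 2
            then have "V = fm (X u)" using V(1) F[OF xb] by simp
            then show ?thesis using 2 transversal(2)[OF xb] by (simp add: mult_nonpos_nonneg)
          qed simp
        qed
        ultimately show "\<exists>d\<le>0. (f has_vector_derivative d) (at u within {a..t})" 
          by (intro exI[of _ "2 * (\<sigma> (X u) * D\<sigma> (X u) V)"]) simp
      qed
    qed
  qed (use t in auto)
  then have "\<sigma> (X t) * \<sigma> (X t) \<le> 0" using X(2) z by (simp add: f_def)
  then show ?thesis using zero_le_square[of "\<sigma> (X t)"] by (metis mult_eq_0_iff order_antisym)
qed

text \<open>As \<open>\<sigma>\<close> vanishes along the curve, almost all its velocities are tangential.\<close>

lemma solves_ode:
  assumes X: "inclusion_curve F a s X" "X a = z" "M * (s - a) < r" and "a < s" and t: "t \<in> {a..s}"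
  shows "(X has_vector_derivative slide (X t)) (at t within {a..s})"
proof (rule ae_derivative_continuous_imp_derivative[OF _ _ _ t])
  show ac: "absolutely_continuous_fun_on {a..s} X" using X(1) by (simp add: inclusion_curve_def)
  show "continuous_on {a..s} (\<lambda>t. slide (X t))"
    by (rule continuous_on_compose2[OF slide_cont absolutely_continuous_fun_on_imp_continuous_on[OF ac]])
       (use in_ball[OF X] in auto)
  have "AE u in lborel. u \<in> {a..s} \<longrightarrow> (\<exists>V \<in> convex hull (F (X u)). (X has_vector_derivative V) (at u within {a..s}))"
    using X(1) by (simp add: inclusion_curve_def)
  then show "AE u in lborel. u \<in> {a..s} \<longrightarrow> (X has_vector_derivative slide (X u)) (at u within {a..s})"
  proof eventually_elim
    case (elim u)
    show ?case
    proof
      assume u: "u \<in> {a..s}"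
      then obtain V where V: "V \<in> convex hull (F (X u))" "(X has_vector_derivative V) (at u within {a..s})" using elim by blast
      have xb: "X u \<in> ball z r" using in_ball[OF X u] .
      have "((\<lambda>u. \<sigma> (X u)) has_vector_derivative D\<sigma> (X u) V) (at u within {a..s})"
        by (rule has_vector_derivative_compose_has_derivative[OF V(2) \<sigma>[OF xb]])
      moreover have "((\<lambda>u. \<sigma> (X u)) has_vector_derivative 0) (at u within {a..s})"
        by (rule has_vector_derivative_transform[OF u _ has_vector_derivative_const[of 0]])
           (use on_surface[OF X] in auto)
      ultimately have "D\<sigma> (X u) V = 0"
        by (rule vector_derivative_unique_within_closed_interval[OF \<open>a < s\<close> u[folded box_real(2)], unfolded box_real(2)])
      then have "V = slide (X u)" using tangential_eq_slide[OF xb on_surface[OF X u] V(1)] by simp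
      then show "(X has_vector_derivative slide (X u)) (at u within {a..s})" using V(2) by simp
    qed
  qed
qed

text \<open>The orthogonal projection along \<open>e\<close>. On the hypersurface it takes the same value at \<open>slide x\<close> and at \<open>fm x\<close>.\<close>

definition proj :: "'a \<Rightarrow> 'a" where
  "proj v = v - ((v \<bullet> e) / (e \<bullet> e)) *\<^sub>R e"

lemma e_nonzero: "e \<noteq> 0"
proof
  assume "e = 0"
  have "z \<in> ball z r" using r by simp
  then have "D\<sigma> z 0 = 0" using linear_0[OF linear_D\<sigma>] by blast
  then show False using jump_transversal[OF \<open>z \<in> ball z r\<close>] \<kappa> \<open>e = 0\<close> by simp
qed

lemma bounded_linear_proj: "bounded_linear proj"
  unfolding linear_conv_bounded_linear[symmetric]
  by (rule linearI) (simp_all add: proj_def inner_add_left scaleR_add_left add_divide_distrib scaleR_diff_right)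

lemma proj_e: "proj (u *\<^sub>R e) = 0"
  using e_nonzero by (simp add: proj_def)

lemma norm_proj: "norm (proj v) \<le> norm v"
proof -
  have "proj v \<bullet> e = 0" using e_nonzero by (simp add: proj_def inner_diff_left)
  then have "(norm v)\<^sup>2 = (norm (proj v))\<^sup>2 + (norm (((v \<bullet> e) / (e \<bullet> e)) *\<^sub>R e))\<^sup>2"
    by (subst norm_add_Pythagorean[symmetric]) (auto simp: orthogonal_def proj_def)
  then have "(norm (proj v))\<^sup>2 \<le> (norm v)\<^sup>2" by simp
  then show ?thesis by (rule power2_le_imp_le) simp
qed

text \<open>The hypersurface is a Lipschitz graph over the hyperplane orthogonal to \<open>e\<close>. By the mean value theorem some \<open>D\<sigma> w\<close>
annihilates \<open>x - y\<close>, and since \<open>D\<sigma> w e\<close> is bounded away from zero this bounds the component of \<open>x - y\<close> along \<open>e\<close> by the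
projection.\<close>

lemma proj_bound_on_surface:
  assumes x: "x \<in> ball z r" "\<sigma> x = 0" and y: "y \<in> ball z r" "\<sigma> y = 0"
  shows "norm (x - y) \<le> (1 + K * norm e / \<kappa>) * norm (proj (x - y))"
proof -
  define u where "u = ((x - y) \<bullet> e) / (e \<bullet> e)"
  have dec: "x - y = proj (x - y) + u *\<^sub>R e" by (simp add: proj_def u_def)
  have seg: "closed_segment y x \<subseteq> ball z r" using x y convex_contains_segment convex_ball by blast
  have "\<exists>w\<in>closed_segment y x. \<sigma> x - \<sigma> y = D\<sigma> w (x - y)"
  proof -
    have "\<exists>t\<in>{0<..<1::real}. \<sigma> (y + 1 *\<^sub>R (x - y)) - \<sigma> (y + 0 *\<^sub>R (x - y)) = (1 - 0) * D\<sigma> (y + t *\<^sub>R (x - y)) (x - y)"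
    proof -
      have inb: "y + t *\<^sub>R (x - y) \<in> ball z r" if "t \<in> {0..1}" for t
        using seg that by (force simp: closed_segment_def algebra_simps)
      have d: "((\<lambda>t. \<sigma> (y + t *\<^sub>R (x - y))) has_vector_derivative D\<sigma> (y + t *\<^sub>R (x - y)) (x - y)) (at t within {0..1})"
        if "t \<in> {0..1}" for t
        by (rule has_vector_derivative_compose_has_derivative[where X="\<lambda>t. y + t *\<^sub>R (x - y)" and f=\<sigma>, OF _ \<sigma>[OF inb[OF that]]])
           (auto intro!: derivative_eq_intros)
      show ?thesis
        using mvt_simple[of 0 1 "\<lambda>t. \<sigma> (y + t *\<^sub>R (x - y))" "\<lambda>t h. h * D\<sigma> (y + t *\<^sub>R (x - y)) (x - y)"] d
        by (force simp: has_vector_derivative_def)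
    qed
    then obtain t where "t \<in> {0<..<1}" "\<sigma> x - \<sigma> y = D\<sigma> (y + t *\<^sub>R (x - y)) (x - y)" by auto
    moreover have "y + t *\<^sub>R (x - y) \<in> closed_segment y x"
      using \<open>t \<in> {0<..<1}\<close> by (auto simp: closed_segment_def algebra_simps intro!: exI[of _ t])
    ultimately show ?thesis by blast
  qed
  then obtain w where w: "w \<in> ball z r" "D\<sigma> w (x - y) = 0" using seg x y by auto
  have "D\<sigma> w (proj (x - y)) + u * D\<sigma> w e = 0"
    using w(2) linear_D\<sigma>[OF w(1)] by (subst (asm) dec) (simp add: linear_add linear_cmul)
  then have "\<bar>u\<bar> * \<bar>D\<sigma> w e\<bar> = \<bar>D\<sigma> w (proj (x - y))\<bar>" 
    by (metis abs_minus_cancel abs_mult add_eq_0_iff)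
  then have "\<bar>u\<bar> * \<kappa> \<le> K * norm (proj (x - y))"
    using D\<sigma>_bound[OF w(1), of "proj (x - y)"] jump_transversal[OF w(1)]
    by (metis abs_ge_zero mult_left_mono order_trans)
  then have "\<bar>u\<bar> \<le> K * norm (proj (x - y)) / \<kappa>" using \<kappa> by (simp add: field_simps)
  then have "\<bar>u\<bar> * norm e \<le> K * norm (proj (x - y)) / \<kappa> * norm e"
    by (rule mult_right_mono) simp
  then have "norm (u *\<^sub>R e) \<le> K * norm (proj (x - y)) / \<kappa> * norm e" by simp
  moreover have "norm (x - y) \<le> norm (proj (x - y)) + norm (u *\<^sub>R e)" by (metis dec norm_triangle_ineq)
  ultimately show ?thesis by (simp add: algebra_simps)
qed

text \<open>Gronwall's inequality for the squared norm of the projected difference of the two curves. Its derivative only involves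
the Lipschitz field \<open>fm\<close>, as the weights disappear under the projection.\<close>

lemma unique:
  assumes X: "inclusion_curve F a s X" "X a = z" and Y: "inclusion_curve F a s Y" "Y a = z"
    and s: "M * (s - a) < r" "a \<le> s"
  shows "X s = Y s"
proof (cases "a = s")
  case True
  then show ?thesis using X Y by simp
next
  case False
  then have "a < s" using s by simp
  define L where "L = 1 + K * norm e / \<kappa>"
  have "L \<ge> 0" using K \<kappa> by (simp add: L_def)
  define w where "w = (\<lambda>t. proj (X t - Y t))"
  \<comment> \<open>The exponential factor turns the differential inequality into monotonicity.\<close>
  define f where "f = (\<lambda>t. exp (- (2 * K * L) * t) * (w t \<bullet> w t))"
  have dneg: "\<exists>d\<le>0. (f has_vector_derivative d) (at t within {a..s})" if t: "t \<in> {a..s}" for t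
  proof -
    note xb = in_ball[OF X s(1) t] in_ball[OF Y s(1) t]
    note x0 = on_surface[OF X s(1) t] on_surface[OF Y s(1) t]
    have sl: "proj (slide x) = proj (fm x)" if "x \<in> ball z r" "\<sigma> x = 0" for x
    proof -
      have "slide x = fm x + weight x *\<^sub>R (fp x - fm x)" by (simp add: slide_def algebra_simps)
      then have "slide x = fm x + (weight x * c x) *\<^sub>R e" using jump[OF that] by simp
      then show ?thesis using proj_e by (simp add: linear_add[OF bounded_linear.linear[OF bounded_linear_proj]])
    qed
    define v where "v = proj (fm (X t) - fm (Y t))"
    have v: "v = proj (slide (X t) - slide (Y t))"
      using sl xb x0 by (simp add: v_def linear_diff[OF bounded_linear.linear[OF bounded_linear_proj]])
    have "((\<lambda>t. X t - Y t) has_vector_derivative slide (X t) - slide (Y t)) (at t within {a..s})"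
      by (intro has_vector_derivative_diff solves_ode X Y s \<open>a < s\<close> t)
    then have dw: "(w has_vector_derivative v) (at t within {a..s})"
      unfolding w_def v by (rule bounded_linear.has_vector_derivative[OF bounded_linear_proj])
    have dww: "((\<lambda>t. w t \<bullet> w t) has_vector_derivative w t \<bullet> v + v \<bullet> w t) (at t within {a..s})"
      by (rule bounded_bilinear.has_vector_derivative[OF bounded_bilinear_inner dw dw])
    have "(f has_vector_derivative exp (- (2 * K * L) * t) * (w t \<bullet> v + v \<bullet> w t) - (2 * K * L) * exp (- (2 * K * L) * t) * (w t \<bullet> w t)) (at t within {a..s})"
      unfolding f_def using dww by (auto intro!: derivative_eq_intros simp flip: has_real_derivative_iff_has_vector_derivative)
    moreover have "w t \<bullet> v \<le> K * L * (w t \<bullet> w t)"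
    proof -
      have "norm v \<le> norm (fm (X t) - fm (Y t))" unfolding v_def by (rule norm_proj)
      also have "\<dots> \<le> K * norm (X t - Y t)" by (rule field_lip[OF xb])
      also have "\<dots> \<le> K * (L * norm (w t))"
        unfolding L_def w_def using proj_bound_on_surface[OF xb(1) x0(1) xb(2) x0(2)] K by (intro mult_left_mono) auto
      finally have "norm v \<le> K * L * norm (w t)" by simp
      then have "norm (w t) * norm v \<le> norm (w t) * (K * L * norm (w t))" by (intro mult_left_mono) auto
      then show ?thesis using norm_cauchy_schwarz[of "w t" v] by (simp add: dot_square_norm power2_eq_square algebra_simps)
    qed
    then have "exp (- (2 * K * L) * t) * (w t \<bullet> v + v \<bullet> w t) - (2 * K * L) * exp (- (2 * K * L) * t) * (w t \<bullet> w t) \<le> 0"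
    proof -
      have "exp (- (2 * K * L) * t) * (w t \<bullet> v + v \<bullet> w t) - (2 * K * L) * exp (- (2 * K * L) * t) * (w t \<bullet> w t)
        = 2 * exp (- (2 * K * L) * t) * (w t \<bullet> v - K * L * (w t \<bullet> w t))"
        by (simp add: inner_commute[of v] algebra_simps)
      then show ?thesis using \<open>w t \<bullet> v \<le> K * L * (w t \<bullet> w t)\<close> by (simp add: mult_le_0_iff)
    qed
    ultimately show ?thesis by blast
  qed
  have "f s \<le> f a"
  proof -
    obtain d where d: "\<And>t. t \<in> {a..s} \<Longrightarrow> d t \<le> 0 \<and> (f has_vector_derivative d t) (at t within {a..s})"
      using dneg by metis
    have "\<exists>t\<in>{a<..<s}. f s - f a = (s - a) *\<^sub>R d t"
      by (rule mvt_simple[OF \<open>a < s\<close>, of f "\<lambda>t h. h *\<^sub>R d t"]) (use d in \<open>auto simp: has_vector_derivative_def\<close>)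
    then obtain t where "t \<in> {a<..<s}" "f s - f a = (s - a) * d t" by auto
    moreover have "(s - a) * d t \<le> 0" using d[of t] \<open>t \<in> {a<..<s}\<close> by (intro mult_nonneg_nonpos) auto
    ultimately show ?thesis by simp
  qed
  moreover have "f a = 0" using X Y linear_0[OF bounded_linear.linear[OF bounded_linear_proj]] by (simp add: f_def w_def)
  ultimately have "w s \<bullet> w s \<le> 0" unfolding f_def by (simp add: mult_le_0_iff)
  then have "w s = 0" by (metis inner_gt_zero_iff not_le)
  moreover have sb: "s \<in> {a..s}" using s by simp
  have "norm (X s - Y s) \<le> (1 + K * norm e / \<kappa>) * norm (proj (X s - Y s))"
    by (rule proj_bound_on_surface) (use in_ball[OF X s(1) sb] in_ball[OF Y s(1) sb] on_surface[OF X s(1) sb] on_surface[OF Y s(1) sb] in auto)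
  ultimately show ?thesis by (simp add: w_def)
qed

end

lemma eventually_gt_nhds_if_continuous_on:
  fixes f :: "'a::metric_space \<Rightarrow> real"
  assumes "open U" "z \<in> U" "continuous_on U f" "a < f z"
  shows "\<forall>\<^sub>F x in nhds z. a < f x"
proof -
  have "(f \<longlongrightarrow> f z) (at z)" 

    using assms(2,3) continuous_on_eq_continuous_at[OF assms(1)] isContD by metis
  then have "(f \<longlongrightarrow> f z) (nhds z)" using tendsto_at_iff_tendsto_nhds by blast
  then show ?thesis using assms(4) by (rule order_tendstoD(1))
qed

text \<open>The strict inequalities at \<open>z\<close> persist nearby by continuity, and compactness of a closed ball yields the constants. That
\<open>e\<close> is transversal follows from the signs of \<open>D\<sigma> z\<close> on the two fields, whose difference is a multiple of \<open>e\<close>.\<close>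

lemma sliding_region_exists:
  fixes z :: "'a::euclidean_space"
  assumes U: "open U" "z \<in> U" and C1: "C1_on U \<sigma>" "C1_on U fp" "C1_on U fm" and z: "\<sigma> z = 0"
    and trans: "frechet_derivative \<sigma> (at z) (fp z) < 0" "frechet_derivative \<sigma> (at z) (fm z) > 0"
    and jump: "\<And>x. x \<in> U \<Longrightarrow> \<sigma> x = 0 \<Longrightarrow> fp x - fm x = c x *\<^sub>R e"
    and F: "\<And>x. x \<in> U \<Longrightarrow> F x = (if \<sigma> x > 0 then {fp x} else if \<sigma> x < 0 then {fm x} else {fp x, fm x})"
  shows "\<exists>r K M \<kappa>. sliding_region z r K M \<kappa> \<sigma> (\<lambda>x. frechet_derivative \<sigma> (at x)) fp fm F e c \<and> ball z r \<subseteq> U"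
proof -
  let ?D = "\<lambda>x. frechet_derivative \<sigma> (at x)"
  note cont = C1_on_continuous_on[OF C1(2)] C1_on_continuous_on[OF C1(3)]
  have Dcont: "continuous_on A (\<lambda>x. ?D x (v x))" if "A \<subseteq> U" "continuous_on A v" for A v
    using C1_on_continuous_derivative[OF C1(1), of A "\<lambda>x. x" v] that by (auto simp: continuous_on_id)
  have lin: "linear (?D z)" using C1(1) U(2) by (auto simp: C1_on_def intro: linear_frechet_derivative)
  have "c z * ?D z e = ?D z (fp z) - ?D z (fm z)"
    using jump[OF U(2) z] lin by (metis linear_cmul linear_diff real_scaleR_def)
  then have De: "?D z e \<noteq> 0" using trans by auto
  define \<kappa> where "\<kappa> = \<bar>?D z e\<bar> / 2"
  have \<kappa>: "\<kappa> > 0" "\<kappa> < \<bar>?D z e\<bar>" using De by (auto simp: \<kappa>_def)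
  have "\<forall>\<^sub>F x in nhds z. x \<in> U" using U by (simp add: eventually_nhds_in_open)
  moreover have "\<forall>\<^sub>F x in nhds z. ?D x (fp x) < 0"
    using eventually_gt_nhds_if_continuous_on[OF U continuous_on_minus[OF Dcont[OF order_refl cont(1)]], of 0] trans(1) by simp
  moreover have "\<forall>\<^sub>F x in nhds z. ?D x (fm x) > 0"
    by (rule eventually_gt_nhds_if_continuous_on[OF U Dcont[OF order_refl cont(2)] trans(2)])
  moreover have "\<forall>\<^sub>F x in nhds z. \<kappa> < \<bar>?D x e\<bar>"
  proof -
    have "continuous_on U (\<lambda>x. \<bar>?D x e\<bar>)" using Dcont[OF order_refl continuous_on_const] by (intro continuous_intros)
    from eventually_gt_nhds_if_continuous_on[OF U this \<kappa>(2)] show ?thesis .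
  qed
  ultimately have "\<forall>\<^sub>F x in nhds z. x \<in> U \<and> ?D x (fp x) < 0 \<and> ?D x (fm x) > 0 \<and> \<kappa> < \<bar>?D x e\<bar>"
    by eventually_elim auto
  then obtain d where d: "d > 0" "\<And>x. dist x z < d \<Longrightarrow> x \<in> U \<and> ?D x (fp x) < 0 \<and> ?D x (fm x) > 0 \<and> \<kappa> < \<bar>?D x e\<bar>"
    unfolding eventually_nhds_metric by blast
  define r where "r = d / 2"
  have r: "r > 0" using d by (simp add: r_def)
  have cb: "x \<in> U" "?D x (fp x) < 0" "?D x (fm x) > 0" "\<kappa> < \<bar>?D x e\<bar>" if "x \<in> cball z r" for x
    using d(2)[of x] that r by (auto simp: r_def dist_commute)
  have sub: "cball z r \<subseteq> U" using cb by auto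
  obtain K1 where K1: "K1 \<ge> 0" "\<And>x v. x \<in> cball z r \<Longrightarrow> norm (?D x v) \<le> K1 * norm v"
    using C1_on_derivative_bound[OF C1(1) compact_cball sub] by metis
  obtain K2 where K2: "K2 \<ge> 0" "\<And>x y. x \<in> cball z r \<Longrightarrow> y \<in> cball z r \<Longrightarrow> norm (fm x - fm y) \<le> K2 * norm (x - y)"
    using C1_on_lipschitz[OF C1(3) compact_cball convex_cball sub] by metis
  obtain K3 where K3: "K3 \<ge> 0" "\<And>x y. x \<in> cball z r \<Longrightarrow> y \<in> cball z r \<Longrightarrow> norm (fp x - fp y) \<le> K3 * norm (x - y)"
    using C1_on_lipschitz[OF C1(2) compact_cball convex_cball sub] by metis
  define K where "K = K1 + K2"
  define M where "M = norm (fp z) + norm (fm z) + (K2 + K3) * r"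
  have bound: "norm (f x) \<le> M" if "x \<in> ball z r" "f = fp \<and> L = K3 \<or> f = fm \<and> L = K2"
    for x f L
  proof -
    have zx: "z \<in> cball z r" "x \<in> cball z r" using that(1) r by auto
    have "norm (f x) \<le> norm (f z) + norm (f x - f z)" by (metis add.commute diff_add_cancel norm_triangle_ineq)
    moreover have "norm (f x - f z) \<le> L * norm (x - z)" using K2(2)[OF zx(2,1)] K3(2)[OF zx(2,1)] that(2) by auto
    moreover have "L * norm (x - z) \<le> (K2 + K3) * r"
      using that K2(1) K3(1) by (intro mult_mono) (auto simp: dist_norm norm_minus_commute)
    ultimately have "norm (f x) \<le> norm (f z) + (K2 + K3) * r" by linarith
    moreover have "norm (f z) \<le> norm (fp z) + norm (fm z)" using that(2) by auto
    ultimately show ?thesis unfolding M_def by linarith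
  qed
  have bsub: "ball z r \<subseteq> U" using sub by auto
  have "sliding_region z r K M \<kappa> \<sigma> ?D fp fm F e c"
  proof
    show "0 \<le> K" "0 \<le> M" using K1 K2 K3 r by (auto simp: K_def M_def)
    fix x v assume x: "x \<in> ball z r"
    then have xc: "x \<in> cball z r" by auto
    show "(\<sigma> has_derivative ?D x) (at x)" using C1_on_has_derivative[OF C1(1) cb(1)[OF xc]] .
    have "\<bar>?D x v\<bar> \<le> K1 * norm v" using K1(2)[OF xc, of v] by simp
    also have "\<dots> \<le> K * norm v" using K2(1) by (intro mult_right_mono) (auto simp: K_def)
    finally show "\<bar>?D x v\<bar> \<le> K * norm v" .
    show "norm (fp x) \<le> M" "norm (fm x) \<le> M" using bound[OF x] by blast+
    show "?D x (fp x) < 0" "0 < ?D x (fm x)" "\<kappa> \<le> \<bar>?D x e\<bar>" using cb[OF xc] by auto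
    show "fp x - fm x = c x *\<^sub>R e" if "\<sigma> x = 0" using jump[OF cb(1)[OF xc] that] .
    show "F x = (if \<sigma> x > 0 then {fp x} else if \<sigma> x < 0 then {fm x} else {fp x, fm x})"
      using F[OF cb(1)[OF xc]] .
  next
    fix x y assume "x \<in> ball z r" "y \<in> ball z r"
    then have "norm (fm x - fm y) \<le> K2 * norm (x - y)" using K2(2)[of x y] by simp
    also have "\<dots> \<le> K * norm (x - y)" using K1(1) by (intro mult_right_mono) (auto simp: K_def)
    finally show "norm (fm x - fm y) \<le> K * norm (x - y)" .
  next
    show "continuous_on (ball z r) fp" "continuous_on (ball z r) fm"
      using cont bsub by (auto intro: continuous_on_subset)
    show "continuous_on (ball z r) (\<lambda>x. ?D x (v x))" if "continuous_on (ball z r) v" for v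
      by (rule Dcont[OF bsub that])
  qed (use r z \<kappa> in auto)
  then show ?thesis using bsub by blast
qed

section \<open>Normals to level sets\<close>

text \<open>The curve in the definition of \<open>tangent_vector\<close> has to be differentiable at the origin only, so points of \<open>A\<close> that are nearly
closest to \<open>z + t *\<^sub>R w\<close> form such a curve.\<close>

lemma tangent_vector_if_infdist_small:
  fixes z w :: "'a::real_normed_vector"
  assumes z: "z \<in> A"
    and small: "\<And>\<epsilon>. \<epsilon> > 0 \<Longrightarrow> \<forall>\<^sub>F t in at (0::real). infdist (z + t *\<^sub>R w) A \<le> \<epsilon> * \<bar>t\<bar>"
  shows "tangent_vector A z w"
proof -
  have "\<exists>y\<in>A. dist (z + t *\<^sub>R w) y < infdist (z + t *\<^sub>R w) A + t\<^sup>2" if "t \<noteq> 0" for t :: real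
  proof -
    have "A \<noteq> {}" using z by auto
    then have "(INF a\<in>A. dist (z + t *\<^sub>R w) a) < infdist (z + t *\<^sub>R w) A + t\<^sup>2"
      using that by (simp add: infdist_notempty)
    then show ?thesis using cInf_lessD[of "dist (z + t *\<^sub>R w) ` A"] \<open>A \<noteq> {}\<close> by blast
  qed
  then obtain c' where c': "\<And>t::real. t \<noteq> 0 \<Longrightarrow> c' t \<in> A \<and> dist (z + t *\<^sub>R w) (c' t) < infdist (z + t *\<^sub>R w) A + t\<^sup>2"
    by metis
  define c where "c t = (if t = 0 then z else c' t)" for t
  show ?thesis unfolding tangent_vector_def
  proof (intro exI conjI)
    show "c 0 = z" by (simp add: c_def)
    show "\<forall>\<^sub>F t in at 0. c t \<in> A" using c' z by (auto simp: c_def)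
    show "(c has_vector_derivative w) (at 0)"
      unfolding has_vector_derivative_def has_derivative_at_alt
    proof (intro conjI allI impI)
      show "bounded_linear (\<lambda>x. x *\<^sub>R w)" by (rule bounded_linear_scaleR_left)
      fix \<epsilon> :: real assume "\<epsilon> > 0"
      then have "\<forall>\<^sub>F t in at (0::real). infdist (z + t *\<^sub>R w) A \<le> \<epsilon>/2 * \<bar>t\<bar>" by (intro small) auto
      then obtain d where d: "d > 0" "\<And>t. t \<noteq> 0 \<Longrightarrow> \<bar>t\<bar> < d \<Longrightarrow> infdist (z + t *\<^sub>R w) A \<le> \<epsilon>/2 * \<bar>t\<bar>"
        unfolding eventually_at by (auto simp: dist_real_def)
      show "\<exists>d>0. \<forall>y. norm (y - 0) < d \<longrightarrow> norm (c y - c 0 - (y - 0) *\<^sub>R w) \<le> \<epsilon> * norm (y - 0)"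
      proof (intro exI[of _ "min d (\<epsilon>/2)"] conjI allI impI)
        show "0 < min d (\<epsilon>/2)" using d \<open>\<epsilon> > 0\<close> by simp
        fix t :: real assume t: "norm (t - 0) < min d (\<epsilon>/2)"
        show "norm (c t - c 0 - (t - 0) *\<^sub>R w) \<le> \<epsilon> * norm (t - 0)"
        proof (cases "t = 0")
          case False
          have "t\<^sup>2 = \<bar>t\<bar> * \<bar>t\<bar>" by (simp add: power2_eq_square)
          also have "\<dots> \<le> \<epsilon>/2 * \<bar>t\<bar>" using t by (intro mult_right_mono) auto
          finally have "t\<^sup>2 \<le> \<epsilon>/2 * \<bar>t\<bar>" .
          then have "dist (z + t *\<^sub>R w) (c' t) \<le> \<epsilon> * \<bar>t\<bar>"
            using c'[OF False] d(2)[OF False] t by (auto simp: field_simps)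
          then show ?thesis using False by (simp add: c_def dist_norm norm_minus_commute algebra_simps)
        qed (simp add: c_def)
      qed
    qed
  qed
qed

text \<open>On the segment of half-length \<open>\<epsilon> * \<bar>t\<bar>\<close> in the direction of \<open>\<nu>\<close> around \<open>z + t *\<^sub>R w\<close>, the first-order expansion of \<open>\<sigma>\<close>
shows opposite signs at the two ends, so by the intermediate value theorem the segment meets the level set.\<close>

lemma infdist_level_set_small:
  fixes \<sigma> :: "'a::real_inner \<Rightarrow> real"
  assumes r: "r > 0" and cont: "continuous_on (ball z r) \<sigma>" and z: "\<sigma> z = 0"
    and der: "(\<sigma> has_derivative (\<lambda>h. h \<bullet> \<nu>)) (at z)" and \<nu>: "\<nu> \<noteq> 0" and w: "w \<bullet> \<nu> = 0"
    and A: "\<And>x. x \<in> ball z r \<Longrightarrow> \<sigma> x = 0 \<Longrightarrow> x \<in> A" and "\<epsilon> > 0"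
  shows "\<forall>\<^sub>F t in at (0::real). infdist (z + t *\<^sub>R w) A \<le> \<epsilon> * \<bar>t\<bar>"
proof -
  define u where "u = \<nu> /\<^sub>R norm \<nu>"
  have u: "norm u = 1" "u \<bullet> \<nu> = norm \<nu>" using \<nu> by (auto simp: u_def dot_square_norm power2_eq_square)
  define b where "b = norm w + \<epsilon>"
  have b: "b > 0" using \<open>\<epsilon> > 0\<close> by (simp add: b_def add_nonneg_pos)
  \<comment> \<open>With this tolerance the error of the expansion is at most half of the value of the linear part at the ends.\<close>
  define \<eta> where "\<eta> = \<epsilon> * norm \<nu> / (2 * b)"
  have \<eta>: "\<eta> > 0" using b \<nu> \<open>\<epsilon> > 0\<close> by (simp add: \<eta>_def)
  obtain d where d: "d > 0" "\<And>y. norm (y - z) < d \<Longrightarrow> norm (\<sigma> y - \<sigma> z - (y - z) \<bullet> \<nu>) \<le> \<eta> * norm (y - z)"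
    using der \<eta> unfolding has_derivative_at_alt by blast
  define d' where "d' = min d r / b"
  have "d' > 0" using d r b by (simp add: d'_def)
  moreover have "infdist (z + t *\<^sub>R w) A \<le> \<epsilon> * \<bar>t\<bar>" if t: "t \<noteq> 0" "\<bar>t\<bar> < d'" for t
  proof -
    define p where "p s = z + t *\<^sub>R w + (s * \<epsilon> * \<bar>t\<bar>) *\<^sub>R u" for s
    have nb: "norm (p s - z) \<le> \<bar>t\<bar> * b" if "\<bar>s\<bar> \<le> 1" for s
    proof -
      have "norm (p s - z) \<le> norm (t *\<^sub>R w) + norm ((s * \<epsilon> * \<bar>t\<bar>) *\<^sub>R u)"
        unfolding p_def using norm_triangle_ineq[of "t *\<^sub>R w" "(s * \<epsilon> * \<bar>t\<bar>) *\<^sub>R u"] by (simp add: add.assoc)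
      also have "\<dots> = \<bar>t\<bar> * norm w + \<bar>s\<bar> * (\<epsilon> * \<bar>t\<bar>)" using u \<open>\<epsilon> > 0\<close> by (simp add: abs_mult)
      also have "\<dots> \<le> \<bar>t\<bar> * norm w + 1 * (\<epsilon> * \<bar>t\<bar>)" using that \<open>\<epsilon> > 0\<close> by (intro add_left_mono mult_right_mono) auto
      finally show ?thesis by (simp add: b_def algebra_simps)
    qed
    have tb: "\<bar>t\<bar> * b < min d r" using t b by (simp add: d'_def field_simps)
    have inb: "p s \<in> ball z r" "norm (p s - z) < d" if "\<bar>s\<bar> \<le> 1" for s
      using nb[OF that] tb by (auto simp: dist_norm norm_minus_commute)
    have val: "(p s - z) \<bullet> \<nu> = s * \<epsilon> * \<bar>t\<bar> * norm \<nu>" for s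
      using w u by (simp add: p_def inner_add_left)
    have err: "norm (\<sigma> (p s) - (p s - z) \<bullet> \<nu>) \<le> \<epsilon> * \<bar>t\<bar> * norm \<nu> / 2" if "\<bar>s\<bar> \<le> 1" for s
    proof -
      have "norm (\<sigma> (p s) - (p s - z) \<bullet> \<nu>) \<le> \<eta> * norm (p s - z)" using d(2)[OF inb(2)[OF that]] z by simp
      also have "\<dots> \<le> \<eta> * (\<bar>t\<bar> * b)" using nb[OF that] \<eta> by (intro mult_left_mono) auto
      also have "\<dots> = \<epsilon> * \<bar>t\<bar> * norm \<nu> / 2" using b by (simp add: \<eta>_def)
      finally show ?thesis .
    qed
    have pos: "\<epsilon> * \<bar>t\<bar> * norm \<nu> > 0" using \<nu> t \<open>\<epsilon> > 0\<close> by simp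
    have "\<sigma> (p (-1)) \<le> 0" "0 \<le> \<sigma> (p 1)"
    proof -
      define q where "q = \<epsilon> * \<bar>t\<bar> * norm \<nu>"
      have "\<bar>\<sigma> (p 1) - q\<bar> \<le> q / 2" "\<bar>\<sigma> (p (-1)) + q\<bar> \<le> q / 2" "q > 0"
        using err[of 1] err[of "-1"] pos unfolding val q_def by simp_all
      then show "\<sigma> (p (-1)) \<le> 0" "0 \<le> \<sigma> (p 1)" by linarith+
    qed
    moreover have "continuous_on {-1..1} (\<lambda>s. \<sigma> (p s))"
      by (rule continuous_on_compose2[OF cont]) (use inb in \<open>auto simp: p_def intro!: continuous_intros\<close>)
    ultimately obtain s where s: "-1 \<le> s" "s \<le> 1" "\<sigma> (p s) = 0"
      using IVT'[of "\<lambda>s. \<sigma> (p s)" "-1" 0 1] by auto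
    then have "p s \<in> A" using inb A by simp
    then have "infdist (z + t *\<^sub>R w) A \<le> dist (z + t *\<^sub>R w) (p s)" by (rule infdist_le)
    also have "\<dots> = \<bar>s\<bar> * (\<epsilon> * \<bar>t\<bar>)" using u \<open>\<epsilon> > 0\<close> by (simp add: p_def dist_norm abs_mult)
    also have "\<dots> \<le> 1 * (\<epsilon> * \<bar>t\<bar>)" using s \<open>\<epsilon> > 0\<close> by (intro mult_right_mono) auto
    finally show ?thesis by simp
  qed
  ultimately show ?thesis unfolding eventually_at by (auto simp: dist_real_def)
qed

text \<open>The tangent vectors are exactly those orthogonal to \<open>\<nu>\<close>, which leaves two unit vectors; the requirement on the sides
singles out the one in which \<open>\<sigma>\<close> grows.\<close>

lemma unit_normal_level_set:
  fixes \<sigma> :: "'a::real_inner \<Rightarrow> real"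
  assumes r: "r > 0" and cont: "continuous_on (ball z r) \<sigma>" and z: "\<sigma> z = 0"
    and der: "(\<sigma> has_derivative (\<lambda>h. h \<bullet> \<nu>)) (at z)" and \<nu>: "\<nu> \<noteq> 0"
    and A: "\<And>x. x \<in> ball z r \<Longrightarrow> x \<in> A \<longleftrightarrow> \<sigma> x = 0"
    and Vp: "\<And>x. x \<in> ball z r \<Longrightarrow> x \<in> Vp \<longleftrightarrow> \<sigma> x > 0"
    and Vm: "\<And>x. x \<in> ball z r \<Longrightarrow> x \<in> Vm \<longleftrightarrow> \<sigma> x < 0"
  shows "unit_normal_from_to A Vm Vp z = \<nu> /\<^sub>R norm \<nu>"
proof -
  define u where "u = \<nu> /\<^sub>R norm \<nu>"
  have u: "norm u = 1" "u \<bullet> \<nu> = norm \<nu>" "u \<bullet> u = 1" "\<nu> = norm \<nu> *\<^sub>R u"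
    using \<nu> by (auto simp: u_def dot_square_norm power2_eq_square)
  have line: "((\<lambda>t. \<sigma> (z + t *\<^sub>R v)) has_real_derivative (v \<bullet> \<nu>)) (at 0)" for v
    unfolding has_real_derivative_iff_has_vector_derivative
    by (rule has_vector_derivative_compose_has_derivative[where X="\<lambda>t. z + t *\<^sub>R v" and f=\<sigma> and D="\<lambda>h. h \<bullet> \<nu>"])
       (use der in \<open>auto intro!: derivative_eq_intros\<close>)
  have inb: "\<forall>\<^sub>F t in at_right 0. z + t *\<^sub>R v \<in> ball z r" for v
  proof -
    have "((\<lambda>t. z + t *\<^sub>R v) \<longlongrightarrow> z + 0 *\<^sub>R v) (at_right 0)" by (intro tendsto_intros)
    then show ?thesis using r by (intro topological_tendstoD) auto
  qed
  have pos: "\<forall>\<^sub>F t in at_right 0. \<sigma> (z + t *\<^sub>R u) > 0"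
  proof -
    have "\<exists>d>0. \<forall>h>0. h < d \<longrightarrow> \<sigma> (z + 0 *\<^sub>R u) < \<sigma> (z + (0 + h) *\<^sub>R u)"
      by (rule DERIV_pos_inc_right[OF line]) (use u \<nu> in auto)
    then show ?thesis using z unfolding eventually_at_right_field by (auto intro: exI)
  qed
  have neg: "\<forall>\<^sub>F t in at_right 0. \<sigma> (z - t *\<^sub>R u) < 0"
  proof -
    have "\<exists>d>0. \<forall>h>0. h < d \<longrightarrow> \<sigma> (z + 0 *\<^sub>R - u) > \<sigma> (z + (0 + h) *\<^sub>R - u)"
      by (rule DERIV_neg_dec_right[OF line]) (use u \<nu> in auto)
    then show ?thesis using z unfolding eventually_at_right_field by auto
  qed
  have tangent: "w \<bullet> \<nu> = 0" if tw: "tangent_vector A z w" for w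
  proof -
    obtain c where c: "c 0 = z" "\<forall>\<^sub>F t in at 0. c t \<in> A" "(c has_vector_derivative w) (at (0::real))"
      using tw by (auto simp: tangent_vector_def)
    have "(c \<longlongrightarrow> z) (at 0)" using has_vector_derivative_continuous[OF c(3)] c(1) by (simp add: continuous_at)
    then have "\<forall>\<^sub>F t in at 0. c t \<in> ball z r" using r by (intro topological_tendstoD) auto
    then have "\<forall>\<^sub>F t in at 0. \<sigma> (c t) = 0" using c(2) by eventually_elim (use A in auto)
    then have ev: "\<forall>\<^sub>F t in nhds 0. \<sigma> (c t) = 0"
      using c(1) z by (simp add: eventually_at_filter) (auto elim: eventually_mono)
    have "((\<lambda>t. \<sigma> (c t)) has_real_derivative (w \<bullet> \<nu>)) (at 0)"
      using has_vector_derivative_compose_has_derivative[OF c(3), of \<sigma> "\<lambda>h. h \<bullet> \<nu>"] der c(1)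
      by (simp add: has_real_derivative_iff_has_vector_derivative)
    moreover have "((\<lambda>t. \<sigma> (c t)) has_real_derivative 0) (at 0)"
      using DERIV_cong_ev[OF refl ev refl, of 0] by auto
    ultimately show ?thesis by (rule DERIV_unique)
  qed
  have zA: "z \<in> A" using A[of z] z r by simp
  have tangent': "tangent_vector A z w" if "w \<bullet> \<nu> = 0" for w
    by (rule tangent_vector_if_infdist_small[OF zA infdist_level_set_small[OF r cont z der \<nu> that]]) (use A in auto)
  show ?thesis unfolding unit_normal_from_to_def u_def[symmetric]
  proof (rule the_equality)
    show "norm u = 1 \<and> (\<forall>w. tangent_vector A z w \<longrightarrow> u \<bullet> w = 0) \<and>
      (\<forall>\<^sub>F t in at_right 0. z + t *\<^sub>R u \<in> Vp \<and> z - t *\<^sub>R u \<in> Vm)"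
    proof (intro conjI allI impI)
      show "u \<bullet> w = 0" if "tangent_vector A z w" for w
        using tangent[OF that] \<nu> by (simp add: u_def inner_commute)
      show "\<forall>\<^sub>F t in at_right 0. z + t *\<^sub>R u \<in> Vp \<and> z - t *\<^sub>R u \<in> Vm"
        using pos neg inb[of u] inb[of "- u"] by eventually_elim (use Vp Vm in auto)
    qed (rule u)
    fix n assume n: "norm n = 1 \<and> (\<forall>w. tangent_vector A z w \<longrightarrow> n \<bullet> w = 0) \<and>
      (\<forall>\<^sub>F t in at_right 0. z + t *\<^sub>R n \<in> Vp \<and> z - t *\<^sub>R n \<in> Vm)"
    define w where "w = n - (n \<bullet> u) *\<^sub>R u"
    have wu: "w \<bullet> u = 0" by (simp add: w_def inner_diff_left u(3))
    then have "w \<bullet> \<nu> = 0" by (subst u(4)) simp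
    then have "n \<bullet> w = 0" using n tangent' by blast
    then have "w \<bullet> w = 0" using wu by (simp add: w_def inner_diff_left inner_diff_right inner_commute)
    then have nu: "n = (n \<bullet> u) *\<^sub>R u" by (simp add: w_def)
    then have "norm n = \<bar>n \<bullet> u\<bar>" using u(1) by (metis mult.right_neutral norm_scaleR)
    then have "\<bar>n \<bullet> u\<bar> = 1" using n by simp
    then consider "n \<bullet> u = 1" | "n \<bullet> u = -1" by linarith
    then show "n = u"
    proof cases
      case 2
      then have "n = - u" using nu by simp
      then have "\<forall>\<^sub>F t in at_right 0. z - t *\<^sub>R u \<in> Vp" using n by (auto elim: eventually_mono)
      then have "\<forall>\<^sub>F t in at_right (0::real). False"
        using neg inb[of "- u"] by eventually_elim (use Vp in auto)
      then show ?thesis by simp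
    qed (use nu in simp)
  qed
qed

section \<open>Maximizing glide directions\<close>

lemma max_glide_iff: "g \<in> max_glide G j k Z \<longleftrightarrow> g \<in> G \<and> (\<forall>h\<in>G. j k Z \<bullet> h \<le> j k Z \<bullet> g)"
  by (auto simp: max_glide_def is_arg_max_linorder)

lemma max_glide_nonempty: "finite G \<Longrightarrow> G \<noteq> {} \<Longrightarrow> max_glide G j k Z \<noteq> {}"
proof -
  assume "finite G" "G \<noteq> {}"
  then have "Max ((\<lambda>h. j k Z \<bullet> h) ` G) \<in> (\<lambda>h. j k Z \<bullet> h) ` G" by (intro Max_in) auto
  then obtain g where "g \<in> G" "j k Z \<bullet> g = Max ((\<lambda>h. j k Z \<bullet> h) ` G)" by auto
  then have "g \<in> max_glide G j k Z" using \<open>finite G\<close> by (auto simp: max_glide_iff)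
  then show ?thesis by blast
qed

lemma orthogonal_plane_representation:
  fixes v x :: "real^2"
  assumes "v \<noteq> 0" "v \<bullet> x = 0"
  obtains a where "x = a *\<^sub>R (J_mat *v v)"
proof -
  have n: "(v$1)\<^sup>2 + (v$2)\<^sup>2 \<noteq> 0" using assms(1) by (auto simp: vec_eq_iff forall_2 sum_power2_eq_zero_iff)
  have o: "v$1 * x$1 + v$2 * x$2 = 0" using assms(2) by (simp add: inner_vec_def sum_2)
  define a where "a = (x$1 * v$2 - x$2 * v$1) / ((v$1)\<^sup>2 + (v$2)\<^sup>2)"
  have "x$1 * ((v$1)\<^sup>2 + (v$2)\<^sup>2) = (x$1 * v$2 - x$2 * v$1) * v$2 + v$1 * (v$1 * x$1 + v$2 * x$2)"
    "x$2 * ((v$1)\<^sup>2 + (v$2)\<^sup>2) = - (x$1 * v$2 - x$2 * v$1) * v$1 + v$2 * (v$1 * x$1 + v$2 * x$2)"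
    by (simp_all add: power2_eq_square algebra_simps)
  then have "x$1 = a * v$2" "x$2 = - (a * v$1)" using n unfolding a_def o by (simp_all add: field_simps)
  then have "x = a *\<^sub>R (J_mat *v v)"
    by (simp add: vec_eq_iff forall_2 J_mat_def matrix_vector_mult_def sum_2)
  then show ?thesis by (rule that)
qed

text \<open>A line meets the unit circle in at most two points.\<close>

lemma three_unit_vectors_on_line:
  fixes v :: "real^2"
  assumes "norm g1 = 1" "norm g2 = 1" "norm g3 = 1" "v \<bullet> g1 = v \<bullet> g2" "v \<bullet> g1 = v \<bullet> g3"
    and "g1 \<noteq> g2" "g1 \<noteq> g3" "g2 \<noteq> g3"
  shows "v = 0"
proof (rule ccontr)
  assume "v \<noteq> 0"
  define w where "w = J_mat *v v"
  obtain a where a: "g2 - g1 = a *\<^sub>R w"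
    using orthogonal_plane_representation[OF \<open>v \<noteq> 0\<close>, of "g2 - g1"] assms(4) by (auto simp: inner_diff_right w_def)
  obtain b where b: "g3 - g1 = b *\<^sub>R w"
    using orthogonal_plane_representation[OF \<open>v \<noteq> 0\<close>, of "g3 - g1"] assms(5) by (auto simp: inner_diff_right w_def)
  have key: "2 * (g1 \<bullet> w) + c * (w \<bullet> w) = 0" if "g - g1 = c *\<^sub>R w" "norm g = 1" "g \<noteq> g1" for g c
  proof -
    have g: "g = g1 + c *\<^sub>R w" using that(1) by (simp add: algebra_simps)
    have "g \<bullet> g = 1" "g1 \<bullet> g1 = 1" using that(2) assms(1) by (simp_all add: dot_square_norm)
    then have "c * (2 * (g1 \<bullet> w) + c * (w \<bullet> w)) = 0" unfolding g
      by (simp add: inner_add_left inner_add_right inner_commute algebra_simps)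
    moreover have "c \<noteq> 0" using that(3) g by auto
    ultimately show ?thesis by simp
  qed
  have "2 * (g1 \<bullet> w) + a * (w \<bullet> w) = 0" "2 * (g1 \<bullet> w) + b * (w \<bullet> w) = 0"
    using key[OF a assms(2)] key[OF b assms(3)] assms(6,7) by simp_all
  then have "a * (w \<bullet> w) = b * (w \<bullet> w)" by linarith
  moreover have "w \<noteq> 0" using a assms(6) by auto
  ultimately have "g2 - g1 = g3 - g1" using a b by simp
  then show False using assms(8) by simp
qed

text \<open>Under a nonzero force the maximizing directions lie on a line and on the unit circle, so there are one or two of them.\<close>

lemma max_glide_singleton:
  assumes G: "glide_directions G" and nz: "j k Z \<noteq> 0" and c: "card (max_glide G j k Z) \<noteq> 2"
    and ne: "G \<noteq> {}"
  obtains g where "max_glide G j k Z = {g}" "g \<in> G"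
proof -
  have fin: "finite G" and unit: "\<And>g. g \<in> G \<Longrightarrow> norm g = 1" using G by (auto simp: glide_directions_def)
  obtain g1 where g1: "g1 \<in> max_glide G j k Z" using max_glide_nonempty[OF fin ne] by blast
  have "max_glide G j k Z = {g1}"
  proof (rule ccontr)
    assume "max_glide G j k Z \<noteq> {g1}"
    then obtain g2 where g2: "g2 \<in> max_glide G j k Z" "g2 \<noteq> g1" using g1 by blast
    then have "max_glide G j k Z \<noteq> {g1, g2}" using c by auto
    then obtain g3 where g3: "g3 \<in> max_glide G j k Z" "g3 \<noteq> g1" "g3 \<noteq> g2" using g1 g2 by blast
    have "j k Z = 0"
      by (rule three_unit_vectors_on_line[of g1 g2 g3])
         (use g1 g2 g3 unit in \<open>auto simp: max_glide_iff intro: order_antisym\<close>)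
    then show False using nz by simp
  qed
  moreover have "g1 \<in> G" using g1 by (simp add: max_glide_iff)
  ultimately show ?thesis using that by blast
qed

text \<open>A direction that is beaten by another one is still beaten by it nearby, and there are finitely many directions.\<close>

lemma max_glide_subset_nhds:
  assumes fin: "finite G" and cont: "isCont (j k) Z1"
  shows "\<forall>\<^sub>F Z in nhds Z1. max_glide G j k Z \<subseteq> max_glide G j k Z1"
proof -
  have "\<forall>g\<in>G - max_glide G j k Z1. \<forall>\<^sub>F Z in nhds Z1. g \<notin> max_glide G j k Z"
  proof
    fix g assume "g \<in> G - max_glide G j k Z1"
    then obtain h where h: "h \<in> G" "j k Z1 \<bullet> g < j k Z1 \<bullet> h" by (auto simp: max_glide_iff not_le)
    have "(j k \<longlongrightarrow> j k Z1) (nhds Z1)" using cont tendsto_at_iff_tendsto_nhds isContD by blast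
    then have "((\<lambda>Z. j k Z \<bullet> h - j k Z \<bullet> g) \<longlongrightarrow> j k Z1 \<bullet> h - j k Z1 \<bullet> g) (nhds Z1)"
      by (intro tendsto_intros)
    then have "\<forall>\<^sub>F Z in nhds Z1. 0 < j k Z \<bullet> h - j k Z \<bullet> g"
      using h(2) by (intro order_tendstoD(1)) auto
    then show "\<forall>\<^sub>F Z in nhds Z1. g \<notin> max_glide G j k Z"
      by eventually_elim (use h(1) in \<open>auto simp: max_glide_iff not_le\<close>)
  qed
  then have "\<forall>\<^sub>F Z in nhds Z1. \<forall>g\<in>G - max_glide G j k Z1. g \<notin> max_glide G j k Z"
    using fin by (intro eventually_ball_finite) auto
  moreover have "max_glide G j k Z \<subseteq> G" for Z by (auto simp: max_glide_iff)
  ultimately show ?thesis by (auto elim!: eventually_mono)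
qed

lemma max_glide_pair:
  assumes "max_glide G j l Z \<subseteq> {gp, gm}" "max_glide G j l Z \<noteq> {}" "gp \<in> G" "gm \<in> G"
  shows "max_glide G j l Z = (if j l Z \<bullet> (gp - gm) > 0 then {gp} else if j l Z \<bullet> (gp - gm) < 0 then {gm} else {gp, gm})"
proof -
  have p: "gp \<in> max_glide G j l Z \<longleftrightarrow> j l Z \<bullet> (gp - gm) \<ge> 0"
  proof
    assume "gp \<in> max_glide G j l Z"
    then show "j l Z \<bullet> (gp - gm) \<ge> 0" using assms(4) by (simp add: max_glide_iff inner_diff_right)
  next
    assume a: "j l Z \<bullet> (gp - gm) \<ge> 0"
    obtain g where g: "g \<in> max_glide G j l Z" "g = gp \<or> g = gm" using assms(1,2) by blast
    then have "j l Z \<bullet> g \<le> j l Z \<bullet> gp" using a by (auto simp: inner_diff_right)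
    then show "gp \<in> max_glide G j l Z" using g(1) assms(3) by (force simp: max_glide_iff)
  qed
  have m: "gm \<in> max_glide G j l Z \<longleftrightarrow> j l Z \<bullet> (gp - gm) \<le> 0"
  proof
    assume "gm \<in> max_glide G j l Z"
    then show "j l Z \<bullet> (gp - gm) \<le> 0" using assms(3) by (simp add: max_glide_iff inner_diff_right)
  next
    assume a: "j l Z \<bullet> (gp - gm) \<le> 0"
    obtain g where g: "g \<in> max_glide G j l Z" "g = gp \<or> g = gm" using assms(1,2) by blast
    then have "j l Z \<bullet> g \<le> j l Z \<bullet> gm" using a by (auto simp: inner_diff_right)
    then show "gm \<in> max_glide G j l Z" using g(1) assms(4) by (force simp: max_glide_iff)
  qed
  consider "j l Z \<bullet> (gp - gm) > 0" | "j l Z \<bullet> (gp - gm) < 0" | "j l Z \<bullet> (gp - gm) = 0" by linarith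
  then show ?thesis using p m assms(1) by cases auto
qed

text \<open>If all other dislocations have a single direction, the choice is confined to component \<open>l\<close>.\<close>

lemma Fset_eq_local_fields:
  fixes j :: "'n::finite \<Rightarrow> (real^2)^'n \<Rightarrow> real^2"
  assumes "\<And>k. k \<noteq> l \<Longrightarrow> max_glide G j k Z = {the_elem (max_glide G j k Z1)}"
  shows "Fset G j Z = (\<lambda>g. local_field G j l Z1 g Z) ` max_glide G j l Z"
proof -
  define h where "h k = the_elem (max_glide G j k Z1)" for k
  have "W \<in> Fset G j Z \<longleftrightarrow> (\<exists>g\<in>max_glide G j l Z. W = local_field G j l Z1 g Z)" for W
  proof
    assume W: "W \<in> Fset G j Z"
    then obtain g where g: "g \<in> max_glide G j l Z" "W $ l = (j l Z \<bullet> g) *\<^sub>R g" by (auto simp: Fset_def)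
    have "W $ k = (j k Z \<bullet> h k) *\<^sub>R h k" if "k \<noteq> l" for k
    proof -
      have "W $ k \<in> {(j k Z \<bullet> g) *\<^sub>R g |g. g \<in> max_glide G j k Z}" using W by (simp add: Fset_def)
      then show ?thesis unfolding assms[OF that] h_def by simp
    qed
    then have "W = local_field G j l Z1 g Z" using g by (auto simp: vec_eq_iff local_field_def h_def Let_def)
    then show "\<exists>g\<in>max_glide G j l Z. W = local_field G j l Z1 g Z" using g by blast
  next
    assume "\<exists>g\<in>max_glide G j l Z. W = local_field G j l Z1 g Z"
    then obtain g where g: "g \<in> max_glide G j l Z" "W = local_field G j l Z1 g Z" by blast
    show "W \<in> Fset G j Z" unfolding Fset_def
    proof (rule CollectI, rule allI)
      fix k show "W $ k \<in> {(j k Z \<bullet> g) *\<^sub>R g |g. g \<in> max_glide G j k Z}"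
        using g assms[of k] by (cases "k = l") (auto simp: local_field_def Let_def)
    qed
  qed
  then show ?thesis by auto
qed

section \<open>Sliding motion for continuously differentiable forces\<close>

lemma open_configs: 
  fixes \<Omega> :: "(real^2) set"
  assumes "open \<Omega>"
  shows "open (configs \<Omega> :: ((real^2)^'n::finite) set)"
proof -
  have "configs \<Omega> = (\<Inter>i. (\<lambda>Z::(real^2)^'n. Z $ i) -` \<Omega>) \<inter> (\<Inter>j. \<Inter>k\<in>-{j}. {Z. Z $ j \<noteq> Z $ k})"
    by (auto simp: configs_def)
  moreover have "open ((\<lambda>Z::(real^2)^'n. Z $ i) -` \<Omega>)" for i by (rule open_vimage_vec_nth[OF assms])
  moreover have "open {Z::(real^2)^'n. Z $ j \<noteq> Z $ k}" for j k
    by (intro open_Collect_neq continuous_intros)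
  ultimately show ?thesis by (auto intro!: open_Int open_INT)
qed

lemma C1_on_local_field:
  fixes j :: "'n::finite \<Rightarrow> (real^2)^'n \<Rightarrow> real^2"
  assumes "\<And>k. C1_on U (j k)"
  shows "C1_on U (local_field G j l Zhat g)"
proof (rule C1_on_vec)
  fix k
  define h where "h = (if k = l then g else the_elem (max_glide G j k Zhat))"
  have "bounded_linear (\<lambda>y. (y \<bullet> h) *\<^sub>R h)"
    by (rule bounded_linear_compose[OF bounded_linear_scaleR_left bounded_linear_inner_left])
  from C1_on_bounded_linear_compose[OF assms[of k] this]
  show "C1_on U (\<lambda>x. local_field G j l Zhat g x $ k)"
    by (simp add: local_field_def Let_def h_def)
qed

text \<open>Outside \<open>E_int\<close> and \<open>E_zero\<close> the other dislocations have a single maximizing direction at \<open>Z1\<close>, and no new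
directions can appear nearby.\<close>

lemma local_structure:
  fixes j :: "'n::finite \<Rightarrow> (real^2)^'n \<Rightarrow> real^2"
  assumes \<Omega>: "open \<Omega>" and j: "\<And>k. C1_on (configs \<Omega>) (j k)" and G: "glide_directions G"
    and Z1: "Z1 \<in> I_set \<Omega> G j l" and gpm: "max_glide G j l Z1 = {gp, gm}"
  shows "\<exists>U. open U \<and> Z1 \<in> U \<and> U \<subseteq> configs \<Omega> \<and>
    (\<forall>x\<in>U. max_glide G j l x =
       (if j l x \<bullet> (gp - gm) > 0 then {gp} else if j l x \<bullet> (gp - gm) < 0 then {gm} else {gp, gm})) \<and>
    (\<forall>x\<in>U. \<forall>k. k \<noteq> l \<longrightarrow> max_glide G j k x = {the_elem (max_glide G j k Z1)})"
proof -
  have oc: "open (configs \<Omega> :: ((real^2)^'n) set)" by (rule open_configs[OF \<Omega>])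
  have Z1c: "Z1 \<in> configs \<Omega>" using Z1 by (auto simp: I_set_def ambiguity_def)
  have fin: "finite G" using G by (simp add: glide_directions_def)
  have gG: "gp \<in> G" "gm \<in> G" using gpm max_glide_iff[of _ G j l Z1] by auto
  then have ne: "G \<noteq> {}" by auto
  have cont: "isCont (j k) Z1" for k
    using C1_on_continuous_on[OF j] continuous_on_eq_continuous_at[OF oc] Z1c by blast
  have sing: "\<exists>g. max_glide G j k Z1 = {g}" if "k \<noteq> l" for k
  proof -
    have "j k Z1 \<noteq> 0" using Z1 Z1c by (auto simp: I_set_def E_zero_def)
    moreover have "card (max_glide G j k Z1) \<noteq> 2"
      using Z1 that by (auto simp: I_set_def E_int_def ambiguity_def)
    ultimately show ?thesis using max_glide_singleton[OF G _ _ ne] by metis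
  qed
  have "\<forall>\<^sub>F x in nhds Z1. \<forall>k\<in>UNIV. max_glide G j k x \<subseteq> max_glide G j k Z1"
    by (intro eventually_ball_finite ballI max_glide_subset_nhds[OF fin cont]) simp
  moreover have "\<forall>\<^sub>F x in nhds Z1. x \<in> configs \<Omega>" using oc Z1c by (simp add: eventually_nhds_in_open)
  ultimately have "\<forall>\<^sub>F x in nhds Z1. x \<in> configs \<Omega> \<and> (\<forall>k. max_glide G j k x \<subseteq> max_glide G j k Z1)"
    by eventually_elim auto
  then obtain U where U: "open U" "Z1 \<in> U" "\<And>x. x \<in> U \<Longrightarrow> x \<in> configs \<Omega> \<and> (\<forall>k. max_glide G j k x \<subseteq> max_glide G j k Z1)"
    unfolding eventually_nhds by blast
  show ?thesis
  proof (intro exI[of _ U] conjI ballI allI impI)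
    show "open U" "Z1 \<in> U" "U \<subseteq> configs \<Omega>" using U by blast+
    show "max_glide G j l x =
       (if j l x \<bullet> (gp - gm) > 0 then {gp} else if j l x \<bullet> (gp - gm) < 0 then {gm} else {gp, gm})"
      if "x \<in> U" for x
      using U(3)[OF that] gpm by (intro max_glide_pair max_glide_nonempty fin ne gG) metis
    show "max_glide G j k x = {the_elem (max_glide G j k Z1)}" if "x \<in> U" "k \<noteq> l" for x k
    proof -
      obtain g where g: "max_glide G j k Z1 = {g}" using sing[OF \<open>k \<noteq> l\<close>] by blast
      have "max_glide G j k x \<subseteq> {g}" using U(3)[OF that(1)] g by metis
      then have "max_glide G j k x = {g}" using max_glide_nonempty[OF fin ne, of j k x] by blast
      then show ?thesis using g by simp
    qed
  qed
qed

lemma inclusion_solution_imp_curve: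
  assumes "inclusion_solution \<Omega> G j I X" "a \<in> I" "s \<in> I" "a \<le> s"
  shows "inclusion_curve (Fset G j) a s X"
proof -
  have sub: "{a..s} \<subseteq> I"
    using assms by (auto simp: inclusion_solution_def intro: mem_is_interval_1_I)
  have "AE t in lborel. t \<in> I \<longrightarrow>
        (\<exists>V \<in> convex hull (Fset G j (X t)). (X has_vector_derivative V) (at t within I))"
    using assms(1) by (simp add: inclusion_solution_def)
  then have "AE t in lborel. t \<in> {a..s} \<longrightarrow>
        (\<exists>V \<in> convex hull (Fset G j (X t)). (X has_vector_derivative V) (at t within {a..s}))"
  proof eventually_elim
    case (elim t)
    show ?case
    proof
      assume t: "t \<in> {a..s}"
      then obtain V where "V \<in> convex hull (Fset G j (X t))" "(X has_vector_derivative V) (at t within I)"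
        using elim sub by blast
      then show "\<exists>V \<in> convex hull (Fset G j (X t)). (X has_vector_derivative V) (at t within {a..s})"
        using has_vector_derivative_within_subset[OF _ sub] by blast
    qed
  qed
  then show ?thesis
    using assms(1) sub absolutely_continuous_fun_on_subset
    by (auto simp: inclusion_curve_def inclusion_solution_def)
qed

text \<open>The assumption \<open>Z1 \<in> I_set \<Omega> G j l\<close> excludes \<open>singular\<close>, so the gradient of \<open>\<sigma>\<close> does not vanish at \<open>Z1\<close>. Hence \<open>n\<close> is the
normalized gradient, the hypothesis \<open>transversal\<close> concerns derivatives of \<open>\<sigma>\<close>, and the local fields form a
\<open>sliding_region\<close>.\<close>

theorem sliding_motion:
  fixes j :: "'n::finite \<Rightarrow> (real^2)^'n \<Rightarrow> real^2"
  assumes \<Omega>: "open \<Omega>" and j: "\<And>k. C1_on (configs \<Omega>) (j k)" and G: "glide_directions G"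
    and sol: "inclusion_solution \<Omega> G j {-T..T} Z"
    and t1: "t1 \<in> {-T<..<T}" "Z t1 = Z1" "Z1 \<in> I_set \<Omega> G j l"
    and gpm: "max_glide G j l Z1 = {gp, gm}"
    and fpm: "fp = local_field G j l Z1 gp" "fm = local_field G j l Z1 gm"
    and n: "n = unit_normal_from_to (ambiguity \<Omega> G j l) (side \<Omega> G j l gm) (side \<Omega> G j l gp)"
    and transversal: "fm Z1 \<bullet> n Z1 > 0" "fp Z1 \<bullet> n Z1 < 0"
    and \<alpha>: "\<alpha> = (\<lambda>Y. (fm Y \<bullet> n Y) / (fm Y \<bullet> n Y - fp Y \<bullet> n Y))"
    and f0: "f0 = (\<lambda>Y. \<alpha> Y *\<^sub>R fp Y + (1 - \<alpha> Y) *\<^sub>R fm Y)"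
  shows "right_unique \<Omega> G j t1 Z1 \<and>
    (\<exists>\<delta>>0. t1 + \<delta> \<le> T \<and>
      (\<forall>t\<in>{t1..t1 + \<delta>}.
         Z t \<in> ambiguity \<Omega> G j l \<and>
         \<alpha> (Z t) \<in> {0<..<1} \<and>
         f0 (Z t) \<in> convex hull (Fset G j (Z t)) \<and>
         (Z has_vector_derivative f0 (Z t)) (at t within {t1..t1 + \<delta>})))"
proof -
  from local_structure[OF \<Omega> j G t1(3) gpm] obtain U where
    Uall: "open U \<and> Z1 \<in> U \<and> U \<subseteq> configs \<Omega> \<and>
    (\<forall>x\<in>U. max_glide G j l x =
       (if j l x \<bullet> (gp - gm) > 0 then {gp} else if j l x \<bullet> (gp - gm) < 0 then {gm} else {gp, gm})) \<and>
    (\<forall>x\<in>U. \<forall>k. k \<noteq> l \<longrightarrow> max_glide G j k x = {the_elem (max_glide G j k Z1)})"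
    by (elim exE)
  then have U: "open U" "Z1 \<in> U" "U \<subseteq> configs \<Omega>"
    and mg: "\<And>x. x \<in> U \<Longrightarrow> max_glide G j l x =
       (if j l x \<bullet> (gp - gm) > 0 then {gp} else if j l x \<bullet> (gp - gm) < 0 then {gm} else {gp, gm})"
    and mk: "\<And>x k. x \<in> U \<Longrightarrow> k \<noteq> l \<Longrightarrow> max_glide G j k x = {the_elem (max_glide G j k Z1)}"
    by blast+
  have Z1a: "Z1 \<in> ambiguity \<Omega> G j l" "Z1 \<notin> singular \<Omega> G j l" using t1(3) by (auto simp: I_set_def)
  have neq: "gp \<noteq> gm" using Z1a(1) gpm by (auto simp: ambiguity_def)
  define \<sigma> where "\<sigma> = (\<lambda>Y. j l Y \<bullet> (gp - gm))"
  note jU = C1_on_subset[OF j U(3)]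
  have \<sigma>C1: "C1_on U \<sigma>" unfolding \<sigma>_def
    by (rule C1_on_bounded_linear_compose[OF jU bounded_linear_inner_left])
  have fC1: "C1_on U fp" "C1_on U fm" unfolding fpm by (rule C1_on_local_field[OF jU])+
  have \<sigma>Z1: "\<sigma> Z1 = 0"
    using mg[OF U(2)] gpm neq by (auto simp: \<sigma>_def split: if_splits)
  define D where "D = (\<lambda>x. frechet_derivative \<sigma> (at x))"
  define \<nu> where "\<nu> = (\<lambda>x. \<Sum>i\<in>Basis. D x i *\<^sub>R i)"
  have D\<nu>: "D x v = v \<bullet> \<nu> x" if "x \<in> U" for x v
    using frechet_derivative_expand[of \<sigma> x v] \<sigma>C1 that
    by (simp add: D_def \<nu>_def inner_sum_right C1_on_def mult.commute)
  have der: "(\<sigma> has_derivative (\<lambda>h. h \<bullet> \<nu> x)) (at x)" if "x \<in> U" for x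
  proof -
    have "D x = (\<lambda>h. h \<bullet> \<nu> x)" using D\<nu>[OF that] by auto
    then show ?thesis using C1_on_has_derivative[OF \<sigma>C1 that] by (simp add: D_def)
  qed
  have normal: "n x = \<nu> x /\<^sub>R norm (\<nu> x)" if x: "x \<in> U" "\<sigma> x = 0" "\<nu> x \<noteq> 0" for x
  proof -
    obtain r where r: "r > 0" "ball x r \<subseteq> U" using U(1) x(1) open_contains_ball by blast
    show ?thesis unfolding n
    proof (rule unit_normal_level_set[OF r(1) _ x(2) der[OF x(1)] x(3)])
      show "continuous_on (ball x r) \<sigma>" using C1_on_continuous_on[OF \<sigma>C1] r(2) continuous_on_subset by blast
      fix y assume "y \<in> ball x r"
      then have y: "y \<in> U" "y \<in> configs \<Omega>" using r(2) U(3) by auto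
      show "y \<in> ambiguity \<Omega> G j l \<longleftrightarrow> \<sigma> y = 0"
        using y(2) mg[OF y(1)] neq by (auto simp: ambiguity_def \<sigma>_def)
      show "y \<in> side \<Omega> G j l gp \<longleftrightarrow> \<sigma> y > 0" "y \<in> side \<Omega> G j l gm \<longleftrightarrow> \<sigma> y < 0"
        using y(2) mg[OF y(1)] neq by (auto simp: side_def \<sigma>_def)
    qed
  qed
  have "\<nu> Z1 \<noteq> 0"
  proof
    assume "\<nu> Z1 = 0"
    then have "GDERIV \<sigma> Z1 :> 0" using der[OF U(2)] by (simp add: gderiv_def)
    then have "Z1 \<in> singular \<Omega> G j l" using Z1a(1) gpm \<sigma>Z1 unfolding singular_def \<sigma>_def by blast
    then show False using Z1a(2) by simp
  qed
  note nZ1 = normal[OF U(2) \<sigma>Z1 this]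
  have tr: "D Z1 (fp Z1) < 0" "D Z1 (fm Z1) > 0"
    using transversal \<open>\<nu> Z1 \<noteq> 0\<close> by (simp_all add: nZ1 D\<nu>[OF U(2)] zero_less_mult_iff mult_less_0_iff)
  define c where "c = (\<lambda>x. j l x \<bullet> gp)"
  \<comment> \<open>On the hypersurface the forces along \<open>gp\<close> and \<open>gm\<close> agree, so the fields differ by this common value times \<open>e\<close>.\<close>
  define e :: "(real^2)^'n" where "e = axis l (gp - gm)"
  have jump: "fp x - fm x = c x *\<^sub>R e" if "\<sigma> x = 0" for x
    using that by (auto simp: fpm local_field_def vec_eq_iff c_def e_def axis_def \<sigma>_def Let_def inner_diff_right algebra_simps)
  have F: "Fset G j x = (if \<sigma> x > 0 then {fp x} else if \<sigma> x < 0 then {fm x} else {fp x, fm x})" if "x \<in> U" for x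
    using Fset_eq_local_fields[of l G j x Z1, OF mk[OF that]] mg[OF that] by (auto simp: \<sigma>_def fpm)
  have "\<exists>r K M \<kappa>. sliding_region Z1 r K M \<kappa> \<sigma> D fp fm (Fset G j) e c \<and> ball Z1 r \<subseteq> U"
    unfolding D_def
  proof (rule sliding_region_exists[OF U(1,2) \<sigma>C1 fC1 \<sigma>Z1 tr[unfolded D_def]])
    show "fp x - fm x = c x *\<^sub>R e" if "\<sigma> x = 0" for x using that by (rule jump)
    show "Fset G j x = (if \<sigma> x > 0 then {fp x} else if \<sigma> x < 0 then {fm x} else {fp x, fm x})" if "x \<in> U" for x
      using that by (rule F)
  qed
  then obtain r K M \<kappa> where "sliding_region Z1 r K M \<kappa> \<sigma> D fp fm (Fset G j) e c \<and> ball Z1 r \<subseteq> U"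
    by (elim exE)
  then have reg: "sliding_region Z1 r K M \<kappa> \<sigma> D fp fm (Fset G j) e c" and ball: "ball Z1 r \<subseteq> U"
    by auto
  interpret sliding_region Z1 r K M \<kappa> \<sigma> D fp fm "Fset G j" e c by (rule reg)
  \<comment> \<open>The speed is at most \<open>M\<close>, so solutions stay in the ball during this time.\<close>
  define d where "d = r / (2 * (M + 1))"
  have d: "d > 0" "M * d < r" 
  proof -
    have "0 < M * r + r * 2" using r M by (intro add_nonneg_pos) auto
    then show "d > 0" "M * d < r" using r M by (auto simp: d_def field_simps)
  qed
  have Md: "M * (s - t1) < r" if "s \<le> t1 + d" for s
    using mult_left_mono[of "s - t1" d M] that M d by linarith
  have "right_unique \<Omega> G j t1 Z1"
    unfolding right_unique_def
  proof (intro exI[of _ "t1 + d"] conjI allI impI ballI)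
    fix I1 I2 X Y t
    assume X: "inclusion_solution \<Omega> G j I1 X" and Y: "inclusion_solution \<Omega> G j I2 Y"
      and t1I: "t1 \<in> I1" "t1 \<in> I2" and at: "X t1 = Z1" "Y t1 = Z1" and t: "t \<in> {t1..t1 + d} \<inter> I1 \<inter> I2"
    show "X t = Y t"
      using t by (intro unique[OF inclusion_solution_imp_curve[OF X t1I(1)] at(1) inclusion_solution_imp_curve[OF Y t1I(2)] at(2) Md]) auto
  qed (use d in simp)
  moreover
  define \<delta> where "\<delta> = min d (T - t1)"
  have \<delta>: "\<delta> > 0" "t1 + \<delta> \<le> T" "t1 + \<delta> \<le> t1 + d" using d t1(1) by (auto simp: \<delta>_def)
  have curve: "inclusion_curve (Fset G j) t1 (t1 + \<delta>) Z"
    by (rule inclusion_solution_imp_curve[OF sol]) (use t1(1) \<delta> in auto)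
  have "Z t \<in> ambiguity \<Omega> G j l \<and> \<alpha> (Z t) \<in> {0<..<1} \<and> f0 (Z t) \<in> convex hull (Fset G j (Z t)) \<and>
         (Z has_vector_derivative f0 (Z t)) (at t within {t1..t1 + \<delta>})" if t: "t \<in> {t1..t1 + \<delta>}" for t
  proof -
    have xb: "Z t \<in> ball Z1 r" and x0: "\<sigma> (Z t) = 0"
      using in_ball[OF curve t1(2) Md[OF \<delta>(3)] t] on_surface[OF curve t1(2) Md[OF \<delta>(3)] t] by auto
    have xU: "Z t \<in> U" using xb ball by blast
    have \<nu>nz: "\<nu> (Z t) \<noteq> 0" using transversal[OF xb] D\<nu>[OF xU] by auto
    have fn: "v \<bullet> n (Z t) = D (Z t) v / norm (\<nu> (Z t))" for v
      by (simp add: normal[OF xU x0 \<nu>nz] D\<nu>[OF xU] divide_inverse mult.commute)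
    have "\<alpha> (Z t) = weight (Z t)"
      using \<nu>nz by (simp add: \<alpha> fn weight_def flip: diff_divide_distrib)
    then have f0s: "f0 (Z t) = slide (Z t)" by (simp add: f0 slide_def)
    show ?thesis
    proof (intro conjI)
      show "Z t \<in> ambiguity \<Omega> G j l"
        using xU U(3) mg[OF xU] x0 neq by (auto simp: ambiguity_def \<sigma>_def)
      show "\<alpha> (Z t) \<in> {0<..<1}" using weight_bounds[OF xb] \<open>\<alpha> (Z t) = weight (Z t)\<close> by simp
      show "f0 (Z t) \<in> convex hull (Fset G j (Z t))" unfolding f0s by (rule slide_in_hull[OF xb x0])
      show "(Z has_vector_derivative f0 (Z t)) (at t within {t1..t1 + \<delta>})"
        unfolding f0s using \<delta> by (intro solves_ode[OF curve t1(2) Md[OF \<delta>(3)] _ t]) auto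
    qed
  qed
  ultimately show ?thesis using \<delta> by blast
qed

section \<open>Symmetry of second derivatives\<close>

definition second_difference :: "('a::real_vector \<Rightarrow> real) \<Rightarrow> 'a \<Rightarrow> 'a \<Rightarrow> 'a \<Rightarrow> real" where
  "second_difference u x v w = u (x + v + w) - u (x + v) - u (x + w) + u x"

text \<open>The mean value theorem in the direction \<open>v\<close> turns the second difference into \<open>v\<close> paired with an increment of the gradient,
which the derivative \<open>H\<close> of the gradient at \<open>x\<close> approximates.\<close>

lemma second_difference_quotient:
  fixes u :: "'a::real_inner \<Rightarrow> real"
  assumes S: "open S" "x \<in> S" and u: "\<And>y. y \<in> S \<Longrightarrow> (u has_derivative (\<lambda>h. h \<bullet> g y)) (at y)"
    and g: "(g has_derivative H) (at x)" and "\<epsilon> > 0"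
  shows "\<exists>d>0. \<forall>s. 0 < s \<longrightarrow> s < d \<longrightarrow>
    \<bar>second_difference u x (s *\<^sub>R v) (s *\<^sub>R w) - s\<^sup>2 * (v \<bullet> H w)\<bar>
      \<le> s\<^sup>2 * (2 * \<epsilon> * norm v * (norm v + norm w))"
proof -
  obtain d1 where d1: "d1 > 0" "ball x d1 \<subseteq> S" using S open_contains_ball by blast
  obtain d2 where d2: "d2 > 0" "\<And>y. norm (y - x) < d2 \<Longrightarrow> norm (g y - g x - H (y - x)) \<le> \<epsilon> * norm (y - x)"
    using g \<open>\<epsilon> > 0\<close> unfolding has_derivative_at_alt by blast
  have lin: "linear H" using g has_derivative_linear by blast
  define b where "b = norm v + norm w + 1"
  have b: "b > 0" using norm_ge_zero[of v] norm_ge_zero[of w] unfolding b_def by linarith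
  show ?thesis
  proof (intro exI[of _ "min d1 d2 / b"] conjI allI impI)
    show "0 < min d1 d2 / b" using d1 d2 b by simp
    fix s :: real assume s: "0 < s" "s < min d1 d2 / b"
    then have sb: "s * b < min d1 d2" using b by (simp add: field_simps)
    have small: "norm ((t * s) *\<^sub>R v + (t' * s) *\<^sub>R w) \<le> s * (norm v + norm w)" if "0 \<le> t" "t \<le> 1" "0 \<le> t'" "t' \<le> 1" for t t'
    proof -
      have "norm ((t * s) *\<^sub>R v + (t' * s) *\<^sub>R w) \<le> norm ((t * s) *\<^sub>R v) + norm ((t' * s) *\<^sub>R w)" by (rule norm_triangle_ineq)
      also have "\<dots> = t * (s * norm v) + t' * (s * norm w)" using that s by (simp add: abs_mult)
      also have "\<dots> \<le> 1 * (s * norm v) + 1 * (s * norm w)" using that s by (intro add_mono mult_right_mono) auto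
      finally show ?thesis by (simp add: algebra_simps)
    qed
    have small': "s * (norm v + norm w) < d1" "s * (norm v + norm w) < d2"
    proof -
      have "s * (norm v + norm w) \<le> s * b" using s by (intro mult_left_mono) (auto simp: b_def)
      then show "s * (norm v + norm w) < d1" "s * (norm v + norm w) < d2" using sb by auto
    qed
    have inS: "x + (t * s) *\<^sub>R v + (t' * s) *\<^sub>R w \<in> S" if "0 \<le> t" "t \<le> 1" "0 \<le> t'" "t' \<le> 1" for t t'
    proof -
      have "dist x (x + ((t * s) *\<^sub>R v + (t' * s) *\<^sub>R w)) < d1"
        using le_less_trans[OF small[OF that] small'(1)] by (simp only: dist_norm norm_minus_commute[of x] add_diff_cancel_left')
      then show ?thesis using d1(2) by (auto simp: add.assoc)
    qed
    have err: "norm (g (x + (t * s) *\<^sub>R v + (t' * s) *\<^sub>R w) - g x - H ((t * s) *\<^sub>R v + (t' * s) *\<^sub>R w)) \<le> \<epsilon> * (s * (norm v + norm w))"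
      if "0 \<le> t" "t \<le> 1" "0 \<le> t'" "t' \<le> 1" for t t'
    proof -
      have "norm (g (x + ((t * s) *\<^sub>R v + (t' * s) *\<^sub>R w)) - g x - H ((t * s) *\<^sub>R v + (t' * s) *\<^sub>R w))
          \<le> \<epsilon> * norm ((t * s) *\<^sub>R v + (t' * s) *\<^sub>R w)"
        using d2(2)[of "x + ((t * s) *\<^sub>R v + (t' * s) *\<^sub>R w)"] small[OF that] small' by simp
      also have "\<dots> \<le> \<epsilon> * (s * (norm v + norm w))" using small[OF that] \<open>\<epsilon> > 0\<close> by (intro mult_left_mono) auto
      finally show ?thesis by (simp add: add.assoc)
    qed
    define p where "p t t' = x + (t * s) *\<^sub>R v + (t' * s) *\<^sub>R w" for t t'
    define \<phi> where "\<phi> t = u (p t 1) - u (p t 0)" for t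
    have dp: "((\<lambda>t. p t t') has_vector_derivative s *\<^sub>R v) (at t within {0..1})" for t t'
      unfolding p_def by (auto intro!: derivative_eq_intros)
    have d\<phi>: "(\<phi> has_vector_derivative (s *\<^sub>R v) \<bullet> g (p t 1) - (s *\<^sub>R v) \<bullet> g (p t 0)) (at t within {0..1})"
      if "t \<in> {0..1}" for t
      unfolding \<phi>_def
      by (intro has_vector_derivative_diff has_vector_derivative_compose_has_derivative[OF dp] u)
         (use inS[of t 1] inS[of t 0] that in \<open>auto simp: p_def\<close>)
    have "\<exists>t\<in>{0<..<1}. \<phi> 1 - \<phi> 0 = (1 - 0) *\<^sub>R ((s *\<^sub>R v) \<bullet> g (p t 1) - (s *\<^sub>R v) \<bullet> g (p t 0))"
      by (rule mvt_simple[of 0 1 \<phi> "\<lambda>t h. h *\<^sub>R ((s *\<^sub>R v) \<bullet> g (p t 1) - (s *\<^sub>R v) \<bullet> g (p t 0))"])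
         (use d\<phi> in \<open>auto simp: has_vector_derivative_def\<close>)
    then obtain t where t: "t \<in> {0<..<1}" "\<phi> 1 - \<phi> 0 = s * (v \<bullet> (g (p t 1) - g (p t 0)))"
      by (auto simp: inner_diff_right algebra_simps)
    have t': "0 \<le> t" "t \<le> 1" using t(1) by auto
    define E where "E = g (p t 1) - g (p t 0) - s *\<^sub>R H w"
    have "E = (g (p t 1) - g x - H ((t * s) *\<^sub>R v + (1 * s) *\<^sub>R w)) - (g (p t 0) - g x - H ((t * s) *\<^sub>R v + (0 * s) *\<^sub>R w))"
      unfolding E_def by (simp add: linear_add[OF lin] linear_cmul[OF lin])
    then have "norm E \<le> norm (g (p t 1) - g x - H ((t * s) *\<^sub>R v + (1 * s) *\<^sub>R w)) + norm (g (p t 0) - g x - H ((t * s) *\<^sub>R v + (0 * s) *\<^sub>R w))"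
      by (metis norm_triangle_ineq4)
    also have "\<dots> \<le> \<epsilon> * (s * (norm v + norm w)) + \<epsilon> * (s * (norm v + norm w))"
      unfolding p_def by (intro add_mono err t') auto
    finally have E: "norm E \<le> 2 * \<epsilon> * (s * (norm v + norm w))" by simp
    have "second_difference u x (s *\<^sub>R v) (s *\<^sub>R w) - s\<^sup>2 * (v \<bullet> H w) = \<phi> 1 - \<phi> 0 - s\<^sup>2 * (v \<bullet> H w)"
      by (simp add: \<phi>_def p_def second_difference_def)
    also have "\<dots> = s * (v \<bullet> E)"
      unfolding t(2) E_def by (simp add: inner_diff_right power2_eq_square algebra_simps)
    finally have "\<bar>second_difference u x (s *\<^sub>R v) (s *\<^sub>R w) - s\<^sup>2 * (v \<bullet> H w)\<bar> = s * \<bar>v \<bullet> E\<bar>"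
      using s by (simp add: abs_mult)
    also have "\<dots> \<le> s * (norm v * norm E)" using s by (intro mult_left_mono Cauchy_Schwarz_ineq2) auto
    also have "\<dots> \<le> s * (norm v * (2 * \<epsilon> * (s * (norm v + norm w))))" using s E by (intro mult_left_mono) auto
    also have "\<dots> = s\<^sup>2 * (2 * \<epsilon> * norm v * (norm v + norm w))" by (simp add: power2_eq_square)
    finally show "\<bar>second_difference u x (s *\<^sub>R v) (s *\<^sub>R w) - s\<^sup>2 * (v \<bullet> H w)\<bar>
      \<le> s\<^sup>2 * (2 * \<epsilon> * norm v * (norm v + norm w))" .
  qed
qed

text \<open>The second difference does not change when \<open>v\<close> and \<open>w\<close> are exchanged, so it approximates both sides.\<close>

lemma second_derivative_symmetric:
  fixes u :: "'a::real_inner \<Rightarrow> real"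
  assumes S: "open S" "x \<in> S" and u: "\<And>y. y \<in> S \<Longrightarrow> (u has_derivative (\<lambda>h. h \<bullet> g y)) (at y)"
    and g: "(g has_derivative H) (at x)"
  shows "v \<bullet> H w = w \<bullet> H v"
proof -
  define b where "b = norm v + norm w"
  have "\<bar>v \<bullet> H w - w \<bullet> H v\<bar> \<le> 2 * \<epsilon> * b * b" if "\<epsilon> > 0" for \<epsilon>
  proof -
    note q = second_difference_quotient[OF S u g that]
    obtain d1 where d1: "d1 > 0" "\<And>s. 0 < s \<Longrightarrow> s < d1 \<Longrightarrow> \<bar>second_difference u x (s *\<^sub>R v) (s *\<^sub>R w) - s\<^sup>2 * (v \<bullet> H w)\<bar>
      \<le> s\<^sup>2 * (2 * \<epsilon> * norm v * (norm v + norm w))" using q[of v w] by blast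
    obtain d2 where d2: "d2 > 0" "\<And>s. 0 < s \<Longrightarrow> s < d2 \<Longrightarrow> \<bar>second_difference u x (s *\<^sub>R w) (s *\<^sub>R v) - s\<^sup>2 * (w \<bullet> H v)\<bar>
      \<le> s\<^sup>2 * (2 * \<epsilon> * norm w * (norm w + norm v))" using q[of w v] by blast
    define s where "s = min d1 d2 / 2"
    have s: "0 < s" "s < d1" "s < d2" using d1(1) d2(1) by (auto simp: s_def)
    define \<Delta> where "\<Delta> = second_difference u x (s *\<^sub>R v) (s *\<^sub>R w)"
    have comm: "second_difference u x (s *\<^sub>R w) (s *\<^sub>R v) = \<Delta>"
      by (simp add: \<Delta>_def second_difference_def add_ac)
    have 1: "\<bar>\<Delta> - s\<^sup>2 * (v \<bullet> H w)\<bar> \<le> s\<^sup>2 * (2 * \<epsilon> * norm v * b)" using d1(2)[OF s(1,2)] by (simp add: \<Delta>_def b_def)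
    have 2: "\<bar>\<Delta> - s\<^sup>2 * (w \<bullet> H v)\<bar> \<le> s\<^sup>2 * (2 * \<epsilon> * norm w * b)"
      using d2(2)[OF s(1,3)] by (simp add: comm b_def add.commute)
    have "\<bar>s\<^sup>2 * (v \<bullet> H w) - s\<^sup>2 * (w \<bullet> H v)\<bar> \<le> s\<^sup>2 * (2 * \<epsilon> * norm v * b) + s\<^sup>2 * (2 * \<epsilon> * norm w * b)"
      using 1 2 by linarith
    then have "s\<^sup>2 * \<bar>v \<bullet> H w - w \<bullet> H v\<bar> \<le> s\<^sup>2 * (2 * \<epsilon> * b * b)"
    proof -
      have "s\<^sup>2 * \<bar>v \<bullet> H w - w \<bullet> H v\<bar> = \<bar>s\<^sup>2 * (v \<bullet> H w) - s\<^sup>2 * (w \<bullet> H v)\<bar>"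
        by (simp add: abs_mult flip: right_diff_distrib)
      moreover have "s\<^sup>2 * (2 * \<epsilon> * norm v * b) + s\<^sup>2 * (2 * \<epsilon> * norm w * b) = s\<^sup>2 * (2 * \<epsilon> * b * b)"
        by (simp add: b_def algebra_simps)
      ultimately show ?thesis using \<open>\<bar>s\<^sup>2 * (v \<bullet> H w) - s\<^sup>2 * (w \<bullet> H v)\<bar> \<le> _\<close> by linarith
    qed
    then show ?thesis using s(1) by (simp add: mult_le_cancel_left_pos)
  qed
  note le = this
  show ?thesis
  proof (rule ccontr)
    assume "v \<bullet> H w \<noteq> w \<bullet> H v"
    define D where "D = \<bar>v \<bullet> H w - w \<bullet> H v\<bar>"
    have "D > 0" using \<open>v \<bullet> H w \<noteq> w \<bullet> H v\<close> by (simp add: D_def)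
    define c where "c = b * b + 1"
    have c: "c > 0" "b * b < c" by (auto simp: c_def intro!: add_nonneg_pos)
    have "D \<le> 2 * (D / (2 * c)) * b * b"
      unfolding D_def by (rule le) (use \<open>D > 0\<close> c(1) in \<open>simp add: D_def\<close>)
    also have "\<dots> = D * (b * b / c)" using c(1) by (simp add: field_simps)
    also have "\<dots> < D * 1" using \<open>D > 0\<close> c by (intro mult_strict_left_mono) auto
    finally show False by simp
  qed
qed

section \<open>Functions near a graph boundary with vanishing tangential derivative\<close>

lemma J_mat_apply [simp]: "(J_mat *v x) $ 1 = x $ 2" "(J_mat *v x) $ 2 = - x $ 1"
  by (simp_all add: J_mat_def matrix_vector_mult_def sum_2)

lemma inner_J_mat: "(J_mat *v x) \<bullet> (J_mat *v y) = x \<bullet> y" "x \<bullet> (J_mat *v x) = 0" "(J_mat *v x) \<bullet> x = 0"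
  by (simp_all add: inner_vec_def sum_2)

lemma orthonormal_decomposition:
  assumes "norm (e :: real^2) = 1"
  shows "x = (x \<bullet> (J_mat *v e)) *\<^sub>R (J_mat *v e) + (x \<bullet> e) *\<^sub>R e"
proof -
  have n: "(e$1)\<^sup>2 + (e$2)\<^sup>2 = 1" using assms by (simp add: norm_vec_def L2_set_def sum_2)
  have "x$1 = x$1 * ((e$1)\<^sup>2 + (e$2)\<^sup>2)" "x$2 = x$2 * ((e$1)\<^sup>2 + (e$2)\<^sup>2)" using n by simp_all
  then show ?thesis by (simp add: vec_eq_iff forall_2 inner_vec_def sum_2 power2_eq_square algebra_simps)
qed

locale graph_domain =
  fixes \<Omega> :: "(real^2) set" and p e :: "real^2" and r :: real and \<phi> \<phi>' :: "real \<Rightarrow> real"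
  assumes \<Omega>: "open \<Omega>" and e: "norm e = 1" and r: "r > 0"
    and \<phi>: "\<And>s. (\<phi> has_real_derivative \<phi>' s) (at s)" and \<phi>': "continuous_on UNIV \<phi>'"
    and graph: "\<And>x. x \<in> ball p r \<Longrightarrow> x \<in> \<Omega> \<longleftrightarrow> \<phi> (x \<bullet> (J_mat *v e)) < x \<bullet> e"
begin

definition Je :: "real^2" where "Je = J_mat *v e"

lemma ee: "e \<bullet> e = 1" "Je \<bullet> Je = 1" "e \<bullet> Je = 0" "Je \<bullet> e = 0"
proof -
  show "e \<bullet> e = 1" using e by (simp add: dot_square_norm)
  then show "Je \<bullet> Je = 1" "e \<bullet> Je = 0" "Je \<bullet> e = 0" by (simp_all add: Je_def inner_J_mat)
qed

lemma decomp: "x = (x \<bullet> Je) *\<^sub>R Je + (x \<bullet> e) *\<^sub>R e"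
  unfolding Je_def by (rule orthonormal_decomposition[OF e])

lemma graph': "x \<in> ball p r \<Longrightarrow> x \<in> \<Omega> \<longleftrightarrow> \<phi> (x \<bullet> Je) < x \<bullet> e"
  unfolding Je_def by (rule graph)

lemma cont_\<phi>: "continuous_on A \<phi>"
  using \<phi> DERIV_continuous_on has_field_derivative_at_within by blast

lemma cont_comp: "continuous_on A (\<lambda>x. \<phi> (x \<bullet> Je))"
  by (rule continuous_on_compose2[OF cont_\<phi>[of UNIV]]) (auto intro!: continuous_intros)

text \<open>The point with tangential coordinate \<open>s\<close> at height \<open>h\<close> above the boundary.\<close>

definition c :: "real \<Rightarrow> real \<Rightarrow> real^2" where "c s h = s *\<^sub>R Je + (\<phi> s + h) *\<^sub>R e"

lemma c_coords: "c s h \<bullet> Je = s" "c s h \<bullet> e = \<phi> s + h"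
  by (simp_all add: c_def inner_add_left ee)

lemma c_eq: "c (x \<bullet> Je) (x \<bullet> e - \<phi> (x \<bullet> Je)) = x"
  using decomp[of x] by (simp add: c_def)

lemma not_in_closure: 
  assumes x: "x \<in> ball p r" "\<phi> (x \<bullet> Je) > x \<bullet> e"
  shows "x \<notin> closure \<Omega>"
proof -
  have "open {x \<in> ball p r. x \<bullet> e < \<phi> (x \<bullet> Je)}"
  proof -
    have "open {x. x \<bullet> e < \<phi> (x \<bullet> Je)}"
      by (intro open_Collect_less cont_comp continuous_intros)
    then have "open (ball p r \<inter> {x. x \<bullet> e < \<phi> (x \<bullet> Je)})" by (intro open_Int) auto
    then show ?thesis by (simp add: Int_def)
  qed
  moreover have "{x \<in> ball p r. x \<bullet> e < \<phi> (x \<bullet> Je)} \<inter> \<Omega> = {}" using graph' by fastforce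
  ultimately have "{x \<in> ball p r. x \<bullet> e < \<phi> (x \<bullet> Je)} \<inter> closure \<Omega> = {}"
    using open_Int_closure_eq_empty by blast
  then show ?thesis using x by blast
qed

lemma frontier_graph: 
  assumes "x \<in> frontier \<Omega>" "x \<in> ball p r"
  shows "\<phi> (x \<bullet> Je) = x \<bullet> e"
proof -
  have "x \<notin> \<Omega>" "x \<in> closure \<Omega>" using assms(1) \<Omega> by (auto simp: frontier_def interior_open)
  then show ?thesis using graph'[OF assms(2)] not_in_closure[OF assms(2)] by force
qed

lemma in_\<Omega>: "c s h \<in> ball p r \<Longrightarrow> h > 0 \<Longrightarrow> c s h \<in> \<Omega>"
  using graph'[of "c s h"] by (simp add: c_coords)

lemma in_frontier:
  assumes "c s 0 \<in> ball p r"
  shows "c s 0 \<in> frontier \<Omega>"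
proof -
  have "c s 0 \<notin> \<Omega>" using graph'[OF assms] by (simp add: c_coords)
  moreover have "c s 0 \<in> closure \<Omega>"
    unfolding closure_approachable
  proof (intro allI impI)
    fix \<epsilon> :: real assume "\<epsilon> > 0"
    define h where "h = min \<epsilon> (r - dist p (c s 0)) / 2"
    have h: "h > 0" "h < \<epsilon>" "h < r - dist p (c s 0)" using assms \<open>\<epsilon> > 0\<close> by (auto simp: h_def min_def)
    have d: "dist (c s h) (c s 0) = h" using e h(1) by (simp add: c_def dist_norm algebra_simps flip: scaleR_diff_left)
    have "dist p (c s h) < r" using dist_triangle[of p "c s h" "c s 0"] d h(3) by (simp add: dist_commute)
    then have "c s h \<in> \<Omega>" using in_\<Omega> h(1) by simp
    then show "\<exists>y\<in>\<Omega>. dist y (c s 0) < \<epsilon>" using d h by (intro bexI[of _ "c s h"]) simp_all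
  qed
  ultimately show ?thesis using \<Omega> by (simp add: frontier_def interior_open)
qed

definition N :: "real \<Rightarrow> real^2" where
  "N s = (1 / sqrt (1 + (\<phi>' s)\<^sup>2)) *\<^sub>R (\<phi>' s *\<^sub>R Je - e)"

text \<open>A ray from a boundary point enters or leaves the domain according to the sign of the derivative, along the ray, of the
depth \<open>\<phi> (x \<bullet> Je) - x \<bullet> e\<close> below the graph.\<close>

lemma outer_normal:
  assumes q: "c s 0 \<in> ball p r"
  shows "outer_unit_normal \<Omega> (c s 0) (N s)"
proof -
  define k where "k = 1 / sqrt (1 + (\<phi>' s)\<^sup>2)"
  have pos: "1 + (\<phi>' s)\<^sup>2 > 0" by (rule add_pos_nonneg) auto
  then have k: "k > 0" by (simp add: k_def)
  have "(norm (\<phi>' s *\<^sub>R Je - e))\<^sup>2 = 1 + (\<phi>' s)\<^sup>2"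
    unfolding power2_norm_eq_inner by (simp add: inner_diff_left inner_diff_right ee power2_eq_square)
  then have "norm (\<phi>' s *\<^sub>R Je - e) = sqrt (1 + (\<phi>' s)\<^sup>2)" by (metis norm_ge_zero real_sqrt_unique)
  then have n1: "norm (N s) = 1" using pos by (simp add: N_def)
  have vN: "v \<bullet> N s = k * (\<phi>' s * (v \<bullet> Je) - v \<bullet> e)" for v
    by (simp add: N_def k_def inner_diff_right)
  have inb: "\<forall>\<^sub>F t in at_right 0. c s 0 + t *\<^sub>R v \<in> ball p r" for v
  proof -
    have "((\<lambda>t. c s 0 + t *\<^sub>R v) \<longlongrightarrow> c s 0 + 0 *\<^sub>R v) (at_right 0)" by (intro tendsto_intros)
    then show ?thesis using q by (intro topological_tendstoD) auto
  qed
  have der: "((\<lambda>t. \<phi> ((c s 0 + t *\<^sub>R v) \<bullet> Je) - (c s 0 + t *\<^sub>R v) \<bullet> e) has_real_derivative \<phi>' s * (v \<bullet> Je) - v \<bullet> e) (at 0)" for v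
    by (auto simp: inner_add_left c_coords intro!: derivative_eq_intros DERIV_chain2[OF \<phi>])
  show ?thesis unfolding outer_unit_normal_def
  proof (intro conjI allI impI n1)
    fix v assume "v \<bullet> N s < 0"
    then have "\<phi>' s * (v \<bullet> Je) - v \<bullet> e < 0" using k by (simp add: vN mult_less_0_iff)
    from DERIV_neg_dec_right[OF der this] have "\<forall>\<^sub>F t in at_right 0. \<phi> ((c s 0 + t *\<^sub>R v) \<bullet> Je) - (c s 0 + t *\<^sub>R v) \<bullet> e < 0"
      unfolding eventually_at_right_field by (auto simp: c_coords)
    then show "\<forall>\<^sub>F t in at_right 0. c s 0 + t *\<^sub>R v \<in> \<Omega>"
      using inb[of v] by eventually_elim (use graph' in auto)
  next
    fix v assume "v \<bullet> N s > 0"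
    then have "\<phi>' s * (v \<bullet> Je) - v \<bullet> e > 0" using k by (simp add: vN zero_less_mult_iff)
    from DERIV_pos_inc_right[OF der this] have "\<forall>\<^sub>F t in at_right 0. \<phi> ((c s 0 + t *\<^sub>R v) \<bullet> Je) - (c s 0 + t *\<^sub>R v) \<bullet> e > 0"
      unfolding eventually_at_right_field by (auto simp: c_coords)
    then show "\<forall>\<^sub>F t in at_right 0. c s 0 + t *\<^sub>R v \<notin> closure \<Omega>"
      using inb[of v] by eventually_elim (use not_in_closure in auto)
  qed
qed

text \<open>A quarter turn takes the normal to a multiple of the derivative of the boundary curve.\<close>

lemma J_N: "J_mat *v N s = (- 1 / sqrt (1 + (\<phi>' s)\<^sup>2)) *\<^sub>R (Je + \<phi>' s *\<^sub>R e)"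
  by (simp add: N_def Je_def vec_eq_iff forall_2 algebra_simps)

text \<open>Here \<open>M\<close> is the gradient of \<open>\<psi>\<close>. At small heights above the boundary \<open>\<psi>\<close> varies little in the tangential direction,
because the tangential component of \<open>M\<close> is continuous up to the boundary and vanishes there, and little in the vertical direction, because
\<open>M\<close> is bounded. By Cauchy's criterion \<open>\<psi>\<close> has one and the same limit at all boundary points near \<open>p\<close>.\<close>

lemma boundary_limit:
  fixes \<psi> :: "real^2 \<Rightarrow> real" and M :: "real^2 \<Rightarrow> real^2"
  assumes p: "p \<in> frontier \<Omega>"
    and der: "\<And>x. x \<in> \<Omega> \<inter> ball p r \<Longrightarrow> (\<psi> has_derivative (\<lambda>v. v \<bullet> M x)) (at x)"
    and cont: "continuous_on (closure \<Omega> \<inter> ball p r) M"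
    and bc: "\<And>x \<nu>. x \<in> frontier \<Omega> \<inter> ball p r \<Longrightarrow> outer_unit_normal \<Omega> x \<nu> \<Longrightarrow> M x \<bullet> (J_mat *v \<nu>) = 0"
  shows "\<exists>C \<rho>. \<rho> > 0 \<and> (\<forall>q\<in>frontier \<Omega> \<inter> ball p \<rho>. (\<psi> \<longlongrightarrow> C) (at q within \<Omega>))"
proof -
  define s0 where "s0 = p \<bullet> Je"
  have p_eq: "c s0 0 = p" using c_eq[of p] frontier_graph[OF p] r by (simp add: s0_def)
  have c_cont: "continuous_on A (\<lambda>(s, h). c s h)" for A
    unfolding c_def case_prod_unfold
    by (intro continuous_intros continuous_on_compose2[OF cont_\<phi>[of UNIV]]) auto
  have "isCont (\<lambda>(s, h). c s h) (s0, 0)"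
    using c_cont[of UNIV] continuous_on_eq_continuous_at[OF open_UNIV] by blast
  then obtain d where d: "d > 0" "\<And>y. dist y (s0, 0) < d \<Longrightarrow> dist (case y of (s, h) \<Rightarrow> c s h) p < r"
    using r unfolding continuous_at_eps_delta by (metis (no_types, lifting) case_prod_conv p_eq)
  define \<eta> where "\<eta> = d / 3"
  have \<eta>: "\<eta> > 0" using d by (simp add: \<eta>_def)
  define I where "I = {s0 - \<eta>..s0 + \<eta>}"
  have inb: "c s h \<in> ball p r" if "s \<in> I" "h \<in> {0..\<eta>}" for s h
  proof -
    have "dist (s, h) (s0, 0) \<le> \<bar>s - s0\<bar> + \<bar>h\<bar>"
      unfolding dist_Pair_Pair dist_real_def by (metis diff_zero sqrt_sum_squares_le_sum_abs power2_abs)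
    also have "\<dots> < d" using that d by (auto simp: I_def \<eta>_def abs_le_iff)
    finally show ?thesis using d(2)[of "(s, h)"] by (simp add: dist_commute)
  qed
  have incl: "c s h \<in> closure \<Omega>" if "s \<in> I" "h \<in> {0..\<eta>}" for s h
  proof (cases "h = 0")
    case True
    then show ?thesis using in_frontier[of s] inb[OF that] by (simp add: frontier_def)
  next
    case False
    then show ?thesis using in_\<Omega>[OF inb[OF that]] that(2) closure_subset by force
  qed
  have cM: "continuous_on (I \<times> {0..\<eta>}) (\<lambda>(s, h). M (c s h))"
    unfolding case_prod_unfold
    by (rule continuous_on_compose2[OF cont]) (use c_cont inb incl in \<open>auto simp: case_prod_unfold\<close>)
  define T where "T s = Je + \<phi>' s *\<^sub>R e" for s
  have cT: "continuous_on A T" for A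
    unfolding T_def by (intro continuous_intros continuous_on_subset[OF \<phi>']) auto
  have cMT: "continuous_on (I \<times> {0..\<eta>}) (\<lambda>(s, h). M (c s h) \<bullet> T s)"
    using cM unfolding case_prod_unfold
    by (intro continuous_intros continuous_on_compose2[OF cT[of UNIV]]) auto
  have comp: "compact (I \<times> {0..\<eta>})" unfolding I_def by (intro compact_Times compact_Icc)
  obtain K where K: "\<And>s h. s \<in> I \<Longrightarrow> h \<in> {0..\<eta>} \<Longrightarrow> \<bar>M (c s h) \<bullet> e\<bar> \<le> K"
  proof -
    have "compact ((\<lambda>(s, h). M (c s h)) ` (I \<times> {0..\<eta>}))" by (rule compact_continuous_image[OF cM comp])
    then have "bounded ((\<lambda>(s, h). M (c s h)) ` (I \<times> {0..\<eta>}))" by (rule compact_imp_bounded)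
    then obtain K where K: "\<forall>x\<in>(\<lambda>(s, h). M (c s h)) ` (I \<times> {0..\<eta>}). norm x \<le> K"
      unfolding bounded_iff by (elim exE)
    have "\<bar>M (c s h) \<bullet> e\<bar> \<le> K" if "s \<in> I" "h \<in> {0..\<eta>}" for s h
    proof -
      have "\<bar>M (c s h) \<bullet> e\<bar> \<le> norm (M (c s h)) * norm e" by (rule Cauchy_Schwarz_ineq2)
      also have "\<dots> = norm (M (c s h))" using e by simp
      also have "\<dots> \<le> K" by (rule bspec[OF K]) (use that in force)
      finally show ?thesis .
    qed
    then show ?thesis using that by blast
  qed
  have zero: "M (c s 0) \<bullet> T s = 0" if "s \<in> I" for s
  proof -
    have "c s 0 \<in> ball p r" using inb[OF that, of 0] \<eta> by simp
    then have "M (c s 0) \<bullet> (J_mat *v N s) = 0" using bc[OF _ outer_normal] in_frontier by simp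
    moreover have "1 + (\<phi>' s)\<^sup>2 > 0" by (rule add_pos_nonneg) auto
    ultimately show ?thesis unfolding J_N T_def by simp
  qed
  have unif: "\<exists>h0>0. \<forall>s\<in>I. \<forall>h\<in>{0..\<eta>}. h < h0 \<longrightarrow> \<bar>M (c s h) \<bullet> T s\<bar> \<le> \<epsilon>" if "\<epsilon> > 0" for \<epsilon>
  proof -
    define Q where "Q = (\<lambda>(s, h). M (c s h) \<bullet> T s)"
    have "uniformly_continuous_on (I \<times> {0..\<eta>}) Q"
      unfolding Q_def by (rule compact_uniformly_continuous[OF cMT comp])
    then obtain d where "d > 0"
      and d: "\<forall>x\<in>I \<times> {0..\<eta>}. \<forall>x'\<in>I \<times> {0..\<eta>}. dist x' x < d \<longrightarrow> dist (Q x') (Q x) < \<epsilon>"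
      using \<open>\<epsilon> > 0\<close> unfolding uniformly_continuous_on_def by blast
    have "\<bar>M (c s h) \<bullet> T s\<bar> \<le> \<epsilon>" if s: "s \<in> I" "h \<in> {0..\<eta>}" "h < d" for s h
    proof -
      have "dist (s, h) (s, 0) < d" using s by (simp add: dist_Pair_Pair)
      then have "dist (Q (s, h)) (Q (s, 0)) < \<epsilon>"
        using d[rule_format, of "(s, 0)" "(s, h)"] s \<eta> by simp
      then show ?thesis using zero[OF s(1)] by (simp add: Q_def)
    qed
    then show ?thesis using \<open>d > 0\<close> by blast
  qed
  have horiz: "\<bar>\<psi> (c s h) - \<psi> (c s' h)\<bar> \<le> \<epsilon> * \<bar>s - s'\<bar>"
    if h: "0 < h" "h \<le> \<eta>" and b: "\<And>s. s \<in> I \<Longrightarrow> \<bar>M (c s h) \<bullet> T s\<bar> \<le> \<epsilon>" and s: "s \<in> I" "s' \<in> I" for s s' h \<epsilon>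
  proof -
    have "norm (\<psi> (c s h) - \<psi> (c s' h)) \<le> \<epsilon> * norm (s - s')"
    proof (rule field_differentiable_bound[where S=I and f'="\<lambda>s. M (c s h) \<bullet> T s"])
      show "convex I" by (simp add: I_def)
      fix t assume t: "t \<in> I"
      have "c t h \<in> \<Omega> \<inter> ball p r" using inb[OF t, of h] in_\<Omega>[of t h] h by simp
      moreover have "((\<lambda>t. c t h) has_vector_derivative T t) (at t within I)"
        unfolding c_def T_def
        by (auto intro!: derivative_eq_intros has_field_derivative_at_within[OF \<phi>] simp: algebra_simps)
      ultimately have "((\<lambda>t. \<psi> (c t h)) has_vector_derivative T t \<bullet> M (c t h)) (at t within I)"
        using has_vector_derivative_compose_has_derivative[OF _ der] by blast
      then show "((\<lambda>t. \<psi> (c t h)) has_field_derivative M (c t h) \<bullet> T t) (at t within I)"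
        by (simp add: has_real_derivative_iff_has_vector_derivative inner_commute)
      show "norm (M (c t h) \<bullet> T t) \<le> \<epsilon>" using b[OF t] by simp
    qed (use s in auto)
    then show ?thesis by simp
  qed
  have vert: "\<bar>\<psi> (c s h) - \<psi> (c s h')\<bar> \<le> K * \<bar>h - h'\<bar>"
    if s: "s \<in> I" and h: "h \<in> {0<..\<eta>}" "h' \<in> {0<..\<eta>}" for s h h'
  proof -
    have "norm (\<psi> (c s h) - \<psi> (c s h')) \<le> K * norm (h - h')"
    proof (rule field_differentiable_bound[where S="{0<..\<eta>}" and f'="\<lambda>h. M (c s h) \<bullet> e"])
      show "convex {0<..\<eta>}" by simp
      fix t assume t: "t \<in> {0<..\<eta>}"
      have "c s t \<in> \<Omega> \<inter> ball p r" using inb[OF s, of t] in_\<Omega>[of s t] t by simp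
      moreover have "((\<lambda>t. c s t) has_vector_derivative e) (at t within {0<..\<eta>})"
        unfolding c_def by (auto intro!: derivative_eq_intros)
      ultimately have "((\<lambda>t. \<psi> (c s t)) has_vector_derivative e \<bullet> M (c s t)) (at t within {0<..\<eta>})"
        using has_vector_derivative_compose_has_derivative[OF _ der] by blast
      then show "((\<lambda>t. \<psi> (c s t)) has_field_derivative M (c s t) \<bullet> e) (at t within {0<..\<eta>})"
        by (simp add: has_real_derivative_iff_has_vector_derivative inner_commute)
      show "norm (M (c s t) \<bullet> e) \<le> K" using K[OF s, of t] t by simp
    qed (use h in auto)
    then show ?thesis by simp
  qed
  have s0I: "s0 \<in> I" using \<eta> by (simp add: I_def)
  have "K \<ge> 0" using K[OF s0I, of 0] \<eta> by (metis abs_ge_zero atLeastAtMost_iff less_eq_real_def order_trans)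
  have osc: "\<exists>h0>0. h0 \<le> \<eta> \<and> (\<forall>s\<in>I. \<forall>s'\<in>I. \<forall>h h'. 0 < h \<longrightarrow> h < h0 \<longrightarrow> 0 < h' \<longrightarrow> h' < h0 \<longrightarrow> \<bar>\<psi> (c s h) - \<psi> (c s' h')\<bar> \<le> \<epsilon>)"
    if "\<epsilon> > 0" for \<epsilon>
  proof -
    have "\<epsilon> / (4 * \<eta>) > 0" using that \<eta> by simp
    then obtain h0 where h0: "h0 > 0" "\<And>s h. s \<in> I \<Longrightarrow> h \<in> {0..\<eta>} \<Longrightarrow> h < h0 \<Longrightarrow> \<bar>M (c s h) \<bullet> T s\<bar> \<le> \<epsilon> / (4 * \<eta>)"
      using unif by blast
    \<comment> \<open>Half of \<open>\<epsilon>\<close> is spent on the tangential displacement, of length at most \<open>2 * \<eta>\<close>, and half on the vertical one.\<close>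
    define h1 where "h1 = min (min h0 \<eta>) (\<epsilon> / (2 * (K + 1)))"
    have h1: "h1 > 0" "h1 \<le> h0" "h1 \<le> \<eta>" "h1 \<le> \<epsilon> / (2 * (K + 1))"
      using h0(1) \<eta> \<open>K \<ge> 0\<close> that by (auto simp: h1_def)
    have K1: "K * h1 \<le> \<epsilon> / 2"
    proof -
      have "K * h1 \<le> (K + 1) * h1" using h1 by simp
      also have "\<dots> \<le> (K + 1) * (\<epsilon> / (2 * (K + 1)))" using h1 \<open>K \<ge> 0\<close> by (intro mult_left_mono) auto
      also have "\<dots> = \<epsilon> / 2" using \<open>K \<ge> 0\<close> by (simp add: field_simps)
      finally show ?thesis .
    qed
    have "\<bar>\<psi> (c s h) - \<psi> (c s' h')\<bar> \<le> \<epsilon>" if s: "s \<in> I" "s' \<in> I" and h: "0 < h" "h < h1" "0 < h'" "h' < h1" for s s' h h'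
    proof -
      have "\<bar>\<psi> (c s h) - \<psi> (c s' h)\<bar> \<le> \<epsilon> / (4 * \<eta>) * \<bar>s - s'\<bar>"
        using h h1 by (intro horiz h0(2) s) auto
      also have "\<dots> \<le> \<epsilon> / (4 * \<eta>) * (2 * \<eta>)"
        using s \<open>\<epsilon> / (4 * \<eta>) > 0\<close> by (intro mult_left_mono) (auto simp: I_def)
      also have "\<dots> = \<epsilon> / 2" using \<eta> by simp
      finally have 1: "\<bar>\<psi> (c s h) - \<psi> (c s' h)\<bar> \<le> \<epsilon> / 2" .
      have "\<bar>\<psi> (c s' h) - \<psi> (c s' h')\<bar> \<le> K * \<bar>h - h'\<bar>" using h h1 by (intro vert s) auto
      also have "\<dots> \<le> K * h1" using h \<open>K \<ge> 0\<close> by (intro mult_left_mono) auto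
      finally show ?thesis using 1 K1 by linarith
    qed
    then show ?thesis using h1 by blast
  qed
  define a where "a n = \<psi> (c s0 (\<eta> / real (n + 2)))" for n
  have hn: "(\<lambda>n. \<eta> / real (n + 2)) \<longlonglongrightarrow> 0"
    using LIMSEQ_ignore_initial_segment[OF lim_const_over_n[of \<eta>], of 2] by simp
  have "Cauchy a" unfolding Cauchy_def
  proof (intro allI impI)
    fix \<epsilon> :: real assume "\<epsilon> > 0"
    then have "\<epsilon> / 2 > 0" by simp
    from osc[OF this] obtain h0 where h0: "h0 > 0" "\<And>h h'. 0 < h \<Longrightarrow> h < h0 \<Longrightarrow> 0 < h' \<Longrightarrow> h' < h0 \<Longrightarrow> \<bar>\<psi> (c s0 h) - \<psi> (c s0 h')\<bar> \<le> \<epsilon> / 2"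
      using s0I by blast
    obtain n0 where n0: "\<And>n. n \<ge> n0 \<Longrightarrow> \<eta> / real (n + 2) < h0"
      using order_tendstoD(2)[OF hn h0(1)] unfolding eventually_sequentially by blast
    have "dist (a m) (a n) < \<epsilon>" if "m \<ge> n0" "n \<ge> n0" for m n
    proof -
      have "\<bar>a m - a n\<bar> \<le> \<epsilon> / 2" unfolding a_def using n0[OF that(1)] n0[OF that(2)] \<eta> by (intro h0(2)) auto
      then show ?thesis using \<open>\<epsilon> > 0\<close> by (simp add: dist_real_def)
    qed
    then show "\<exists>M. \<forall>m\<ge>M. \<forall>n\<ge>M. dist (a m) (a n) < \<epsilon>" by blast
  qed
  then obtain C where C: "a \<longlonglongrightarrow> C" using Cauchy_convergent_iff convergent_def by blast
  have close: "\<exists>h0>0. \<forall>s\<in>I. \<forall>h. 0 < h \<longrightarrow> h < h0 \<longrightarrow> \<bar>\<psi> (c s h) - C\<bar> \<le> \<epsilon>" if "\<epsilon> > 0" for \<epsilon>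
  proof -
    from osc[OF that] obtain h0 where h0: "h0 > 0" "\<And>s h h'. s \<in> I \<Longrightarrow> 0 < h \<Longrightarrow> h < h0 \<Longrightarrow> 0 < h' \<Longrightarrow> h' < h0 \<Longrightarrow> \<bar>\<psi> (c s h) - \<psi> (c s0 h')\<bar> \<le> \<epsilon>"
      using s0I by blast
    have "\<bar>\<psi> (c s h) - C\<bar> \<le> \<epsilon>" if "s \<in> I" "0 < h" "h < h0" for s h
    proof -
      have "(\<lambda>n. \<bar>\<psi> (c s h) - a n\<bar>) \<longlonglongrightarrow> \<bar>\<psi> (c s h) - C\<bar>" by (intro tendsto_intros C)
      moreover have "\<forall>\<^sub>F n in sequentially. \<bar>\<psi> (c s h) - a n\<bar> \<le> \<epsilon>"
        using order_tendstoD(2)[OF hn h0(1)]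
        by eventually_elim (use that \<eta> in \<open>auto simp: a_def intro!: h0(2)\<close>)
      ultimately show ?thesis by (rule tendsto_upperbound) simp
    qed
    then show ?thesis using h0(1) by blast
  qed
  define \<rho> where "\<rho> = min r \<eta>"
  have "(\<psi> \<longlongrightarrow> C) (at q within \<Omega>)" if q: "q \<in> frontier \<Omega> \<inter> ball p \<rho>" for q
  proof (rule tendstoI)
    fix \<epsilon> :: real assume "\<epsilon> > 0"
    then have "\<epsilon> / 2 > 0" by simp
    from close[OF this] obtain h0 where h0: "h0 > 0" "\<And>s h. s \<in> I \<Longrightarrow> 0 < h \<Longrightarrow> h < h0 \<Longrightarrow> \<bar>\<psi> (c s h) - C\<bar> \<le> \<epsilon> / 2" by blast
    have qb: "q \<in> ball p r" using q by (simp add: \<rho>_def)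
    have "continuous_on UNIV (\<lambda>x. x \<bullet> e - \<phi> (x \<bullet> Je))" by (intro continuous_intros cont_comp)
    then have "((\<lambda>x. x \<bullet> e - \<phi> (x \<bullet> Je)) \<longlongrightarrow> q \<bullet> e - \<phi> (q \<bullet> Je)) (at q within \<Omega>)"
      by (meson UNIV_I continuous_on_def tendsto_within_subset subset_UNIV)
    then have "((\<lambda>x. x \<bullet> e - \<phi> (x \<bullet> Je)) \<longlongrightarrow> 0) (at q within \<Omega>)"
      using frontier_graph[OF _ qb] q by simp
    then have "\<forall>\<^sub>F x in at q within \<Omega>. x \<bullet> e - \<phi> (x \<bullet> Je) < h0" using h0(1) by (rule order_tendstoD(2))
    moreover have "\<forall>\<^sub>F x in at q within \<Omega>. x \<in> ball p \<rho>"
      by (rule topological_tendstoD[OF tendsto_ident_at]) (use q in auto)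
    moreover have "\<forall>\<^sub>F x in at q within \<Omega>. x \<in> \<Omega>" by (simp add: eventually_at_filter)
    ultimately show "\<forall>\<^sub>F x in at q within \<Omega>. dist (\<psi> x) C < \<epsilon>"
    proof eventually_elim
      case (elim x)
      have "x \<bullet> e - \<phi> (x \<bullet> Je) > 0" using elim graph'[of x] by (simp add: \<rho>_def)
      moreover have "x \<bullet> Je \<in> I"
      proof -
        have "\<bar>(x - p) \<bullet> Je\<bar> \<le> norm (x - p) * norm Je" by (rule Cauchy_Schwarz_ineq2)
        also have "\<dots> = norm (x - p)" using ee(2) by (simp add: norm_eq_sqrt_inner)
        also have "\<dots> \<le> \<eta>" using elim(2) by (simp add: \<rho>_def dist_norm norm_minus_commute)
        finally show ?thesis by (simp add: I_def s0_def inner_diff_left abs_le_iff)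
      qed
      ultimately have "\<bar>\<psi> (c (x \<bullet> Je) (x \<bullet> e - \<phi> (x \<bullet> Je))) - C\<bar> \<le> \<epsilon> / 2" using elim(1) by (intro h0(2)) auto
      then show ?case using \<open>\<epsilon> > 0\<close> by (simp add: c_eq dist_real_def)
    qed
  qed
  moreover have "\<rho> > 0" using r \<eta> by (simp add: \<rho>_def)
  ultimately show ?thesis by blast
qed

end

lemma C2_holder_graph_domain:
  assumes "open \<Omega>" "norm e = 1" "r > 0" "C2_holder \<gamma> \<phi>" "\<And>x. x \<in> ball p r \<Longrightarrow> x \<in> \<Omega> \<longleftrightarrow> \<phi> (x \<bullet> (J_mat *v e)) < x \<bullet> e"
  obtains \<phi>' where "graph_domain \<Omega> p e r \<phi> \<phi>'"
proof -
  obtain \<phi>' \<phi>'' where d: "\<And>s. (\<phi> has_real_derivative \<phi>' s) (at s)" "\<And>s. (\<phi>' has_real_derivative \<phi>'' s) (at s)"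
    using assms(4) unfolding C2_holder_def by blast
  have "continuous_on UNIV \<phi>'" using d(2) DERIV_continuous_on has_field_derivative_at_within by blast
  then have "graph_domain \<Omega> p e r \<phi> \<phi>'" using assms d by unfold_locales auto
  then show ?thesis by (rule that)
qed

lemma at_within_frontier_nontrivial:
  assumes "open S" "q \<in> frontier S"
  shows "at q within S \<noteq> bot"
proof -
  have "q \<in> closure S" "q \<notin> S" using assms by (auto simp: frontier_def interior_open)
  then have "q islimpt S" by (simp add: closure_def)
  then show ?thesis by (simp add: trivial_limit_within)
qed

text \<open>The boundary value is a locally constant function on the connected frontier.\<close>

lemma frontier_limit_global:
  fixes \<psi> :: "'a::metric_space \<Rightarrow> real"
  assumes conn: "connected (frontier \<Omega>)" and \<Omega>: "open \<Omega>"
    and loc: "\<And>p. p \<in> frontier \<Omega> \<Longrightarrow> \<exists>C \<rho>. \<rho> > 0 \<and> (\<forall>q\<in>frontier \<Omega> \<inter> ball p \<rho>. (\<psi> \<longlongrightarrow> C) (at q within \<Omega>))"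
  shows "\<exists>C. \<forall>q\<in>frontier \<Omega>. (\<psi> \<longlongrightarrow> C) (at q within \<Omega>)"
proof (cases "frontier \<Omega> = {}")
  case False
  note nt = at_within_frontier_nontrivial[OF \<Omega>]
  define bval where "bval q = (SOME C. (\<psi> \<longlongrightarrow> C) (at q within \<Omega>))" for q
  have bval: "bval q = C" if "q \<in> frontier \<Omega>" "(\<psi> \<longlongrightarrow> C) (at q within \<Omega>)" for q C
    using that nt[OF that(1)] tendsto_unique unfolding bval_def by (metis someI)
  have lim: "(\<psi> \<longlongrightarrow> bval q) (at q within \<Omega>)" if "q \<in> frontier \<Omega>" for q
    using loc[OF that] that unfolding bval_def by (metis IntI centre_in_ball someI)
  obtain q0 where q0: "q0 \<in> frontier \<Omega>" using False by blast
  have "bval q = bval q0" if "q \<in> frontier \<Omega>" for q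
  proof (rule connected_local_const[OF conn that q0], rule ballI)
    fix a assume a: "a \<in> frontier \<Omega>"
    obtain C \<rho> where C: "\<rho> > 0" "\<And>q. q \<in> frontier \<Omega> \<inter> ball a \<rho> \<Longrightarrow> (\<psi> \<longlongrightarrow> C) (at q within \<Omega>)"
      using loc[OF a] by blast
    have "bval a = C" using bval[OF a C(2)] a C(1) by simp
    moreover have "\<forall>\<^sub>F b in at a within frontier \<Omega>. b \<in> frontier \<Omega> \<inter> ball a \<rho>"
      unfolding eventually_at using C(1) by (intro exI[of _ \<rho>]) (auto simp: dist_commute)
    ultimately show "\<forall>\<^sub>F b in at a within frontier \<Omega>. bval a = bval b"
      by (auto elim!: eventually_mono simp: bval[OF _ C(2)])
  qed
  then show ?thesis using lim by metis
qed simp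

section \<open>The Riemann map and the Green function\<close>

text \<open>If \<open>Im H\<close> exceeded \<open>C\<close>, it would attain an interior maximum, because the set where it is at least some \<open>m > C\<close> is compact.
By the maximum modulus principle for \<open>exp (- \<i> * H)\<close> it would then be constant, with a value different from its
boundary limit.\<close>

lemma Im_le_boundary_limit:
  assumes S: "open S" "connected S" "bounded S" and H: "H holomorphic_on S"
    and lim: "\<And>q. q \<in> frontier S \<Longrightarrow> ((\<lambda>w. Im (H w)) \<longlongrightarrow> C) (at q within S)"
    and z: "z \<in> S"
  shows "Im (H z) \<le> C"
proof (rule ccontr)
  assume "\<not> Im (H z) \<le> C"
  define m where "m = (C + Im (H z)) / 2"
  have m: "C < m" "m < Im (H z)" using \<open>\<not> Im (H z) \<le> C\<close> by (auto simp: m_def)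
  have cont: "continuous_on S (\<lambda>w. Im (H w))"
    by (intro continuous_intros holomorphic_on_imp_continuous_on[OF H])
  define K where "K = {w \<in> S. m \<le> Im (H w)}"
  have "closed K" unfolding closed_sequential_limits
  proof (intro allI impI, elim conjE)
    fix x q assume x: "\<forall>n. x n \<in> K" "x \<longlonglongrightarrow> q"
    have xS: "x n \<in> S" "m \<le> Im (H (x n))" for n using x(1) by (auto simp: K_def)
    show "q \<in> K"
    proof (cases "q \<in> S")
      case True
      have "isCont (\<lambda>w. Im (H w)) q" using cont S(1) True continuous_on_eq_continuous_at by blast
      then have "(\<lambda>n. Im (H (x n))) \<longlonglongrightarrow> Im (H q)" using x(2) isCont_tendsto_compose by blast
      then have "m \<le> Im (H q)" by (rule LIMSEQ_le_const) (use xS in auto)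
      then show ?thesis using True by (simp add: K_def)
    next
      case False
      have "q \<in> closure S" using xS(1) x(2) closure_sequential by blast
      then have qf: "q \<in> frontier S" using False S(1) by (simp add: frontier_def interior_open)
      have "filterlim x (at q within S) sequentially"
        unfolding filterlim_at using x(2) xS(1) False by (auto intro!: always_eventually)
      then have "(\<lambda>n. Im (H (x n))) \<longlonglongrightarrow> C" using lim[OF qf] filterlim_compose by blast
      then have "m \<le> C" by (rule LIMSEQ_le_const) (use xS in auto)
      then show ?thesis using m by simp
    qed
  qed
  moreover have "bounded K" using S(3) by (rule bounded_subset) (auto simp: K_def)
  ultimately have "compact K" by (simp add: compact_eq_bounded_closed)
  moreover have "z \<in> K" using z m by (simp add: K_def)
  moreover have "continuous_on K (\<lambda>w. Im (H w))" using cont by (rule continuous_on_subset) (auto simp: K_def)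
  ultimately obtain \<xi> where \<xi>: "\<xi> \<in> K" "\<And>w. w \<in> K \<Longrightarrow> Im (H w) \<le> Im (H \<xi>)"
    using continuous_attains_sup[of K "\<lambda>w. Im (H w)"] by blast
  have \<xi>S: "\<xi> \<in> S" "m \<le> Im (H \<xi>)" using \<xi>(1) by (auto simp: K_def)
  have max: "Im (H w) \<le> Im (H \<xi>)" if "w \<in> S" for w
    using \<xi>(2)[of w] that \<xi>S(2) by (cases "m \<le> Im (H w)") (auto simp: K_def)
  have "(\<lambda>w. exp (- \<i> * H w)) constant_on S"
  proof (rule maximum_modulus_principle[OF _ S(1,2) S(1) order_refl \<xi>S(1)])
    show "(\<lambda>w. exp (- \<i> * H w)) holomorphic_on S" by (intro holomorphic_intros H)
    show "norm (exp (- \<i> * H w)) \<le> norm (exp (- \<i> * H \<xi>))" if "w \<in> S" for w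
      using max[OF that] by (simp add: norm_exp_eq_Re)
  qed
  then have "exp (- \<i> * H w) = exp (- \<i> * H \<xi>)" if "w \<in> S" for w using that \<xi>S(1) unfolding constant_on_def by auto
  then have "norm (exp (- \<i> * H w)) = norm (exp (- \<i> * H \<xi>))" if "w \<in> S" for w using that by simp
  then have const: "Im (H w) = Im (H \<xi>)" if "w \<in> S" for w using that by (simp add: norm_exp_eq_Re)
  have "S \<noteq> UNIV" using S(3) not_bounded_UNIV by blast
  then have "frontier S \<noteq> {}" using z frontier_eq_empty by blast
  then obtain q where q: "q \<in> frontier S" by blast
  have "((\<lambda>w. Im (H w)) \<longlongrightarrow> Im (H \<xi>)) (at q within S)"
    by (rule tendsto_eventually) (auto simp: eventually_at_filter const)
  then have "C = Im (H \<xi>)" using tendsto_unique[OF at_within_frontier_nontrivial[OF S(1) q] lim[OF q]] by blast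
  then show False using m \<xi>S by simp
qed

text \<open>The estimate for \<open>H\<close> and for \<open>- H\<close> makes \<open>Im H\<close> constant, and a holomorphic function \<open>exp (- \<i> * H)\<close> of constant modulus is
constant.\<close>

lemma deriv_zero_if_Im_boundary_limit:
  assumes S: "open S" "connected S" "bounded S" and H: "H holomorphic_on S"
    and lim: "\<And>q. q \<in> frontier S \<Longrightarrow> ((\<lambda>w. Im (H w)) \<longlongrightarrow> C) (at q within S)"
    and z: "z \<in> S"
  shows "deriv H z = 0"
proof -
  have const: "Im (H w) = C" if "w \<in> S" for w
  proof (rule antisym)
    show "Im (H w) \<le> C" using Im_le_boundary_limit[OF S H lim that] .
    have "Im (- H w) \<le> - C"
    proof (rule Im_le_boundary_limit[OF S _ _ that])
      show "(\<lambda>w. - H w) holomorphic_on S" by (intro holomorphic_intros H)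
      show "((\<lambda>w. Im (- H w)) \<longlongrightarrow> - C) (at q within S)" if "q \<in> frontier S" for q
        using tendsto_minus[OF lim[OF that]] by simp
    qed
    then show "C \<le> Im (H w)" by simp
  qed
  have "(\<lambda>w. exp (- \<i> * H w)) constant_on S"
  proof (rule maximum_modulus_principle[OF _ S(1,2) S(1) order_refl z])
    show "(\<lambda>w. exp (- \<i> * H w)) holomorphic_on S" by (intro holomorphic_intros H)
    show "norm (exp (- \<i> * H w)) \<le> norm (exp (- \<i> * H z))" if "w \<in> S" for w
      using const[OF that] const[OF z] by (simp add: norm_exp_eq_Re)
  qed
  then obtain k where k: "\<And>w. w \<in> S \<Longrightarrow> exp (- \<i> * H w) = k" unfolding constant_on_def by blast
  have dH: "(H has_field_derivative deriv H z) (at z)" using H S(1) z holomorphic_derivI by blast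
  have "((\<lambda>w. exp (- \<i> * H w)) has_field_derivative exp (- \<i> * H z) * (- \<i> * deriv H z)) (at z)"
    using dH by (auto intro!: derivative_eq_intros)
  moreover have "((\<lambda>w. exp (- \<i> * H w)) has_field_derivative 0) (at z)"
    by (rule has_field_derivative_transform_within_open[OF _ S(1) z, of "\<lambda>_. k"]) (use k in auto)
  ultimately have "exp (- \<i> * H z) * (- \<i> * deriv H z) = 0" by (rule DERIV_unique)
  then show ?thesis by simp
qed

text \<open>The points with \<open>norm (f z) \<le> \<rho>\<close> form the compact set \<open>g ` cball 0 \<rho>\<close>, which keeps away from the frontier.\<close>

lemma norm_tendsto_1_at_frontier:
  fixes f g :: "complex \<Rightarrow> complex"
  assumes S: "open S" and g: "continuous_on (ball 0 1) g"
    and fg: "\<And>z. z \<in> S \<Longrightarrow> f z \<in> ball 0 1 \<and> g (f z) = z" "\<And>z. z \<in> ball 0 1 \<Longrightarrow> g z \<in> S"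
    and q: "q \<in> frontier S"
  shows "((\<lambda>w. norm (f w)) \<longlongrightarrow> 1) (at q within S)"
proof (rule order_tendstoI)
  fix \<rho> :: real assume "\<rho> < 1"
  define K where "K = g ` cball 0 \<rho>"
  have sub: "cball 0 \<rho> \<subseteq> ball (0::complex) 1" using \<open>\<rho> < 1\<close> by auto
  have "compact K" unfolding K_def by (intro compact_continuous_image continuous_on_subset[OF g sub]) auto
  then have "open (- K)" using compact_imp_closed by auto
  moreover have "K \<subseteq> S" using fg(2) sub by (auto simp: K_def)
  moreover have "q \<notin> S" using q S by (auto simp: frontier_def interior_open)
  ultimately have "\<forall>\<^sub>F w in at q within S. w \<in> - K"
    by (intro topological_tendstoD[OF tendsto_ident_at]) auto
  moreover have "\<forall>\<^sub>F w in at q within S. w \<in> S" by (simp add: eventually_at_filter)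
  ultimately show "\<forall>\<^sub>F w in at q within S. \<rho> < norm (f w)"
  proof eventually_elim
    case (elim w)
    show ?case
    proof (rule ccontr)
      assume "\<not> \<rho> < norm (f w)"
      then have "g (f w) \<in> K" by (auto simp: K_def)
      then show False using elim fg(1) by auto
    qed
  qed
next
  fix \<rho> :: real assume "1 < \<rho>"
  have "\<forall>\<^sub>F w in at q within S. w \<in> S" by (simp add: eventually_at_filter)
  then show "\<forall>\<^sub>F w in at q within S. norm (f w) < \<rho>"
    by eventually_elim (use fg(1) \<open>1 < \<rho>\<close> in force)
qed

lemma moebius_norm:
  assumes "norm a < 1" "norm \<zeta> < 1"
  shows "1 - (norm ((\<zeta> - a) / (1 - cnj a * \<zeta>)))\<^sup>2 = (1 - (norm a)\<^sup>2) * (1 - (norm \<zeta>)\<^sup>2) / (norm (1 - cnj a * \<zeta>))\<^sup>2"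
    "norm (1 - cnj a * \<zeta>) \<ge> 1 - norm a" "1 - cnj a * \<zeta> \<noteq> 0"
proof -
  have "norm (cnj a * \<zeta>) \<le> norm a * 1" unfolding norm_mult using assms by (intro mult_mono) auto
  then show ge: "norm (1 - cnj a * \<zeta>) \<ge> 1 - norm a"
    using norm_triangle_ineq2[of 1 "cnj a * \<zeta>"] by simp
  then show nz: "1 - cnj a * \<zeta> \<noteq> 0" using assms(1) by auto
  have "(norm (1 - cnj a * \<zeta>))\<^sup>2 - (norm (\<zeta> - a))\<^sup>2 = (1 - (norm a)\<^sup>2) * (1 - (norm \<zeta>)\<^sup>2)"
    unfolding cmod_power2 by (simp add: power2_eq_square algebra_simps)
  then show "1 - (norm ((\<zeta> - a) / (1 - cnj a * \<zeta>)))\<^sup>2 = (1 - (norm a)\<^sup>2) * (1 - (norm \<zeta>)\<^sup>2) / (norm (1 - cnj a * \<zeta>))\<^sup>2"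
    using nz by (simp add: norm_divide power_divide field_simps)
qed

text \<open>By \<open>moebius_norm\<close> the defect \<open>1 - (norm \<zeta>)\<^sup>2\<close> changes under the Moebius map at most by a constant factor.\<close>

lemma ln_moebius_tendsto_0:
  fixes f :: "'a \<Rightarrow> complex"
  assumes a: "norm a < 1" and f: "((\<lambda>x. norm (f x)) \<longlongrightarrow> 1) F" and lt: "\<forall>\<^sub>F x in F. norm (f x) < 1"
  shows "((\<lambda>x. ln (norm ((f x - a) / (1 - cnj a * f x)))) \<longlongrightarrow> 0) F"
proof -
  define m where "m x = norm ((f x - a) / (1 - cnj a * f x))" for x
  define k where "k = (1 - (norm a)\<^sup>2) / (1 - norm a)\<^sup>2"
  have a2: "(norm a)\<^sup>2 \<le> 1" using a by (simp add: power_le_one)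
  have bd: "\<forall>\<^sub>F x in F. 1 - k * (1 - (norm (f x))\<^sup>2) \<le> (m x)\<^sup>2 \<and> (m x)\<^sup>2 \<le> 1"
    using lt
  proof eventually_elim
    case (elim x)
    have f2: "(norm (f x))\<^sup>2 \<le> 1" using elim by (simp add: power_le_one)
    note mm = moebius_norm[OF a elim]
    have "1 - (m x)\<^sup>2 \<le> (1 - (norm a)\<^sup>2) * (1 - (norm (f x))\<^sup>2) / (1 - norm a)\<^sup>2"
      unfolding m_def mm(1) using a a2 f2 mm(2) by (intro divide_left_mono power_mono mult_pos_pos) (auto simp: mm(3))
    then have "1 - (m x)\<^sup>2 \<le> k * (1 - (norm (f x))\<^sup>2)" by (simp add: k_def)
    moreover have "0 \<le> 1 - (m x)\<^sup>2" unfolding m_def mm(1) using a2 f2 by (intro divide_nonneg_nonneg mult_nonneg_nonneg) auto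
    ultimately show ?case by linarith
  qed
  have "((\<lambda>x. 1 - k * (1 - (norm (f x))\<^sup>2)) \<longlongrightarrow> 1 - k * (1 - 1\<^sup>2)) F" by (intro tendsto_intros f)
  then have lower: "((\<lambda>x. 1 - k * (1 - (norm (f x))\<^sup>2)) \<longlongrightarrow> 1) F" by simp
  have "((\<lambda>x. (m x)\<^sup>2) \<longlongrightarrow> 1) F"
  proof (rule tendsto_sandwich[OF _ _ lower tendsto_const])
    show "\<forall>\<^sub>F x in F. 1 - k * (1 - (norm (f x))\<^sup>2) \<le> (m x)\<^sup>2" using bd by eventually_elim simp
    show "\<forall>\<^sub>F x in F. (m x)\<^sup>2 \<le> 1" using bd by eventually_elim simp
  qed
  then have "((\<lambda>x. sqrt ((m x)\<^sup>2)) \<longlongrightarrow> sqrt 1) F" by (rule tendsto_real_sqrt)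
  moreover have "sqrt ((m x)\<^sup>2) = m x" for x by (simp add: m_def)
  ultimately have "(m \<longlongrightarrow> 1) F" by simp
  then have "((\<lambda>x. ln (m x)) \<longlongrightarrow> ln 1) F" by (intro tendsto_ln) auto
  then show ?thesis by (simp add: m_def)
qed

definition diff_quot :: "(complex \<Rightarrow> complex) \<Rightarrow> complex \<Rightarrow> complex \<Rightarrow> complex" where
  "diff_quot f a z = (if z = a then deriv f a else (f z - f a) / (z - a))"

text \<open>For a Riemann map \<open>f\<close> the function \<open>ln (norm ((z - a) * green_regular f a z))\<close> is the Green function with pole \<open>a\<close> and
boundary values zero; dividing by \<open>z - a\<close> leaves a holomorphic function without zeros.\<close>

definition green_regular :: "(complex \<Rightarrow> complex) \<Rightarrow> complex \<Rightarrow> complex \<Rightarrow> complex" where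
  "green_regular f a z = diff_quot f a z / (1 - cnj (f a) * f z)"

text \<open>The logarithmic derivative of \<open>green_regular f a\<close>. At \<open>z = a\<close> the difference of the two poles is replaced by its limit.\<close>

definition green_log_deriv :: "(complex \<Rightarrow> complex) \<Rightarrow> complex \<Rightarrow> complex \<Rightarrow> complex" where
  "green_log_deriv f a z = cnj (f a) * deriv f z / (1 - cnj (f a) * f z) +
     (if z = a then deriv (deriv f) a / (2 * deriv f a) else deriv f z / (f z - f a) - 1 / (z - a))"

lemma diff_quot_holomorphic: "f holomorphic_on S \<Longrightarrow> open S \<Longrightarrow> diff_quot f a holomorphic_on S"
  unfolding diff_quot_def by (rule pole_lemma_open)

text \<open>Differentiate \<open>f z = f a + (z - a) * diff_quot f a z\<close> twice at \<open>a\<close>.\<close>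

lemma deriv_diff_quot_self:
  assumes f: "f holomorphic_on S" "open S" "a \<in> S"
  shows "deriv (diff_quot f a) a = deriv (deriv f) a / 2"
proof -
  define q where "q = diff_quot f a"
  have q: "q holomorphic_on S" unfolding q_def by (rule diff_quot_holomorphic[OF f(1,2)])
  have dq: "(q has_field_derivative deriv q z) (at z)" if "z \<in> S" for z
    using q f(2) that holomorphic_derivI by blast
  have ddq: "(deriv q has_field_derivative deriv (deriv q) z) (at z)" if "z \<in> S" for z
    using holomorphic_deriv[OF q f(2)] f(2) that holomorphic_derivI by blast
  have f_eq: "f z = f a + (z - a) * q z" for z by (simp add: q_def diff_quot_def)
  have "((\<lambda>z. f a + (z - a) * q z) has_field_derivative q z + (z - a) * deriv q z) (at z)" if "z \<in> S" for z
    by (auto intro!: derivative_eq_intros dq[OF that])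
  then have df: "(f has_field_derivative q z + (z - a) * deriv q z) (at z)" if "z \<in> S" for z
    using that f_eq by (metis (no_types, lifting) ext)
  then have df': "deriv f z = q z + (z - a) * deriv q z" if "z \<in> S" for z using that DERIV_imp_deriv by blast
  have "((\<lambda>z. q z + (z - a) * deriv q z) has_field_derivative 2 * deriv q a) (at a)"
    by (auto intro!: derivative_eq_intros dq[OF f(3)] ddq[OF f(3)])
  then have "(deriv f has_field_derivative 2 * deriv q a) (at a)"
    by (rule has_field_derivative_transform_within_open[OF _ f(2,3)]) (simp add: df')
  then show ?thesis using DERIV_imp_deriv by (fastforce simp: q_def)
qed

text \<open>The difference quotient of an injective function has no zeros: for \<open>z \<noteq> a\<close> by injectivity, and at \<open>a\<close> because the derivative of an
injective holomorphic function does not vanish.\<close>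

lemma green_regular_properties:
  assumes f: "f holomorphic_on S" "open S" "inj_on f S" "\<And>z. z \<in> S \<Longrightarrow> norm (f z) < 1"
    and a: "a \<in> S"
  shows "green_regular f a holomorphic_on S"
    and "z \<in> S \<Longrightarrow> green_regular f a z \<noteq> 0"
    and "z \<in> S \<Longrightarrow> deriv (green_regular f a) z / green_regular f a z = green_log_deriv f a z"
proof -
  have nz: "1 - cnj (f a) * f z \<noteq> 0" if "z \<in> S" for z using moebius_norm(3) f(4)[OF a] f(4)[OF that] by blast
  have q: "diff_quot f a holomorphic_on S" by (rule diff_quot_holomorphic[OF f(1,2)])
  show "green_regular f a holomorphic_on S"
    unfolding green_regular_def by (intro holomorphic_intros q f(1) nz)
  have qnz: "diff_quot f a z \<noteq> 0" if "z \<in> S" for z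
    using holomorphic_injective_imp_regular[OF f(1,2,3) a] f(3) a that
    by (auto simp: diff_quot_def inj_on_def)
  show "green_regular f a z \<noteq> 0" if "z \<in> S" using nz[OF that] qnz[OF that] by (simp add: green_regular_def)
  show "deriv (green_regular f a) z / green_regular f a z = green_log_deriv f a z" if z: "z \<in> S"
  proof -
    define D where "D = 1 - cnj (f a) * f z"
    define Q where "Q = diff_quot f a z"
    have DQ: "D \<noteq> 0" "Q \<noteq> 0" using nz[OF z] qnz[OF z] by (auto simp: D_def Q_def)
    have dq: "(diff_quot f a has_field_derivative deriv (diff_quot f a) z) (at z)" using q f(2) z holomorphic_derivI by blast
    have df: "(f has_field_derivative deriv f z) (at z)" using f(1,2) z holomorphic_derivI by blast
    have "(green_regular f a has_field_derivative
       (deriv (diff_quot f a) z * D - Q * (- cnj (f a) * deriv f z)) / (D * D)) (at z)"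
    proof -
      have "((\<lambda>z. 1 - cnj (f a) * f z) has_field_derivative - cnj (f a) * deriv f z) (at z)"
        using df by (auto intro!: derivative_eq_intros)
      from DERIV_divide[OF dq this nz[OF z]] show ?thesis
        unfolding green_regular_def D_def Q_def .
    qed
    then have e1: "deriv (green_regular f a) z = (deriv (diff_quot f a) z * D - Q * (- cnj (f a) * deriv f z)) / (D * D)"
      by (rule DERIV_imp_deriv)
    have e2: "green_regular f a z = Q / D" by (simp add: green_regular_def Q_def D_def)
    have 1: "deriv (green_regular f a) z / green_regular f a z = deriv (diff_quot f a) z / Q + cnj (f a) * deriv f z / D"
      unfolding e1 e2 using DQ by (simp add: field_simps)
    have "deriv (diff_quot f a) z / Q = (if z = a then deriv (deriv f) a / (2 * deriv f a) else deriv f z / (f z - f a) - 1 / (z - a))"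
    proof (cases "z = a")
      case True
      have "Q = deriv f a" using True by (simp add: Q_def diff_quot_def)
      then show ?thesis unfolding True deriv_diff_quot_self[OF f(1,2) a] by simp
    next
      case False
      have fz: "f z - f a \<noteq> 0" using f(3) a z False by (auto simp: inj_on_def)
      have "((\<lambda>z. (f z - f a) / (z - a)) has_field_derivative (deriv f z * (z - a) - (f z - f a)) / ((z - a) * (z - a))) (at z)"
        using False df by (auto intro!: derivative_eq_intros)
      then have "(diff_quot f a has_field_derivative (deriv f z * (z - a) - (f z - f a)) / ((z - a) * (z - a))) (at z)"
        by (rule has_field_derivative_transform_within_open[where S="- {a}"]) (use False in \<open>auto simp: diff_quot_def\<close>)
      then have e3: "deriv (diff_quot f a) z = (deriv f z * (z - a) - (f z - f a)) / ((z - a) * (z - a))" by (rule DERIV_imp_deriv)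
      have e4: "Q = (f z - f a) / (z - a)" using False by (simp add: Q_def diff_quot_def)
      have "(p * d - u) / (d * d) / (u / d) = p / u - 1 / d" if "d \<noteq> 0" "u \<noteq> 0" for p d u :: complex
        using that by (simp add: field_simps)
      then show ?thesis unfolding e3 e4 using False fz by simp
    qed
    then show ?thesis using 1 by (simp add: green_log_deriv_def D_def)
  qed
qed

text \<open>With logarithms \<open>G i\<close> of the functions \<open>green_regular f (w i)\<close>, the function \<open>\<Psi> + \<i> * (\<Sum>i. \<beta> i * G i)\<close> is holomorphic.
Its imaginary part differs from the stream function by a combination of Green functions, which vanish at the boundary, so it has the
boundary values \<open>C\<close> and is constant.\<close>

lemma stream_function_determined:
  fixes \<beta> :: "'n::finite \<Rightarrow> real" and w :: "'n \<Rightarrow> complex"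
  assumes S: "open S" "simply_connected S" "bounded S"
    and f: "f holomorphic_on S" and g: "g holomorphic_on ball 0 1"
    and fg: "\<And>z. z \<in> S \<Longrightarrow> f z \<in> ball 0 1 \<and> g (f z) = z" "\<And>z. z \<in> ball 0 1 \<Longrightarrow> g z \<in> S \<and> f (g z) = z"
    and \<Psi>: "\<And>z. z \<in> S \<Longrightarrow> (\<Psi> has_field_derivative P z) (at z)"
    and w: "\<And>i. w i \<in> S"
    and lim: "\<And>q. q \<in> frontier S \<Longrightarrow> ((\<lambda>z. Im (\<Psi> z) - (\<Sum>i\<in>UNIV. \<beta> i * ln (norm (z - w i)))) \<longlongrightarrow> C) (at q within S)"
    and z: "z \<in> S"
  shows "P z = - \<i> * (\<Sum>i\<in>UNIV. \<beta> i * green_log_deriv f (w i) z)"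
proof -
  have inj: "inj_on f S" using fg(1) by (metis inj_onI)
  have lt1: "norm (f z) < 1" if "z \<in> S" for z using fg(1)[OF that] by simp
  have conn: "connected S" using S(2) by (rule simply_connected_imp_connected)
  have gr: "green_regular f (w i) holomorphic_on S"
    "z \<in> S \<Longrightarrow> green_regular f (w i) z \<noteq> 0"
    "z \<in> S \<Longrightarrow> deriv (green_regular f (w i)) z / green_regular f (w i) z = green_log_deriv f (w i) z" for i z
    using green_regular_properties[OF f S(1) inj _ w[of i]] lt1 by simp_all
  have "\<exists>G. G holomorphic_on S \<and> (\<forall>z\<in>S. green_regular f (w i) z = exp (G z))" for i
    using simply_connected_eq_holomorphic_log[OF S(1)] S(2) gr(1)[of i] gr(2)[of _ i] by simp
  then obtain G where G: "\<And>i. G i holomorphic_on S" "\<And>i z. z \<in> S \<Longrightarrow> green_regular f (w i) z = exp (G i z)" by metis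
  define H where "H z = \<Psi> z + \<i> * (\<Sum>i\<in>UNIV. \<beta> i * G i z)" for z
  have dG: "(G i has_field_derivative green_log_deriv f (w i) z) (at z)" if "z \<in> S" for i z
  proof -
    have d: "(G i has_field_derivative deriv (G i) z) (at z)" using G(1) S(1) that holomorphic_derivI by blast
    have "((\<lambda>z. exp (G i z)) has_field_derivative exp (G i z) * deriv (G i) z) (at z)"
      using d by (auto intro!: derivative_eq_intros)
    then have "(green_regular f (w i) has_field_derivative exp (G i z) * deriv (G i) z) (at z)"
      by (rule has_field_derivative_transform_within_open[OF _ S(1) that]) (simp add: G(2))
    then have "deriv (green_regular f (w i)) z = green_regular f (w i) z * deriv (G i) z"
      using DERIV_imp_deriv G(2)[OF that] by metis
    then have "deriv (G i) z = green_log_deriv f (w i) z"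
      using gr(2)[OF that, of i] gr(3)[OF that, of i] by (simp add: field_simps)
    then show ?thesis using d by simp
  qed
  have dH: "(H has_field_derivative P z + \<i> * (\<Sum>i\<in>UNIV. \<beta> i * green_log_deriv f (w i) z)) (at z)" if "z \<in> S" for z
    unfolding H_def by (intro DERIV_add \<Psi>[OF that] DERIV_cmult DERIV_sum dG[OF that])
  have Hhol: "H holomorphic_on S" using dH S(1) holomorphic_on_open by blast
  have "deriv H z = 0"
  proof (rule deriv_zero_if_Im_boundary_limit[OF S(1) conn S(3) Hhol _ z])
    fix q assume q: "q \<in> frontier S"
    define m where "m i x = ln (norm ((f x - f (w i)) / (1 - cnj (f (w i)) * f x)))" for i x
    have inS: "\<forall>\<^sub>F x in at q within S. x \<in> S" by (simp add: eventually_at_filter)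
    have m0: "(m i \<longlongrightarrow> 0) (at q within S)" for i
      unfolding m_def
    proof (rule ln_moebius_tendsto_0[OF lt1[OF w]])
      show "((\<lambda>x. norm (f x)) \<longlongrightarrow> 1) (at q within S)"
        by (rule norm_tendsto_1_at_frontier[OF S(1) holomorphic_on_imp_continuous_on[OF g] fg(1) _ q]) (use fg(2) in auto)
      show "\<forall>\<^sub>F x in at q within S. norm (f x) < 1" using inS by eventually_elim (rule lt1)
    qed
    have "((\<lambda>x. (Im (\<Psi> x) - (\<Sum>i\<in>UNIV. \<beta> i * ln (norm (x - w i)))) + (\<Sum>i\<in>UNIV. \<beta> i * m i x)) \<longlongrightarrow> C + (\<Sum>i\<in>UNIV. \<beta> i * 0)) (at q within S)"
      by (intro tendsto_add lim[OF q] tendsto_sum tendsto_mult tendsto_const m0)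
    moreover have "\<forall>\<^sub>F x in at q within S. (Im (\<Psi> x) - (\<Sum>i\<in>UNIV. \<beta> i * ln (norm (x - w i)))) + (\<Sum>i\<in>UNIV. \<beta> i * m i x) = Im (H x)"
    proof -
      have qS: "q \<notin> S" using q S(1) by (auto simp: frontier_def interior_open)
      have "open (- range w)" by (simp add: finite_imp_closed open_Compl)
      then have "\<forall>\<^sub>F x in at q within S. x \<in> - range w"
        by (rule topological_tendstoD[OF tendsto_ident_at]) (use qS w in auto)
      then show ?thesis using inS
      proof eventually_elim
        case (elim x)
        have "m i x - ln (norm (x - w i)) = Re (G i x)" for i
        proof -
          have ne: "x \<noteq> w i" using elim(1) by auto
          have "green_regular f (w i) x * (x - w i) = (f x - f (w i)) / (1 - cnj (f (w i)) * f x)"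
            using ne by (simp add: green_regular_def diff_quot_def)
          then have "norm (exp (G i x)) * norm (x - w i) = norm ((f x - f (w i)) / (1 - cnj (f (w i)) * f x))"
            unfolding G(2)[OF elim(2), symmetric] by (simp flip: norm_mult)
          then have "m i x = ln (norm (exp (G i x)) * norm (x - w i))" by (simp add: m_def)
          also have "\<dots> = ln (norm (exp (G i x))) + ln (norm (x - w i))" using ne by (intro ln_mult_pos) auto
          finally show ?thesis by (simp add: norm_exp_eq_Re)
        qed
        then have "m i x = ln (norm (x - w i)) + Re (G i x)" for i by (simp add: diff_eq_eq add.commute)
        then have "\<beta> i * m i x = \<beta> i * ln (norm (x - w i)) + \<beta> i * Re (G i x)" for i
          by (simp add: distrib_left)
        then have "(\<Sum>i\<in>UNIV. \<beta> i * m i x) = (\<Sum>i\<in>UNIV. \<beta> i * ln (norm (x - w i))) + (\<Sum>i\<in>UNIV. \<beta> i * Re (G i x))"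
          by (simp add: sum.distrib)
        then show ?case by (simp add: H_def Re_sum)
      qed
    qed
    ultimately show "((\<lambda>x. Im (H x)) \<longlongrightarrow> C) (at q within S)"
      using tendsto_cong by force
  qed
  then have "P z + \<i> * (\<Sum>i\<in>UNIV. \<beta> i * green_log_deriv f (w i) z) = 0" using DERIV_imp_deriv[OF dH[OF z]] by simp
  then show ?thesis by (simp add: add_eq_0_iff)
qed

section \<open>The Neumann problem in complex coordinates\<close>

text \<open>The stretch by \<open>Lambda_mat lam\<close>, which turns the equation into Laplace's equation.\<close>

definition to_plane :: "real \<Rightarrow> real^2 \<Rightarrow> complex" where
  "to_plane lam x = Complex (lam * x $ 1) (x $ 2)"

definition from_plane :: "real \<Rightarrow> complex \<Rightarrow> real^2" where
  "from_plane lam z = vector [Re z / lam, Im z]"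

text \<open>If \<open>u x = v (to_plane lam x)\<close>, this map takes the gradient of \<open>u\<close> to the complex gradient \<open>v\<^sub>1 - \<i> v\<^sub>2\<close> of \<open>v\<close>.\<close>

definition to_covector :: "real \<Rightarrow> real^2 \<Rightarrow> complex" where
  "to_covector lam v = Complex (v $ 1 / lam) (- v $ 2)"

definition from_covector :: "real \<Rightarrow> complex \<Rightarrow> real^2" where
  "from_covector lam z = vector [lam * Re z, - Im z]"

lemma bounded_linear_to_plane: "bounded_linear (to_plane lam)"
  by (simp add: linear_conv_bounded_linear[symmetric], rule linearI) (simp_all add: to_plane_def complex_eq_iff algebra_simps)

lemma bounded_linear_from_plane: "bounded_linear (from_plane lam)"
  by (simp add: linear_conv_bounded_linear[symmetric], rule linearI)
     (simp_all add: from_plane_def vec_eq_iff forall_2 add_divide_distrib)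

lemma bounded_linear_to_covector: "bounded_linear (to_covector lam)"
  by (simp add: linear_conv_bounded_linear[symmetric], rule linearI) (simp_all add: to_covector_def complex_eq_iff add_divide_distrib)

lemma bounded_linear_from_covector: "bounded_linear (from_covector lam)"
  by (simp add: linear_conv_bounded_linear[symmetric], rule linearI)
     (simp_all add: from_covector_def vec_eq_iff forall_2 algebra_simps)

lemma from_to_plane [simp]: "lam \<noteq> 0 \<Longrightarrow> from_plane lam (to_plane lam x) = x"
  by (simp add: from_plane_def to_plane_def vec_eq_iff forall_2)

lemma to_from_plane [simp]: "lam \<noteq> 0 \<Longrightarrow> to_plane lam (from_plane lam z) = z"
  by (simp add: from_plane_def to_plane_def complex_eq_iff)

lemma from_to_covector: "lam \<noteq> 0 \<Longrightarrow> from_covector lam (to_covector lam x) = x"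
  by (simp add: from_covector_def to_covector_def vec_eq_iff forall_2)

lemma to_plane_diff: "to_plane lam (x - y) = to_plane lam x - to_plane lam y"
  by (simp add: to_plane_def complex_eq_iff algebra_simps)

lemma to_plane_eq_iff: "lam \<noteq> 0 \<Longrightarrow> to_plane lam x = to_plane lam y \<longleftrightarrow> x = y"
  by (metis from_to_plane)

lemma norm_Lambda_mat: "norm (Lambda_mat lam *v x) = norm (to_plane lam x)"
  by (simp add: Lambda_mat_def to_plane_def norm_vec_def L2_set_def sum_2 matrix_vector_mult_def complex_norm)

lemma L_mat_apply [simp]: "(L_mat \<mu> lam *v x) $ 1 = \<mu> * x $ 1" "(L_mat \<mu> lam *v x) $ 2 = \<mu> * lam\<^sup>2 * x $ 2"
  by (simp_all add: L_mat_def matrix_vector_mult_def sum_2)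

lemma kfield_components:
  "kfield lam \<beta> x y $ 1 = - (\<beta> / (2 * pi) * (lam * (x - y) $ 2 / (norm (to_plane lam (x - y)))\<^sup>2))"
  "kfield lam \<beta> x y $ 2 = \<beta> / (2 * pi) * (lam * (x - y) $ 1 / (norm (to_plane lam (x - y)))\<^sup>2)"
  unfolding kfield_def norm_Lambda_mat
  by (simp_all add: J_mat_def transpose_def matrix_vector_mult_def sum_2 del: vector_minus_component)

text \<open>In complex terms the field of a dislocation is a simple pole.\<close>

lemma to_covector_kfield:
  assumes "lam \<noteq> 0"
  shows "to_covector lam (kfield lam \<beta> x y) = - \<i> * (of_real (\<beta> / (2 * pi)) * (1 / (to_plane lam x - to_plane lam y)))"
proof -
  define d where "d = to_plane lam (x - y)"
  define t where "t = \<beta> / (2 * pi)"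
  have r: "Re (1 / d) = Re d / (norm d)\<^sup>2" "Im (1 / d) = - Im d / (norm d)\<^sup>2"
    by (simp_all add: Re_divide Im_divide cmod_power2)
  have d: "Re d = lam * (x - y) $ 1" "Im d = (x - y) $ 2" by (simp_all add: d_def to_plane_def)
  have "Re (- \<i> * (of_real t * s)) = t * Im s" "Im (- \<i> * (of_real t * s)) = - (t * Re s)" for s
    by simp_all
  moreover have "Re (to_covector lam (kfield lam \<beta> x y)) = t * Im (1 / d)"
    "Im (to_covector lam (kfield lam \<beta> x y)) = - (t * Re (1 / d))"
    unfolding r d using assms
    by (simp_all add: to_covector_def kfield_components t_def del: vector_minus_component flip: d_def)
  ultimately show ?thesis
    unfolding to_plane_diff[symmetric] d_def[symmetric] t_def[symmetric] complex_eq_iff by metis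
qed

lemma has_derivative_grad:
  fixes u :: "'a::euclidean_space \<Rightarrow> real"
  assumes "u differentiable (at x)"
  shows "(u has_derivative (\<lambda>h. h \<bullet> grad u x)) (at x)"
proof -
  define D where "D = (\<Sum>i\<in>Basis. frechet_derivative u (at x) i *\<^sub>R i)"
  have "frechet_derivative u (at x) = (\<lambda>h. h \<bullet> D)"
    by (rule ext, subst frechet_derivative_expand[OF assms]) (simp add: D_def inner_sum_right mult.commute)
  then have "GDERIV u x :> D" using assms unfolding gderiv_def by (metis frechet_derivative_works)
  moreover have "D' = D" if "GDERIV u x :> D'" for D'
  proof -
    have "(\<lambda>h. h \<bullet> D') = (\<lambda>h. h \<bullet> D)"
      using that \<open>GDERIV u x :> D\<close> unfolding gderiv_def by (rule has_derivative_unique)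
    then have "(D' - D) \<bullet> D' = (D' - D) \<bullet> D" by metis
    then have "(D' - D) \<bullet> (D' - D) = 0" by (simp add: inner_diff_right)
    then show ?thesis by simp
  qed
  ultimately have "GDERIV u x :> grad u x" unfolding grad_def by (rule theI)
  then show ?thesis by (simp add: gderiv_def)
qed

text \<open>The Cauchy--Riemann equations are the symmetry of the second derivatives and the equation itself.\<close>

lemma complex_gradient_holomorphic:
  assumes \<Omega>: "open \<Omega>" and lam: "lam \<noteq> 0" and \<mu>: "\<mu> > 0" and u: "C2_on \<Omega> u"
    and div: "\<And>x. x \<in> \<Omega> \<Longrightarrow> divergence (\<lambda>y. L_mat \<mu> lam *v grad u y) x = 0"
  shows "(\<lambda>z. to_covector lam (grad u (from_plane lam z))) holomorphic_on (to_plane lam ` \<Omega>)"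
proof -
  define S where "S = to_plane lam ` \<Omega>"
  have Seq: "S = from_plane lam -` \<Omega>" using lam by (force simp: S_def)
  have "open S" unfolding Seq
    by (intro open_vimage \<Omega> linear_continuous_on bounded_linear_from_plane)
  have "\<exists>c. ((\<lambda>z. to_covector lam (grad u (from_plane lam z))) has_field_derivative c) (at z)" if z: "z \<in> S" for z
  proof -
    define x where "x = from_plane lam z"
    have x: "x \<in> \<Omega>" using z Seq by (simp add: x_def)
    define H where "H = frechet_derivative (grad u) (at x)"
    have dH: "(grad u has_derivative H) (at x)"
      using u x C1_on_has_derivative unfolding C2_on_def H_def by blast
    have linH: "linear H" using dH has_derivative_linear by blast
    have du: "(u has_derivative (\<lambda>h. h \<bullet> grad u y)) (at y)" if "y \<in> \<Omega>" for y
      using u that by (intro has_derivative_grad) (auto simp: C2_on_def C1_on_def)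
    have "axis 1 1 \<bullet> H (axis 2 1) = axis 2 1 \<bullet> H (axis 1 (1::real))"
      by (rule second_derivative_symmetric[OF \<Omega> x du dH])
    then have sym: "H (axis 2 1) $ 1 = H (axis 1 1) $ 2" by (simp add: inner_axis')
    have "((\<lambda>y. L_mat \<mu> lam *v grad u y) has_derivative (\<lambda>v. L_mat \<mu> lam *v H v)) (at x)"
      by (rule bounded_linear.has_derivative[OF matrix_vector_mul_bounded_linear dH])
    then have "frechet_derivative (\<lambda>y. L_mat \<mu> lam *v grad u y) (at x) = (\<lambda>v. L_mat \<mu> lam *v H v)"
      using frechet_derivative_at by metis
    then have "\<mu> * H (axis 1 1) $ 1 + \<mu> * lam\<^sup>2 * H (axis 2 1) $ 2 = 0"
      using div[OF x] by (simp add: divergence_def sum_2)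
    then have "\<mu> * (H (axis 1 1) $ 1 + lam\<^sup>2 * H (axis 2 1) $ 2) = 0" by (simp add: algebra_simps)
    then have tr: "H (axis 1 1) $ 1 = - (lam\<^sup>2 * H (axis 2 1) $ 2)" using \<mu> by simp
    have "((\<lambda>z. grad u (from_plane lam z)) has_derivative (\<lambda>h. H (from_plane lam h))) (at z)"
      using has_derivative_compose[OF bounded_linear_imp_has_derivative[OF bounded_linear_from_plane], of "grad u" H lam z] dH
      by (simp add: x_def)
    then have "((\<lambda>z. to_covector lam (grad u (from_plane lam z))) has_derivative (\<lambda>h. to_covector lam (H (from_plane lam h)))) (at z)"
      by (rule bounded_linear.has_derivative[OF bounded_linear_to_covector])
    moreover have "to_covector lam (H (from_plane lam h)) = Complex (- H (axis 2 1) $ 2) (- H (axis 1 1) $ 2 / lam) * h" for h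
    proof -
      have "from_plane lam h = (Re h / lam) *\<^sub>R axis 1 1 + Im h *\<^sub>R axis 2 1"
        by (simp add: from_plane_def vec_eq_iff forall_2 axis_def)
      then have "H (from_plane lam h) = (Re h / lam) *\<^sub>R H (axis 1 1) + Im h *\<^sub>R H (axis 2 1)"
        by (simp add: linear_add[OF linH] linear_cmul[OF linH])
      then show ?thesis using lam
        by (simp add: to_covector_def complex_eq_iff sym tr power2_eq_square field_simps)
    qed
    ultimately have "((\<lambda>z. to_covector lam (grad u (from_plane lam z))) has_field_derivative
        Complex (- H (axis 2 1) $ 2) (- H (axis 1 1) $ 2 / lam)) (at z)"
      unfolding has_field_derivative_def by (simp add: fun_eq_iff)
    then show ?thesis by blast
  qed
  then show ?thesis unfolding S_def[symmetric] using \<open>open S\<close> holomorphic_on_open by blast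
qed

lemma to_plane_domain:
  assumes \<Omega>: "open \<Omega>" "bounded \<Omega>" "simply_connected \<Omega>" and lam: "lam \<noteq> 0"
  shows "open (to_plane lam ` \<Omega>)" "bounded (to_plane lam ` \<Omega>)" "simply_connected (to_plane lam ` \<Omega>)"
    "frontier (to_plane lam ` \<Omega>) = to_plane lam ` frontier \<Omega>" "connected (frontier \<Omega>)"
proof -
  define S where "S = to_plane lam ` \<Omega>"
  have Seq: "S = from_plane lam -` \<Omega>" using lam by (force simp: S_def)
  show S: "open S" unfolding Seq
    by (intro open_vimage \<Omega> linear_continuous_on bounded_linear_from_plane)
  show Sb: "bounded S" unfolding S_def by (rule bounded_linear_image[OF \<Omega>(2) bounded_linear_to_plane])
  have "\<Omega> homeomorphic S"
    unfolding homeomorphic_def homeomorphism_def S_def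
    by (intro exI[of _ "to_plane lam"] exI[of _ "from_plane lam"])
       (use lam in \<open>auto simp: image_image intro!: linear_continuous_on bounded_linear_to_plane bounded_linear_from_plane\<close>)
  then show Sc: "simply_connected S" using \<Omega>(3) homeomorphic_simply_connected by blast
  have inj: "inj (to_plane lam)" using lam by (metis from_to_plane injI)
  have "closure S = to_plane lam ` closure \<Omega>"
    unfolding S_def using closure_injective_linear_image[OF bounded_linear.linear[OF bounded_linear_to_plane] inj] by blast
  then show fr: "frontier S = to_plane lam ` frontier \<Omega>"
    using S \<Omega>(1) inj by (simp add: frontier_def interior_open S_def image_set_diff)
  have "connected (frontier S)" using simply_connected_eq_frontier_properties[OF S] Sc Sb by simp
  then have "connected (from_plane lam ` frontier S)"
    by (intro connected_continuous_image linear_continuous_on bounded_linear_from_plane)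
  moreover have "from_plane lam ` frontier S = frontier \<Omega>" using lam by (simp add: fr image_image)
  ultimately show "connected (frontier \<Omega>)" by simp
qed

text \<open>Up to a constant factor, the gradient \<open>M\<close> of the stream function \<open>\<psi>\<close> is the total field \<open>E\<close>, weighted by \<open>L_mat\<close> and rotated by a quarter turn. The Neumann
condition, which concerns the normal component of the weighted field, thus says that the tangential component of \<open>M\<close> vanishes at the boundary.\<close>

lemma force_field_formula:
  fixes b :: "'n::finite \<Rightarrow> real" and Y :: "(real^2)^'n"
  assumes \<Omega>: "open \<Omega>" "bounded \<Omega>" "simply_connected \<Omega>" "C2_holder_boundary \<gamma> \<Omega>"
    and \<mu>: "\<mu> > 0" and lam: "lam \<noteq> 0"
    and Y: "Y \<in> configs \<Omega>" and u: "neumann_solution \<Omega> \<mu> lam b Y u"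
    and f: "f holomorphic_on to_plane lam ` \<Omega>" and g: "g holomorphic_on ball 0 1"
    and fg: "\<And>z. z \<in> to_plane lam ` \<Omega> \<Longrightarrow> f z \<in> ball 0 1 \<and> g (f z) = z"
      "\<And>z. z \<in> ball 0 1 \<Longrightarrow> g z \<in> to_plane lam ` \<Omega> \<and> f (g z) = z"
    and x: "x \<in> \<Omega>"
  shows "to_covector lam (grad u x) =
     - \<i> * (\<Sum>i\<in>UNIV. of_real (b i / (2 * pi)) * green_log_deriv f (to_plane lam (Y $ i)) (to_plane lam x))"
proof -
  define S where "S = to_plane lam ` \<Omega>"
  define w where "w i = to_plane lam (Y $ i)" for i
  define \<beta> where "\<beta> i = b i / (2 * pi)" for i
  note dom = to_plane_domain[OF \<Omega>(1-3) lam, folded S_def]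
  have YO: "Y $ i \<in> \<Omega>" for i using Y by (simp add: configs_def)
  then have wS: "w i \<in> S" for i by (simp add: w_def S_def)
  have uC2: "C2_on \<Omega> u" and div: "\<And>x. x \<in> \<Omega> \<Longrightarrow> divergence (\<lambda>y. L_mat \<mu> lam *v grad u y) x = 0"
    using u by (auto simp: neumann_solution_def)
  obtain D where Dc: "continuous_on (closure \<Omega>) D" and Dg: "\<And>x. x \<in> \<Omega> \<Longrightarrow> D x = grad u x"
    and bc: "\<And>x \<nu>. x \<in> frontier \<Omega> \<Longrightarrow> outer_unit_normal \<Omega> x \<nu> \<Longrightarrow>
       (L_mat \<mu> lam *v (D x + (\<Sum>i\<in>UNIV. kfield lam (b i) x (Y $ i)))) \<bullet> \<nu> = 0"
    using u unfolding neumann_solution_def by blast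
  define P where "P z = to_covector lam (grad u (from_plane lam z))" for z
  have Phol: "P holomorphic_on S"
    unfolding P_def S_def by (rule complex_gradient_holomorphic[OF \<Omega>(1) lam \<mu> uC2 div])
  have "\<exists>\<Psi>. \<forall>z\<in>S. (\<Psi> has_field_derivative P z) (at z)"
    using simply_connected_eq_global_primitive[OF dom(1)] dom(3) Phol by blast
  then obtain \<Psi> where \<Psi>: "\<And>z. z \<in> S \<Longrightarrow> (\<Psi> has_field_derivative P z) (at z)" by blast
  define h where "h z = Im (\<Psi> z) - (\<Sum>i\<in>UNIV. \<beta> i * ln (norm (z - w i)))" for z
  define \<psi> where "\<psi> x = h (to_plane lam x)" for x
  define E where "E x = D x + (\<Sum>i\<in>UNIV. kfield lam (b i) x (Y $ i))" for x
  define M where "M x = (- 1 / (\<mu> * lam)) *\<^sub>R (J_mat *v (L_mat \<mu> lam *v E x))" for x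
  have vM: "v \<bullet> M x = E x $ 1 * v $ 2 / lam - lam * E x $ 2 * v $ 1" for v x
    using \<mu> lam by (simp add: M_def inner_vec_def sum_2 power2_eq_square field_simps)
  have d\<psi>: "(\<psi> has_derivative (\<lambda>v. v \<bullet> M x)) (at x)" if x: "x \<in> \<Omega>" "\<And>i. x \<noteq> Y $ i" for x
  proof -
    define \<tau> where "\<tau> = to_plane lam x"
    have dT: "(to_plane lam has_derivative to_plane lam) (at x)"
      by (rule bounded_linear_imp_has_derivative[OF bounded_linear_to_plane])
    have \<tau>S: "\<tau> \<in> S" using x by (simp add: \<tau>_def S_def)
    have P\<tau>: "P \<tau> = to_covector lam (D x)" using lam Dg[OF x(1)] by (simp add: P_def \<tau>_def)
    have "(\<Psi> has_derivative (*) (P \<tau>)) (at \<tau>)" using \<Psi>[OF \<tau>S] by (simp add: has_field_derivative_def)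
    from has_derivative_compose[OF dT this[unfolded \<tau>_def]]
    have d1: "((\<lambda>x. Im (\<Psi> (to_plane lam x))) has_derivative (\<lambda>v. Im (P \<tau> * to_plane lam v))) (at x)"
      by (intro has_derivative_Im) (simp add: \<tau>_def)
    have d2: "((\<lambda>x. ln (norm (to_plane lam x - w i))) has_derivative
        (\<lambda>v. (to_plane lam v \<bullet> (\<tau> - w i)) / (norm (\<tau> - w i))\<^sup>2)) (at x)" for i
    proof -
      have ne: "\<tau> - w i \<noteq> 0" using x(2)[of i] lam by (simp add: \<tau>_def w_def to_plane_eq_iff)
      have a: "((\<lambda>x. to_plane lam x - w i) has_derivative to_plane lam) (at x)"
        using has_derivative_diff[OF dT has_derivative_const[of "w i"]] by simp
      have "(norm has_derivative (\<lambda>h. h \<bullet> sgn (\<tau> - w i))) (at (\<tau> - w i))" using ne by (rule has_derivative_norm)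
      from has_derivative_compose[OF a this[unfolded \<tau>_def]]
      have n: "((\<lambda>x. norm (to_plane lam x - w i)) has_derivative (\<lambda>v. to_plane lam v \<bullet> sgn (\<tau> - w i))) (at x)"
        by (simp add: \<tau>_def)
      have "(ln has_real_derivative inverse (norm (\<tau> - w i))) (at (norm (\<tau> - w i)))"
        using DERIV_ln[of "norm (\<tau> - w i)"] ne by simp
      then have "(ln has_derivative (*) (inverse (norm (\<tau> - w i)))) (at (norm (\<tau> - w i)))"
        by (simp add: has_field_derivative_def)
      from has_derivative_compose[OF n this[unfolded \<tau>_def]] show ?thesis
        by (simp add: \<tau>_def sgn_div_norm power2_eq_square divide_inverse mult_ac)
    qed
    have "(\<psi> has_derivative (\<lambda>v. Im (P \<tau> * to_plane lam v) - (\<Sum>i\<in>UNIV. \<beta> i * ((to_plane lam v \<bullet> (\<tau> - w i)) / (norm (\<tau> - w i))\<^sup>2)))) (at x)"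
      unfolding \<psi>_def h_def
      by (intro has_derivative_diff d1 has_derivative_sum has_derivative_mult_right d2)
    moreover have "Im (P \<tau> * to_plane lam v) - (\<Sum>i\<in>UNIV. \<beta> i * ((to_plane lam v \<bullet> (\<tau> - w i)) / (norm (\<tau> - w i))\<^sup>2)) = v \<bullet> M x" for v
    proof -
      have k: "kfield lam (b i) x (Y $ i) $ 1 * v $ 2 / lam - lam * kfield lam (b i) x (Y $ i) $ 2 * v $ 1
         = - (\<beta> i * ((to_plane lam v \<bullet> (\<tau> - w i)) / (norm (\<tau> - w i))\<^sup>2))" for i
      proof -
        define n where "n = (norm (\<tau> - w i))\<^sup>2"
        have n: "(norm (to_plane lam (x - Y $ i)))\<^sup>2 = n" by (simp add: n_def \<tau>_def w_def to_plane_diff)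
        have ip: "to_plane lam v \<bullet> (\<tau> - w i) = lam * v $ 1 * (lam * (x - Y $ i) $ 1) + v $ 2 * (x - Y $ i) $ 2"
          unfolding \<tau>_def w_def to_plane_diff[symmetric] by (simp add: to_plane_def inner_complex_def)
        show ?thesis
          unfolding kfield_components n ip \<beta>_def[symmetric] n_def[symmetric] using lam
          by (simp add: diff_divide_distrib add_divide_distrib algebra_simps power2_eq_square del: vector_minus_component)
      qed
      have "E x $ 1 * v $ 2 / lam - lam * E x $ 2 * v $ 1 =
        (D x $ 1 * v $ 2 / lam - lam * D x $ 2 * v $ 1) +
        (\<Sum>i\<in>UNIV. kfield lam (b i) x (Y $ i) $ 1 * v $ 2 / lam - lam * kfield lam (b i) x (Y $ i) $ 2 * v $ 1)"
      proof -
        define k1 where "k1 = (\<lambda>i. kfield lam (b i) x (Y $ i) $ 1)"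
        define k2 where "k2 = (\<lambda>i. kfield lam (b i) x (Y $ i) $ 2)"
        have E12: "E x $ 1 = D x $ 1 + sum k1 UNIV" "E x $ 2 = D x $ 2 + sum k2 UNIV"
          unfolding k1_def k2_def E_def by simp_all
        have "(\<Sum>i\<in>UNIV. k1 i * v $ 2 / lam - lam * k2 i * v $ 1) = sum k1 UNIV * v $ 2 / lam - lam * sum k2 UNIV * v $ 1"
          by (simp only: sum_subtractf sum_distrib_left sum_distrib_right sum_divide_distrib)
        then show ?thesis
          unfolding E12 by (simp add: k1_def k2_def distrib_left distrib_right add_divide_distrib)
      qed
      also have "\<dots> = (D x $ 1 * v $ 2 / lam - lam * D x $ 2 * v $ 1) - (\<Sum>i\<in>UNIV. \<beta> i * ((to_plane lam v \<bullet> (\<tau> - w i)) / (norm (\<tau> - w i))\<^sup>2))"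
        unfolding k by (simp add: sum_negf)
      also have "D x $ 1 * v $ 2 / lam - lam * D x $ 2 * v $ 1 = Im (P \<tau> * to_plane lam v)"
        unfolding P\<tau> by (simp add: to_covector_def to_plane_def)
      finally show ?thesis by (simp add: vM)
    qed
    ultimately show ?thesis by simp
  qed
  have contM: "continuous_on (closure \<Omega> - range (\<lambda>i. Y $ i)) M"
  proof -
    have "continuous_on (closure \<Omega> - range (\<lambda>i. Y $ i)) E"
      unfolding E_def
    proof (intro continuous_on_add continuous_on_sum)
      show "continuous_on (closure \<Omega> - range (\<lambda>i. Y $ i)) D" using Dc by (rule continuous_on_subset) auto
      fix i
      have nz: "norm (Lambda_mat lam *v (x - Y $ i)) \<noteq> 0" if "x \<in> closure \<Omega> - range (\<lambda>i. Y $ i)" for x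
        using that lam unfolding norm_Lambda_mat by (auto simp: to_plane_diff to_plane_eq_iff)
      have "continuous_on A (\<lambda>x. B *v (x - Y $ i))" for A and B :: "real^2^2"
        by (intro bounded_linear.continuous_on[OF matrix_vector_mul_bounded_linear] continuous_intros)
      note lin = this
      show "continuous_on (closure \<Omega> - range (\<lambda>i. Y $ i)) (\<lambda>x. kfield lam (b i) x (Y $ i))"
        unfolding kfield_def
        by (intro continuous_on_scaleR continuous_on_const continuous_on_divide continuous_on_power continuous_on_norm lin)
           (use nz in auto)
    qed
    then show ?thesis unfolding M_def
      by (intro continuous_intros bounded_linear.continuous_on[OF matrix_vector_mul_bounded_linear])
  qed
  have "\<exists>C. \<forall>q\<in>frontier \<Omega>. (\<psi> \<longlongrightarrow> C) (at q within \<Omega>)"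
  proof (rule frontier_limit_global[OF dom(5) \<Omega>(1)])
    fix p assume p: "p \<in> frontier \<Omega>"
    obtain e r \<phi> where er: "norm e = 1" "r > 0" "C2_holder \<gamma> \<phi>" "\<And>x. x \<in> ball p r \<Longrightarrow> x \<in> \<Omega> \<longleftrightarrow> \<phi> (x \<bullet> (J_mat *v e)) < x \<bullet> e"
      using \<Omega>(4) p unfolding C2_holder_boundary_def by blast
    have "p \<notin> \<Omega>" using p \<Omega>(1) by (simp add: frontier_def interior_open)
    then have "p \<in> - range (\<lambda>i. Y $ i)" using YO by auto
    moreover have "open (- range (\<lambda>i. Y $ i))" by (simp add: finite_imp_closed open_Compl)
    \<comment> \<open>The ball is shrunk until it contains no dislocation.\<close>
    ultimately obtain r1 where r1: "r1 > 0" "ball p r1 \<subseteq> - range (\<lambda>i. Y $ i)" using open_contains_ball by metis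
    define r' where "r' = min r r1"
    have r': "r' > 0" "ball p r' \<subseteq> ball p r" "ball p r' \<subseteq> - range (\<lambda>i. Y $ i)" using er(2) r1 by (auto simp: r'_def)
    obtain \<phi>' where "graph_domain \<Omega> p e r' \<phi> \<phi>'"
      using C2_holder_graph_domain[OF \<Omega>(1) er(1) r'(1) er(3), of p] er(4) r'(2) by blast
    then interpret graph_domain \<Omega> p e r' \<phi> \<phi>' .
    show "\<exists>C \<rho>. \<rho> > 0 \<and> (\<forall>q\<in>frontier \<Omega> \<inter> ball p \<rho>. (\<psi> \<longlongrightarrow> C) (at q within \<Omega>))"
    proof (rule boundary_limit[OF p])
      show "(\<psi> has_derivative (\<lambda>v. v \<bullet> M x)) (at x)" if "x \<in> \<Omega> \<inter> ball p r'" for x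
        using that r'(3) by (intro d\<psi>) auto
      show "continuous_on (closure \<Omega> \<inter> ball p r') M"
        by (rule continuous_on_subset[OF contM]) (use r'(3) in auto)
      show "M x \<bullet> (J_mat *v \<nu>) = 0" if "x \<in> frontier \<Omega> \<inter> ball p r'" "outer_unit_normal \<Omega> x \<nu>" for x \<nu>
        using bc[OF _ that(2)] that(1) by (simp add: M_def inner_J_mat E_def)
    qed
  qed
  then obtain C where C: "\<And>q. q \<in> frontier \<Omega> \<Longrightarrow> (\<psi> \<longlongrightarrow> C) (at q within \<Omega>)" by blast
  have lim: "(h \<longlongrightarrow> C) (at q within S)" if q: "q \<in> frontier S" for q
  proof -
    obtain p where p: "p \<in> frontier \<Omega>" "q = to_plane lam p" using q dom(4) by auto
    have "isCont (from_plane lam) q" by (simp add: bounded_linear_from_plane linear_continuous_at)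
    then have "(from_plane lam \<longlongrightarrow> p) (at q within S)"
      using p(2) lam by (simp add: isCont_def tendsto_within_subset[of _ _ _ UNIV])
    moreover have "\<forall>\<^sub>F z in at q within S. from_plane lam z \<in> \<Omega> \<and> from_plane lam z \<noteq> p"
      unfolding eventually_at_filter
      by (rule always_eventually) (use p(2) lam in \<open>auto simp: S_def\<close>)
    ultimately have "filterlim (from_plane lam) (at p within \<Omega>) (at q within S)"
      unfolding filterlim_at by simp
    from filterlim_compose[OF C[OF p(1)] this] show ?thesis using lam by (simp add: \<psi>_def)
  qed
  have "P (to_plane lam x) = - \<i> * (\<Sum>i\<in>UNIV. \<beta> i * green_log_deriv f (w i) (to_plane lam x))"
    by (rule stream_function_determined[OF dom(1,3,2) f[folded S_def] g fg[folded S_def] \<Psi> wS lim[unfolded h_def]])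
       (use x in \<open>auto simp: S_def\<close>)
  then show ?thesis using lam by (simp add: P_def \<beta>_def w_def)
qed

section \<open>Regularity of the Peach--Koehler force\<close>

text \<open>At dislocation \<open>l\<close> the fields \<open>kfield\<close> of the others cancel the poles \<open>1 / (z - a)\<close> in \<open>green_log_deriv\<close>. What is left is the
expression \<open>Q\<close> in \<open>f\<close>, its derivatives and conjugates, whose denominators do not vanish as long as the positions are distinct.\<close>

theorem peach_koehler_C1:
  fixes b :: "'n::finite \<Rightarrow> real"
  assumes \<Omega>: "open \<Omega>" "bounded \<Omega>" "simply_connected \<Omega>" "C2_holder_boundary \<gamma> \<Omega>"
    and \<mu>: "\<mu> > 0" and lam: "lam \<noteq> 0"
    and u0: "\<And>Y. Y \<in> configs \<Omega> \<Longrightarrow> neumann_solution \<Omega> \<mu> lam b Y (u0 Y)"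
  shows "C1_on (configs \<Omega>) (peach_koehler \<mu> lam b u0 l)"
proof (cases "\<Omega> = {}")
  case True
  then have "configs \<Omega> = ({} :: ((real^2)^'n) set)" by (auto simp: configs_def)
  then show ?thesis by (simp add: C1_on_def)
next
  case False
  define S where "S = to_plane lam ` \<Omega>"
  note dom = to_plane_domain[OF \<Omega>(1-3) lam, folded S_def]
  have "S \<noteq> {}" using False by (simp add: S_def)
  moreover have "S \<noteq> UNIV" using dom(2) not_bounded_UNIV by blast
  ultimately have "\<exists>f g. f holomorphic_on S \<and> g holomorphic_on ball 0 1 \<and>
      (\<forall>z\<in>S. f z \<in> ball 0 1 \<and> g (f z) = z) \<and> (\<forall>z\<in>ball 0 1. g z \<in> S \<and> f (g z) = z)"
    using Riemann_mapping_theorem[of S] dom(1,3) by simp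
  then obtain f g where fg0: "f holomorphic_on S \<and> g holomorphic_on ball 0 1 \<and>
      (\<forall>z\<in>S. f z \<in> ball 0 1 \<and> g (f z) = z) \<and> (\<forall>z\<in>ball 0 1. g z \<in> S \<and> f (g z) = z)"
    by (elim exE)
  then have f: "f holomorphic_on S" and g: "g holomorphic_on ball 0 1"
    and fg: "\<And>z. z \<in> S \<Longrightarrow> f z \<in> ball 0 1 \<and> g (f z) = z" "\<And>z. z \<in> ball 0 1 \<Longrightarrow> g z \<in> S \<and> f (g z) = z"
    by blast+
  have inj: "inj_on f S" using fg(1) by (metis inj_onI)
  define w where "w Y i = to_plane lam (Y $ i)" for Y :: "(real^2)^'n" and i
  define \<beta> where "\<beta> i = complex_of_real (b i / (2 * pi))" for i
  define X where "X Y = (\<Sum>i\<in>UNIV - {l}. kfield lam (b i) (Y $ l) (Y $ i)) + grad (u0 Y) (Y $ l)" for Y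
  define R where "R Y i = cnj (f (w Y i)) * deriv f (w Y l) * inverse (1 - cnj (f (w Y i)) * f (w Y l))" for Y i
  define Q where "Q Y = - \<i> * ((\<Sum>i\<in>UNIV - {l}. \<beta> i * (R Y i + deriv f (w Y l) * inverse (f (w Y l) - f (w Y i))))
      + \<beta> l * (R Y l + deriv (deriv f) (w Y l) * inverse (2 * deriv f (w Y l))))" for Y
  let ?U = "configs \<Omega> :: ((real^2)^'n) set"
  have oU: "open ?U" by (rule open_configs[OF \<Omega>(1)])
  have wS: "w Y i \<in> S" if "Y \<in> ?U" for Y i using that by (simp add: w_def S_def configs_def)
  have wne: "w Y i \<noteq> w Y l" if "Y \<in> ?U" "i \<noteq> l" for Y i
    using that lam by (auto simp: w_def to_plane_eq_iff configs_def)
  have XQ: "to_covector lam (X Y) = Q Y" if Y: "Y \<in> ?U" for Y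
  proof -
    have "Y $ l \<in> \<Omega>" using Y by (simp add: configs_def)
    from force_field_formula[OF \<Omega> \<mu> lam Y u0[OF Y] f[unfolded S_def] g fg[unfolded S_def] this]
    have "to_covector lam (grad (u0 Y) (Y $ l)) = - \<i> * (\<Sum>i\<in>UNIV. \<beta> i * green_log_deriv f (w Y i) (w Y l))"
      by (simp add: \<beta>_def w_def)
    also have "(\<Sum>i\<in>UNIV. \<beta> i * green_log_deriv f (w Y i) (w Y l))
        = (\<Sum>i\<in>UNIV - {l}. \<beta> i * green_log_deriv f (w Y i) (w Y l)) + \<beta> l * green_log_deriv f (w Y l) (w Y l)"
      by (subst sum.remove[of UNIV l]) (auto simp: add.commute)
    finally have 1: "to_covector lam (grad (u0 Y) (Y $ l)) = - \<i> * ((\<Sum>i\<in>UNIV - {l}. \<beta> i * green_log_deriv f (w Y i) (w Y l)) + \<beta> l * green_log_deriv f (w Y l) (w Y l))" .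
    have "to_covector lam (\<Sum>i\<in>UNIV - {l}. kfield lam (b i) (Y $ l) (Y $ i)) = (\<Sum>i\<in>UNIV - {l}. to_covector lam (kfield lam (b i) (Y $ l) (Y $ i)))"
      by (rule linear_sum[OF bounded_linear.linear[OF bounded_linear_to_covector]])
    also have "\<dots> = - \<i> * (\<Sum>i\<in>UNIV - {l}. \<beta> i * (1 / (w Y l - w Y i)))"
      unfolding sum_distrib_left by (rule sum.cong) (simp_all add: to_covector_kfield[OF lam] \<beta>_def w_def)
    finally have 2: "to_covector lam (\<Sum>i\<in>UNIV - {l}. kfield lam (b i) (Y $ l) (Y $ i)) = - \<i> * (\<Sum>i\<in>UNIV - {l}. \<beta> i * (1 / (w Y l - w Y i)))" .
    have "to_covector lam (X Y) = - \<i> * ((\<Sum>i\<in>UNIV - {l}. \<beta> i * (1 / (w Y l - w Y i)) + \<beta> i * green_log_deriv f (w Y i) (w Y l))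
        + \<beta> l * green_log_deriv f (w Y l) (w Y l))"
      unfolding X_def linear_add[OF bounded_linear.linear[OF bounded_linear_to_covector]] 1 2 sum.distrib
      by (simp add: distrib_left algebra_simps)
    also have "(\<Sum>i\<in>UNIV - {l}. \<beta> i * (1 / (w Y l - w Y i)) + \<beta> i * green_log_deriv f (w Y i) (w Y l))
        = (\<Sum>i\<in>UNIV - {l}. \<beta> i * (R Y i + deriv f (w Y l) * inverse (f (w Y l) - f (w Y i))))"
    proof (rule sum.cong[OF refl])
      fix i assume "i \<in> UNIV - {l}"
      then have "w Y l \<noteq> w Y i" using wne[OF Y, of i] by force
      then show "\<beta> i * (1 / (w Y l - w Y i)) + \<beta> i * green_log_deriv f (w Y i) (w Y l) =
           \<beta> i * (R Y i + deriv f (w Y l) * inverse (f (w Y l) - f (w Y i)))"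
        by (simp add: green_log_deriv_def R_def divide_inverse flip: distrib_left)
    qed
    also have "green_log_deriv f (w Y l) (w Y l) = R Y l + deriv (deriv f) (w Y l) * inverse (2 * deriv f (w Y l))"
      unfolding green_log_deriv_def R_def divide_inverse by simp
    finally show ?thesis by (simp add: Q_def)
  qed
  have "C1_on ?U Q"
  proof -
    have cw: "C1_on ?U (\<lambda>Y. w Y i)" for i
      unfolding w_def by (rule C1_on_bounded_linear_compose[OF C1_on_linear[OF bounded_linear_vec_nth] bounded_linear_to_plane])
    have hol: "C1_on ?U (\<lambda>Y. F (w Y i))" if "F holomorphic_on S" for F i
      by (rule C1_on_holomorphic_compose[OF that dom(1) cw]) (use wS in auto)
    have f': "deriv f holomorphic_on S" "deriv (deriv f) holomorphic_on S"
      using f dom(1) by (auto intro!: holomorphic_deriv)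
    have f'nz: "deriv f z \<noteq> 0" if "z \<in> S" for z
      using holomorphic_injective_imp_regular[OF f dom(1) inj that] .
    have cf: "C1_on ?U (\<lambda>Y. cnj (f (w Y i)))" for i
      by (rule C1_on_bounded_linear_compose[OF hol[OF f] bounded_linear_cnj])
    have diff: "C1_on ?U (\<lambda>Y. F Y - H Y)" if "C1_on ?U F" "C1_on ?U H" for F H :: "(real^2)^'n \<Rightarrow> complex"
      using C1_on_add[OF that(1) C1_on_mult[OF C1_on_const[of _ "-1"] that(2)]] by simp
    have cR: "C1_on ?U (\<lambda>Y. R Y i)" for i
      unfolding R_def
    proof (intro C1_on_mult C1_on_inverse diff cf hol[OF f] hol[OF f'(1)] C1_on_const)
      fix Y assume Y: "Y \<in> ?U"
      show "1 - cnj (f (w Y i)) * f (w Y l) \<noteq> 0"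
        by (rule moebius_norm(3)) (use fg(1)[OF wS[OF Y]] in auto)
    qed
    show ?thesis unfolding Q_def
    proof (intro C1_on_mult C1_on_add C1_on_sum C1_on_inverse diff cR hol[OF f] hol[OF f'(1)] hol[OF f'(2)] C1_on_const)
      show "f (w Y l) - f (w Y i) \<noteq> 0" if "i \<in> UNIV - {l}" "Y \<in> ?U" for Y i
        using wne[OF that(2), of i] wS[OF that(2)] inj that(1) by (auto simp: inj_on_def)
      show "2 * deriv f (w Y l) \<noteq> 0" if "Y \<in> ?U" for Y using f'nz[OF wS[OF that]] by simp
    qed
  qed
  then have "C1_on ?U (\<lambda>Y. from_covector lam (Q Y))" by (rule C1_on_bounded_linear_compose[OF _ bounded_linear_from_covector])
  then have "C1_on ?U X"
    by (rule C1_on_cong[OF _ oU]) (metis XQ from_to_covector[OF lam])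
  moreover have "bounded_linear (\<lambda>v. b l *\<^sub>R (J_mat *v (L_mat \<mu> lam *v v)))"
    by (intro bounded_linear_compose[OF bounded_linear_scaleR_right] bounded_linear_compose[OF matrix_vector_mul_bounded_linear] matrix_vector_mul_bounded_linear)
  ultimately have "C1_on ?U (\<lambda>Y. b l *\<^sub>R (J_mat *v (L_mat \<mu> lam *v X Y)))"
    by (rule C1_on_bounded_linear_compose)
  then show ?thesis by (simp add: X_def peach_koehler_def[abs_def])
qed

section \<open>Sliding motion of dislocations\<close>

theorem theorem2p22:
  fixes \<Omega> G :: "(real^2) set" and \<gamma> \<mu> lam T t1 :: real
    and b :: "'n::finite \<Rightarrow> real" and l :: 'n
    and u0 :: "(real^2)^'n \<Rightarrow> real^2 \<Rightarrow> real"
    and j :: "'n \<Rightarrow> (real^2)^'n \<Rightarrow> real^2"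
    and Z :: "real \<Rightarrow> (real^2)^'n" and Z0 Z1 :: "(real^2)^'n"
    and gp gm :: "real^2"
    and fp fm n f0 :: "(real^2)^'n \<Rightarrow> (real^2)^'n" and \<alpha> :: "(real^2)^'n \<Rightarrow> real"
  assumes domain: "open \<Omega>" "bounded \<Omega>" "simply_connected \<Omega>"
      "0 < \<gamma>" "\<gamma> < 1" "C2_holder_boundary \<gamma> \<Omega>"
    and elastic: "\<mu> > 0" "lam \<noteq> 0"
    and u0: "\<forall>Y\<in>configs \<Omega>. neumann_solution \<Omega> \<mu> lam b Y (u0 Y)"
    and j: "j = peach_koehler \<mu> lam b u0"
    and G: "glide_directions G"
    and sol: "T > 0" "inclusion_solution \<Omega> G j {-T..T} Z" "Z 0 = Z0" "Z0 \<in> configs \<Omega>"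
    and t1: "t1 \<in> {-T<..<T}" "Z t1 = Z1" "Z1 \<in> I_set \<Omega> G j l"
    and gpm: "max_glide G j l Z1 = {gp, gm}"
    and fpm: "fp = local_field G j l Z1 gp" "fm = local_field G j l Z1 gm"
    and n: "n = unit_normal_from_to (ambiguity \<Omega> G j l) (side \<Omega> G j l gm) (side \<Omega> G j l gp)"
    and transversal: "fm Z1 \<bullet> n Z1 > 0" "fp Z1 \<bullet> n Z1 < 0"
    and \<alpha>: "\<alpha> = (\<lambda>Y. (fm Y \<bullet> n Y) / (fm Y \<bullet> n Y - fp Y \<bullet> n Y))"
    and f0: "f0 = (\<lambda>Y. \<alpha> Y *\<^sub>R fp Y + (1 - \<alpha> Y) *\<^sub>R fm Y)"
  shows "right_unique \<Omega> G j t1 Z1 \<and>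
    (\<exists>\<delta>>0. t1 + \<delta> \<le> T \<and>
      (\<forall>t\<in>{t1..t1 + \<delta>}.
         Z t \<in> ambiguity \<Omega> G j l \<and>
         \<alpha> (Z t) \<in> {0<..<1} \<and>
         f0 (Z t) \<in> convex hull (Fset G j (Z t)) \<and>
         (Z has_vector_derivative f0 (Z t)) (at t within {t1..t1 + \<delta>})))"
proof (rule sliding_motion[OF domain(1) _ G sol(2) t1 gpm fpm n transversal \<alpha> f0])
  show "C1_on (configs \<Omega>) (j k)" for k
    unfolding j using u0 by (intro peach_koehler_C1[OF domain(1,2,3,6) elastic]) simp
qed

end
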